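(* Let $G,H$ be any finite cyclic groups. Then the free product $G*H$ embeds into $\mathrm{Homeo}^+(S^1)$ as a pseudo-fibered group; that is, there is an injective homomorphism $\rho:G*H\to\mathrm{Homeo}^+(S^1)$ whose image is a pseudo-fibered group.
   Context: $\mathrm{Homeo}^+(S^1)$ is the group of orientation-preserving homeomorphisms of the circle. Two pairs $(a,b)$, $(c,d)$ of distinct points of $S^1$ are linked if each connected component of $S^1\setminus\{a,b\}$ contains precisely one of $c,d$; otherwise they are unlinked. Let $\mathcal{M}=(S^1\times S^1\setminus\Delta)/((x,y)\sim(y,x))$, where $\Delta$ is the diagonal, be the space of unordered pairs of distinct points of $S^1$. A lamination of $S^1$ is a closed subset $\Lambda\subset\mathcal{M}$ whose elements (called leaves) are pairwise unlinked. The two points of a leaf are its endpoints. Two laminations have distinct endpoints if their sets of endpoints are disjoint. $\Lambda$ is dense if its set of endpoints is dense in $S^1$. For $G\le\mathrm{Homeo}^+(S^1)$, $\Lambda$ is $G$-invariant if the induced action of $G$ on $\mathcal{M}$ preserves $\Lambda$ set-wise. View $S^1=\partial_\infty\mathbb{H}^2$ as the boundary of the closed disk $\mathbb{D}=\mathbb{H}^2\cup\partial_\infty\mathbb{H}^2$, and identify a leaf with the geodesic of $\mathbb{H}^2$ joining its endpoints. A gap of $\Lambda$ is the closure in $\mathbb{D}$ of a connected component of $\mathbb{H}^2\setminus\Lambda$. $\Lambda$ is very full if each gap is a finite-sided ideal polygon; $\Lambda$ is loose if no two leaves share an endpoint unless they are edges of the same (necessarily unique) gap. A laminar group is a discrete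 subgroup of $\mathrm{Homeo}^+(S^1)$ admitting a dense invariant lamination. A pseudo-fibered group is a finitely generated laminar group $\Gamma$ which preserves a pair of very full loose laminations $\Lambda_1,\Lambda_2$ with distinct endpoints and such that each nontrivial element of $\Gamma$ has at most countably many fixed points in $S^1$. *)

theory Defs
  imports "HOL-Analysis.Analysis" "HOL-Algebra.Bij" "HOL-Algebra.Elementary_Groups"
begin

section \<open>Free products of groups\<close>

text \<open>The free product of \<open>G\<close> and \<open>H\<close> is the set of words in the letters
  \<open>carrier G <+> carrier H\<close> modulo the congruence generated by deleting unit letters and
  multiplying adjacent letters that come from the same factor.\<close>

abbreviation fp_words ::
    "('a, 'c) monoid_scheme \<Rightarrow> ('b, 'd) monoid_scheme \<Rightarrow> ('a + 'b) list set"
  where "fp_words G H \<equiv> lists (carrier G <+> carrier H)"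

inductive fp_eq ::
    "('a, 'c) monoid_scheme \<Rightarrow> ('b, 'd) monoid_scheme \<Rightarrow> ('a + 'b) list \<Rightarrow> ('a + 'b) list \<Rightarrow> bool"
  for G H
  where
    refl: "w \<in> fp_words G H \<Longrightarrow> fp_eq G H w w"
  | sym: "fp_eq G H v w \<Longrightarrow> fp_eq G H w v"
  | trans: "fp_eq G H u v \<Longrightarrow> fp_eq G H v w \<Longrightarrow> fp_eq G H u w"
  | one_left: "\<lbrakk>u \<in> fp_words G H; v \<in> fp_words G H\<rbrakk>
      \<Longrightarrow> fp_eq G H (u @ Inl \<one>\<^bsub>G\<^esub> # v) (u @ v)"
  | one_right: "\<lbrakk>u \<in> fp_words G H; v \<in> fp_words G H\<rbrakk>
      \<Longrightarrow> fp_eq G H (u @ Inr \<one>\<^bsub>H\<^esub> # v) (u @ v)"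
  | mult_left: "\<lbrakk>u \<in> fp_words G H; v \<in> fp_words G H; x \<in> carrier G; y \<in> carrier G\<rbrakk>
      \<Longrightarrow> fp_eq G H (u @ Inl x # Inl y # v) (u @ Inl (x \<otimes>\<^bsub>G\<^esub> y) # v)"
  | mult_right: "\<lbrakk>u \<in> fp_words G H; v \<in> fp_words G H; x \<in> carrier H; y \<in> carrier H\<rbrakk>
      \<Longrightarrow> fp_eq G H (u @ Inr x # Inr y # v) (u @ Inr (x \<otimes>\<^bsub>H\<^esub> y) # v)"

definition fp_class ::
    "('a, 'c) monoid_scheme \<Rightarrow> ('b, 'd) monoid_scheme \<Rightarrow> ('a + 'b) list \<Rightarrow> ('a + 'b) list set"
  where "fp_class G H w = {v. fp_eq G H w v}"

definition free_product ::
    "('a, 'c) monoid_scheme \<Rightarrow> ('b, 'd) monoid_scheme \<Rightarrow> ('a + 'b) list set monoid"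
  where "free_product G H =
    \<lparr>carrier = fp_class G H ` fp_words G H,
     mult = (\<lambda>A B. \<Union>a\<in>A. \<Union>b\<in>B. fp_class G H (a @ b)),
     one = fp_class G H []\<rparr>"

locale two_groups = G: group G + H: group H
  for G :: "('a, 'c) monoid_scheme" (structure) and H :: "('b, 'd) monoid_scheme" (structure)
begin

lemma fp_eq_words:
  assumes "fp_eq G H v w" shows "v \<in> fp_words G H \<and> w \<in> fp_words G H"
  using assms by induction auto

lemma fp_class_eq_iff:
  assumes "v \<in> fp_words G H"
  shows "fp_class G H v = fp_class G H w \<longleftrightarrow> fp_eq G H v w"
proof
  assume "fp_class G H v = fp_class G H w"
  moreover have "v \<in> fp_class G H v" using assms by (simp add: fp_class_def fp_eq.refl)
  ultimately show "fp_eq G H v w" by (auto simp: fp_class_def intro: fp_eq.sym)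
next
  assume "fp_eq G H v w"
  then show "fp_class G H v = fp_class G H w"
    unfolding fp_class_def by (blast intro: fp_eq.sym fp_eq.trans)
qed

lemma fp_eq_append_left:
  assumes "fp_eq G H v w" "u \<in> fp_words G H"
  shows "fp_eq G H (u @ v) (u @ w)"
  using assms
proof induction
  case (refl w)
  then show ?case by (intro fp_eq.refl) auto
next
  case (one_left u' v)
  then show ?case using fp_eq.one_left[of "u @ u'" G H v] by simp
next
  case (one_right u' v)
  then show ?case using fp_eq.one_right[of "u @ u'" G H v] by simp
next
  case (mult_left u' v x y)
  then show ?case using fp_eq.mult_left[of "u @ u'" G H v x y] by simp
next
  case (mult_right u' v x y)
  then show ?case using fp_eq.mult_right[of "u @ u'" G H v x y] by simp
next
  case (sym v w)
  then show ?case by (simp add: fp_eq.sym)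
next
  case (trans v w z)
  then show ?case using fp_eq.trans by metis
qed

lemma fp_eq_append_right:
  assumes "fp_eq G H v w" "u \<in> fp_words G H"
  shows "fp_eq G H (v @ u) (w @ u)"
  using assms
proof induction
  case (refl w)
  then show ?case by (intro fp_eq.refl) auto
next
  case (one_left u' v)
  then show ?case using fp_eq.one_left[of u' G H "v @ u"] by simp
next
  case (one_right u' v)
  then show ?case using fp_eq.one_right[of u' G H "v @ u"] by simp
next
  case (mult_left u' v x y)
  then show ?case using fp_eq.mult_left[of u' G H "v @ u" x y] by simp
next
  case (mult_right u' v x y)
  then show ?case using fp_eq.mult_right[of u' G H "v @ u" x y] by simp
next
  case (sym v w)
  then show ?case by (simp add: fp_eq.sym)
next
  case (trans v w z)
  then show ?case using fp_eq.trans by metis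
qed

lemma fp_eq_append:
  assumes "fp_eq G H u v" "fp_eq G H u' v'"
  shows "fp_eq G H (u @ u') (v @ v')"
proof (rule fp_eq.trans)
  show "fp_eq G H (u @ u') (v @ u')"
    using assms fp_eq_words by (intro fp_eq_append_right) simp_all
  show "fp_eq G H (v @ u') (v @ v')"
    using assms fp_eq_words by (intro fp_eq_append_left) simp_all
qed

lemma mult_fp_class:
  assumes "v \<in> fp_words G H" "w \<in> fp_words G H"
  shows "fp_class G H v \<otimes>\<^bsub>free_product G H\<^esub> fp_class G H w = fp_class G H (v @ w)"
proof -
  have "fp_class G H (a @ b) = fp_class G H (v @ w)"
    if "a \<in> fp_class G H v" "b \<in> fp_class G H w" for a b
  proof -
    have "fp_eq G H (v @ w) (a @ b)"
      using that by (auto simp: fp_class_def intro: fp_eq_append)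
    then show ?thesis using assms by (metis fp_class_eq_iff fp_eq_words)
  qed
  moreover have "v \<in> fp_class G H v" "w \<in> fp_class G H w"
    using assms by (auto simp: fp_class_def intro: fp_eq.refl)
  ultimately show ?thesis unfolding free_product_def monoid.simps by blast
qed

lemma carrier_free_product: "carrier (free_product G H) = fp_class G H ` fp_words G H"
  by (simp add: free_product_def)

lemma one_free_product: "\<one>\<^bsub>free_product G H\<^esub> = fp_class G H []"
  by (simp add: free_product_def)

lemma fp_word_left_inverse:
  assumes "w \<in> fp_words G H"
  shows "\<exists>v \<in> fp_words G H. fp_eq G H (v @ w) []"
  using assms
proof (induction w)
  case Nil
  then show ?case by (intro bexI[of _ "[]"]) (auto intro: fp_eq.refl)
next
  case (Cons l w)
  then obtain v where v: "v \<in> fp_words G H" "fp_eq G H (v @ w) []" by auto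
  have w: "w \<in> fp_words G H" using Cons by auto
  have "\<exists>m \<in> carrier G <+> carrier H. fp_eq G H (v @ m # l # w) (v @ w)"
  proof (cases l)
    case (Inl x)
    then have x: "x \<in> carrier G" using Cons by auto
    have "fp_eq G H (v @ Inl (inv\<^bsub>G\<^esub> x) # Inl x # w) (v @ Inl (inv\<^bsub>G\<^esub> x \<otimes>\<^bsub>G\<^esub> x) # w)"
      using x v w by (intro fp_eq.mult_left) auto
    moreover have "fp_eq G H (v @ Inl (inv\<^bsub>G\<^esub> x \<otimes>\<^bsub>G\<^esub> x) # w) (v @ w)"
      using fp_eq.one_left[OF v(1) w] x by simp
    ultimately show ?thesis using x Inl fp_eq.trans
      by (intro bexI[of _ "Inl (inv\<^bsub>G\<^esub> x)"]) blast+
  next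
    case (Inr x)
    then have x: "x \<in> carrier H" using Cons by auto
    have "fp_eq G H (v @ Inr (inv\<^bsub>H\<^esub> x) # Inr x # w) (v @ Inr (inv\<^bsub>H\<^esub> x \<otimes>\<^bsub>H\<^esub> x) # w)"
      using x v w by (intro fp_eq.mult_right) auto
    moreover have "fp_eq G H (v @ Inr (inv\<^bsub>H\<^esub> x \<otimes>\<^bsub>H\<^esub> x) # w) (v @ w)"
      using fp_eq.one_right[OF v(1) w] x by simp
    ultimately show ?thesis using x Inr fp_eq.trans
      by (intro bexI[of _ "Inr (inv\<^bsub>H\<^esub> x)"]) blast+
  qed
  then obtain m where m: "m \<in> carrier G <+> carrier H" "fp_eq G H (v @ m # l # w) (v @ w)"
    by blast
  have "fp_eq G H ((v @ [m]) @ l # w) []"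
    using fp_eq.trans[OF m(2) v(2)] by simp
  moreover have "v @ [m] \<in> fp_words G H" using v m by auto
  ultimately show ?case by blast
qed

lemma group_free_product: "group (free_product G H)"
proof (rule groupI)
  fix A B assume "A \<in> carrier (free_product G H)" "B \<in> carrier (free_product G H)"
  then show "A \<otimes>\<^bsub>free_product G H\<^esub> B \<in> carrier (free_product G H)"
    unfolding carrier_free_product by (elim imageE) (simp add: mult_fp_class)
next
  show "\<one>\<^bsub>free_product G H\<^esub> \<in> carrier (free_product G H)"
    by (auto simp: carrier_free_product one_free_product)
next
  fix A B C
  assume "A \<in> carrier (free_product G H)" "B \<in> carrier (free_product G H)"
    "C \<in> carrier (free_product G H)"
  then show "A \<otimes>\<^bsub>free_product G H\<^esub> B \<otimes>\<^bsub>free_product G H\<^esub> C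
      = A \<otimes>\<^bsub>free_product G H\<^esub> (B \<otimes>\<^bsub>free_product G H\<^esub> C)"
    unfolding carrier_free_product
    by (elim imageE) (simp add: mult_fp_class)
next
  fix A assume "A \<in> carrier (free_product G H)"
  then show "\<one>\<^bsub>free_product G H\<^esub> \<otimes>\<^bsub>free_product G H\<^esub> A = A"
    unfolding carrier_free_product
    by (elim imageE) (simp add: one_free_product mult_fp_class)
next
  fix A assume "A \<in> carrier (free_product G H)"
  then obtain w where w: "w \<in> fp_words G H" "A = fp_class G H w"
    by (auto simp: carrier_free_product)
  obtain v where v: "v \<in> fp_words G H" "fp_eq G H (v @ w) []"
    using fp_word_left_inverse[OF w(1)] by blast
  have "fp_class G H v \<otimes>\<^bsub>free_product G H\<^esub> A = \<one>\<^bsub>free_product G H\<^esub>"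
    using v w fp_class_eq_iff fp_eq_words by (simp add: mult_fp_class one_free_product)
  then show "\<exists>B\<in>carrier (free_product G H). B \<otimes>\<^bsub>free_product G H\<^esub> A = \<one>\<^bsub>free_product G H\<^esub>"
    using v by (auto simp: carrier_free_product)
qed

lemma hom_free_product_left: "(\<lambda>x. fp_class G H [Inl x]) \<in> hom G (free_product G H)"
proof (rule homI)
  fix x y assume xy: "x \<in> carrier G" "y \<in> carrier G"
  then have "fp_eq G H [Inl x, Inl y] [Inl (x \<otimes>\<^bsub>G\<^esub> y)]"
    using fp_eq.mult_left[of "[]" G H "[]" x y] by auto
  then have "fp_class G H [Inl x, Inl y] = fp_class G H [Inl (x \<otimes>\<^bsub>G\<^esub> y)]"
    using xy by (subst fp_class_eq_iff) auto
  then show "fp_class G H [Inl (x \<otimes>\<^bsub>G\<^esub> y)]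
      = fp_class G H [Inl x] \<otimes>\<^bsub>free_product G H\<^esub> fp_class G H [Inl y]"
    using xy by (subst mult_fp_class) auto
qed (auto simp: carrier_free_product)

lemma hom_free_product_right: "(\<lambda>x. fp_class G H [Inr x]) \<in> hom H (free_product G H)"
proof (rule homI)
  fix x y assume xy: "x \<in> carrier H" "y \<in> carrier H"
  then have "fp_eq G H [Inr x, Inr y] [Inr (x \<otimes>\<^bsub>H\<^esub> y)]"
    using fp_eq.mult_right[of "[]" G H "[]" x y] by auto
  then have "fp_class G H [Inr x, Inr y] = fp_class G H [Inr (x \<otimes>\<^bsub>H\<^esub> y)]"
    using xy by (subst fp_class_eq_iff) auto
  then show "fp_class G H [Inr (x \<otimes>\<^bsub>H\<^esub> y)]
      = fp_class G H [Inr x] \<otimes>\<^bsub>free_product G H\<^esub> fp_class G H [Inr y]"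
    using xy by (subst mult_fp_class) auto
qed (auto simp: carrier_free_product)

theorem free_product_universal:
  assumes K: "group K" and f: "f \<in> hom G K" and h: "h \<in> hom H K"
  shows "\<exists>\<phi> \<in> hom (free_product G H) K.
      (\<forall>x\<in>carrier G. \<phi> (fp_class G H [Inl x]) = f x) \<and>
      (\<forall>y\<in>carrier H. \<phi> (fp_class G H [Inr y]) = h y) \<and>
      (\<forall>\<psi> \<in> hom (free_product G H) K.
        (\<forall>x\<in>carrier G. \<psi> (fp_class G H [Inl x]) = f x) \<longrightarrow>
        (\<forall>y\<in>carrier H. \<psi> (fp_class G H [Inr y]) = h y) \<longrightarrow>
        (\<forall>z\<in>carrier (free_product G H). \<psi> z = \<phi> z))"
proof -
  interpret K: group K by (rule K)
  interpret F: group "free_product G H" by (rule group_free_product)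
  note [simp] = hom_in_carrier[OF f] hom_in_carrier[OF h] hom_mult[OF f] hom_mult[OF h]
    hom_one[OF f G.is_group K] hom_one[OF h H.is_group K]
  define e where "e w = foldr (\<lambda>l k. case_sum f h l \<otimes>\<^bsub>K\<^esub> k) w \<one>\<^bsub>K\<^esub>" for w
  have e_Nil [simp]: "e [] = \<one>\<^bsub>K\<^esub>" and e_Cons [simp]: "e (l # w) = case_sum f h l \<otimes>\<^bsub>K\<^esub> e w" for l w
    by (simp_all add: e_def)
  have e_closed [simp]: "e w \<in> carrier K" if "w \<in> fp_words G H" for w
    using that by (induction w) auto
  have e_append: "e (v @ w) = e v \<otimes>\<^bsub>K\<^esub> e w" if "v \<in> fp_words G H" "w \<in> fp_words G H" for v w
    using that
  proof (induction v)
    case (Cons l v)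
    then have "case_sum f h l \<in> carrier K" by auto
    then show ?case using Cons by (simp add: K.m_assoc)
  qed simp
  have e_eq: "e v = e w" if "fp_eq G H v w" for v w
    using that by induction (simp_all add: e_append InlI InrI K.m_assoc)
  define \<phi> where "\<phi> A = e (SOME w. w \<in> A)" for A
  have \<phi>: "\<phi> (fp_class G H w) = e w" if "w \<in> fp_words G H" for w
  proof -
    have "w \<in> fp_class G H w" using that by (simp add: fp_class_def fp_eq.refl)
    then have "(SOME v. v \<in> fp_class G H w) \<in> fp_class G H w" by (rule someI)
    then show ?thesis using e_eq by (auto simp: \<phi>_def fp_class_def)
  qed
  have "\<phi> \<in> hom (free_product G H) K"
  proof (rule homI)
    fix A B assume "A \<in> carrier (free_product G H)" "B \<in> carrier (free_product G H)"
    then show "\<phi> (A \<otimes>\<^bsub>free_product G H\<^esub> B) = \<phi> A \<otimes>\<^bsub>K\<^esub> \<phi> B"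
      unfolding carrier_free_product by (elim imageE) (simp add: mult_fp_class \<phi> e_append)
  next
    fix A assume "A \<in> carrier (free_product G H)"
    then show "\<phi> A \<in> carrier K"
      unfolding carrier_free_product by (elim imageE) (simp add: \<phi>)
  qed
  moreover have "\<forall>x\<in>carrier G. \<phi> (fp_class G H [Inl x]) = f x"
    "\<forall>y\<in>carrier H. \<phi> (fp_class G H [Inr y]) = h y"
    by (simp_all add: \<phi> InlI InrI)
  moreover have "\<psi> z = \<phi> z"
    if \<psi>: "\<psi> \<in> hom (free_product G H) K"
      and l: "\<forall>x\<in>carrier G. \<psi> (fp_class G H [Inl x]) = f x"
      and r: "\<forall>y\<in>carrier H. \<psi> (fp_class G H [Inr y]) = h y"
      and z: "z \<in> carrier (free_product G H)" for \<psi> z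
  proof -
    have "\<psi> (fp_class G H w) = e w" if "w \<in> fp_words G H" for w
      using that
    proof (induction w)
      case Nil
      then show ?case using hom_one[OF \<psi> F.is_group K] by (simp add: one_free_product)
    next
      case (Cons a w)
      have "fp_class G H (a # w) = fp_class G H [a] \<otimes>\<^bsub>free_product G H\<^esub> fp_class G H w"
        using Cons by (subst mult_fp_class) auto
      also have "\<psi> \<dots> = \<psi> (fp_class G H [a]) \<otimes>\<^bsub>K\<^esub> \<psi> (fp_class G H w)"
        using Cons by (intro hom_mult[OF \<psi>]) (auto simp: carrier_free_product)
      finally show ?case using Cons l r by auto
    qed
    then show ?thesis using z unfolding carrier_free_product by (elim imageE) (simp add: \<phi>)
  qed
  ultimately show ?thesis by blast
qed

end


section \<open>Orientation-preserving homeomorphisms of the circle\<close>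

abbreviation S1 :: "complex set"
  where "S1 \<equiv> sphere 0 1"

text \<open>A homeomorphism of the circle preserves the orientation iff it lifts, along the covering
  \<open>cis\<close>, to an increasing homeomorphism of the line.\<close>

definition orientation_preserving :: "(complex \<Rightarrow> complex) \<Rightarrow> bool"
  where "orientation_preserving f \<longleftrightarrow>
    (\<exists>F F'. homeomorphism (UNIV :: real set) UNIV F F' \<and> strict_mono F \<and>
       (\<forall>t. f (cis t) = cis (F t)))"

text \<open>As in \<^const>\<open>BijGroup\<close>, the elements are maps that are \<^const>\<open>undefined\<close> off the circle, so
  that equality of elements is equality of maps \<open>S1 \<rightarrow> S1\<close>.\<close>

definition Homeo_plus :: "(complex \<Rightarrow> complex) monoid"
  where "Homeo_plus = BijGroup S1
    \<lparr>carrier := {f \<in> extensional S1. (\<exists>g. homeomorphism S1 S1 f g) \<and> orientation_preserving f}\<rparr>"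

lemma mem_Homeo_plus_iff:
  "f \<in> carrier Homeo_plus \<longleftrightarrow>
    f \<in> extensional S1 \<and> (\<exists>g. homeomorphism S1 S1 f g) \<and> orientation_preserving f"
  by (simp add: Homeo_plus_def)

lemma mem_Homeo_plusE:
  assumes "f \<in> carrier Homeo_plus"
  obtains g F F' where "f \<in> extensional S1" "homeomorphism S1 S1 f g"
    "homeomorphism (UNIV :: real set) UNIV F F'" "strict_mono F" "\<And>t. f (cis t) = cis (F t)"
  using assms unfolding mem_Homeo_plus_iff orientation_preserving_def by metis

lemma mem_Homeo_plusI:
  assumes "f \<in> extensional S1" "homeomorphism S1 S1 f g"
    "homeomorphism (UNIV :: real set) UNIV F F'" "strict_mono F" "\<And>t. f (cis t) = cis (F t)"
  shows "f \<in> carrier Homeo_plus"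
  using assms unfolding mem_Homeo_plus_iff orientation_preserving_def by metis

lemma Homeo_plus_subset_Bij:
  assumes "f \<in> carrier Homeo_plus"
  shows "f \<in> Bij S1"
proof -
  obtain g where f: "f \<in> extensional S1" "homeomorphism S1 S1 f g"
    using assms unfolding mem_Homeo_plus_iff by metis
  have "inj_on f S1"
    by (rule inj_on_inverseI[of _ g]) (rule homeomorphism_apply1[OF f(2)])
  then show ?thesis
    using f(1) homeomorphism_image1[OF f(2)] unfolding Bij_def bij_betw_def by simp
qed

lemma subgroup_Homeo_plus: "subgroup (carrier Homeo_plus) (BijGroup S1)"
proof (rule subgroup.intro)
  show "carrier Homeo_plus \<subseteq> carrier (BijGroup S1)"
    by (rule subsetI) (simp add: BijGroup_def Homeo_plus_subset_Bij)
next
  fix f g assume fg: "f \<in> carrier Homeo_plus" "g \<in> carrier Homeo_plus"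
  obtain f' F F' where f: "f \<in> extensional S1" "homeomorphism S1 S1 f f'"
    "homeomorphism (UNIV :: real set) UNIV F F'" "strict_mono F" "\<And>t. f (cis t) = cis (F t)"
    using mem_Homeo_plusE[OF fg(1)] by metis
  obtain g' E E' where g: "g \<in> extensional S1" "homeomorphism S1 S1 g g'"
    "homeomorphism (UNIV :: real set) UNIV E E'" "strict_mono E" "\<And>t. g (cis t) = cis (E t)"
    using mem_Homeo_plusE[OF fg(2)] by metis
  have "compose S1 f g \<in> carrier Homeo_plus"
  proof (rule mem_Homeo_plusI)
    show "homeomorphism S1 S1 (compose S1 f g) (g' \<circ> f')"
      by (rule homeomorphism_cong[OF homeomorphism_compose[OF g(2) f(2)]])
        (simp_all add: compose_def)
    show "homeomorphism UNIV UNIV (F \<circ> E) (E' \<circ> F')"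
      by (rule homeomorphism_compose[OF g(3) f(3)])
    show "strict_mono (F \<circ> E)"
      using f(4) g(4) by (simp add: strict_mono_def)
  qed (simp_all add: compose_def f(5) g(5))
  then show "f \<otimes>\<^bsub>BijGroup S1\<^esub> g \<in> carrier Homeo_plus"
    using fg by (simp add: BijGroup_def Homeo_plus_subset_Bij)
next
  have "(\<lambda>x\<in>S1. x) \<in> carrier Homeo_plus"
  proof (rule mem_Homeo_plusI)
    show "homeomorphism S1 S1 (\<lambda>x\<in>S1. x) id"
      by (rule homeomorphism_cong[OF homeomorphism_ident[of S1]]) simp_all
    show "homeomorphism UNIV UNIV (\<lambda>t::real. t) (\<lambda>t. t)"
      by (rule homeomorphism_ident)
  qed (simp_all add: strict_mono_def)
  then show "\<one>\<^bsub>BijGroup S1\<^esub> \<in> carrier Homeo_plus"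
    by (simp add: BijGroup_def)
next
  fix f assume fH: "f \<in> carrier Homeo_plus"
  obtain f' F F' where f: "f \<in> extensional S1" "homeomorphism S1 S1 f f'"
    "homeomorphism (UNIV :: real set) UNIV F F'" "strict_mono F" "\<And>t. f (cis t) = cis (F t)"
    using mem_Homeo_plusE[OF fH] by metis
  have inj: "inj_on f S1"
    using Homeo_plus_subset_Bij[OF fH] by (simp add: Bij_def bij_betw_def)
  have inv: "inv_into S1 f z = f' z" if "z \<in> S1" for z
  proof (rule inv_into_f_eq[OF inj])
    show "f' z \<in> S1" using homeomorphism_image2[OF f(2)] that by blast
    show "f (f' z) = z" by (rule homeomorphism_apply2[OF f(2) that])
  qed
  have FF': "F (F' t) = t" for t
    by (rule homeomorphism_apply2[OF f(3) UNIV_I])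
  have "(\<lambda>z\<in>S1. inv_into S1 f z) \<in> carrier Homeo_plus"
  proof (rule mem_Homeo_plusI)
    show "homeomorphism S1 S1 (\<lambda>z\<in>S1. inv_into S1 f z) f"
      by (rule homeomorphism_cong[OF homeomorphism_symD[OF f(2)]]) (simp_all add: inv)
    show "homeomorphism UNIV UNIV F' F"
      by (rule homeomorphism_symD[OF f(3)])
    show "strict_mono F'"
    proof (rule strict_monoI)
      fix s t :: real assume "s < t"
      then show "F' s < F' t"
        using strict_mono_less[OF f(4), of "F' s" "F' t"] by (simp add: FF')
    qed
    show "(\<lambda>z\<in>S1. inv_into S1 f z) (cis t) = cis (F' t)" for t
    proof -
      have "f' (f (cis (F' t))) = cis (F' t)"
        by (rule homeomorphism_apply1[OF f(2)]) simp
      then show ?thesis by (simp add: inv f(5) FF')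
    qed
  qed simp
  then show "inv\<^bsub>BijGroup S1\<^esub> f \<in> carrier Homeo_plus"
    using inv_BijGroup[OF Homeo_plus_subset_Bij[OF fH]] by simp
qed

lemma group_Homeo_plus: "group Homeo_plus"
  using subgroup.subgroup_is_group[OF subgroup_Homeo_plus group_BijGroup]
  by (simp add: Homeo_plus_def)

text \<open>The topology of \<open>Homeo_plus\<close> is that of uniform convergence, which on the compact circle
  is the compact-open topology.\<close>

definition Homeo_plus_topology :: "(complex \<Rightarrow> complex) topology"
  where "Homeo_plus_topology =
    subtopology (mtopology_of (cfunspace (top_of_set S1) euclidean_metric)) (carrier Homeo_plus)"

definition discrete_subgroup :: "(complex \<Rightarrow> complex) set \<Rightarrow> bool"
  where "discrete_subgroup \<Gamma> \<longleftrightarrow>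
    subgroup \<Gamma> Homeo_plus \<and> subtopology Homeo_plus_topology \<Gamma> = discrete_topology \<Gamma>"

lemma topspace_Homeo_plus_topology: "topspace Homeo_plus_topology = carrier Homeo_plus"
proof -
  have "f \<in> mspace (cfunspace (top_of_set S1) euclidean_metric)" if "f \<in> carrier Homeo_plus" for f
  proof -
    have f: "f \<in> extensional S1" "continuous_on S1 f" "f ` S1 = S1"
      using that unfolding mem_Homeo_plus_iff homeomorphism_def by metis+
    then show ?thesis
      by (simp add: Met_TC.mbounded_def compact_imp_bounded)
  qed
  then show ?thesis
    by (auto simp: Homeo_plus_topology_def)
qed


section \<open>Laminations of the circle\<close>

text \<open>An unordered pair \<open>{x, y}\<close> of distinct points is represented by the set with these two
  elements.\<close>

definition leaf_space :: "complex set set"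
  where "leaf_space = {{x, y} | x y. x \<in> S1 \<and> y \<in> S1 \<and> x \<noteq> y}"

definition leaf_topology :: "complex set topology"
  where "leaf_topology = topology (\<lambda>U. U \<subseteq> leaf_space \<and>
    openin (top_of_set (S1 \<times> S1 - Id)) {p \<in> S1 \<times> S1 - Id. {fst p, snd p} \<in> U})"

lemma openin_leaf_topology:
  "openin leaf_topology U \<longleftrightarrow> U \<subseteq> leaf_space \<and>
    openin (top_of_set (S1 \<times> S1 - Id)) {p \<in> S1 \<times> S1 - Id. {fst p, snd p} \<in> U}"
proof -
  have "istopology (\<lambda>U. U \<subseteq> leaf_space \<and>
    openin (top_of_set (S1 \<times> S1 - Id)) {p \<in> S1 \<times> S1 - Id. {fst p, snd p} \<in> U})"
  proof (unfold istopology_def, intro conjI allI impI)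
    fix U V :: "complex set set"
    assume "U \<subseteq> leaf_space \<and>
        openin (top_of_set (S1 \<times> S1 - Id)) {p \<in> S1 \<times> S1 - Id. {fst p, snd p} \<in> U}"
      and "V \<subseteq> leaf_space \<and>
        openin (top_of_set (S1 \<times> S1 - Id)) {p \<in> S1 \<times> S1 - Id. {fst p, snd p} \<in> V}"
    moreover have "{p \<in> S1 \<times> S1 - Id. {fst p, snd p} \<in> U \<inter> V} =
        {p \<in> S1 \<times> S1 - Id. {fst p, snd p} \<in> U} \<inter> {p \<in> S1 \<times> S1 - Id. {fst p, snd p} \<in> V}"
      by auto
    ultimately show "U \<inter> V \<subseteq> leaf_space"
      "openin (top_of_set (S1 \<times> S1 - Id)) {p \<in> S1 \<times> S1 - Id. {fst p, snd p} \<in> U \<inter> V}"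
      by (auto simp only: openin_Int)
  next
    fix \<K> :: "complex set set set"
    assume *: "\<forall>U\<in>\<K>. U \<subseteq> leaf_space \<and>
      openin (top_of_set (S1 \<times> S1 - Id)) {p \<in> S1 \<times> S1 - Id. {fst p, snd p} \<in> U}"
    then show "\<Union>\<K> \<subseteq> leaf_space" by auto
    have "{p \<in> S1 \<times> S1 - Id. {fst p, snd p} \<in> \<Union>\<K>} =
        (\<Union>U\<in>\<K>. {p \<in> S1 \<times> S1 - Id. {fst p, snd p} \<in> U})"
      by auto
    then show "openin (top_of_set (S1 \<times> S1 - Id)) {p \<in> S1 \<times> S1 - Id. {fst p, snd p} \<in> \<Union>\<K>}"
      using * by (simp only:) (intro openin_Union, blast)
  qed
  then show ?thesis
    by (simp add: leaf_topology_def topology_inverse')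
qed

lemma quotient_map_leaf_topology:
  "quotient_map (top_of_set (S1 \<times> S1 - Id)) leaf_topology (\<lambda>p. {fst p, snd p})"
proof -
  have image: "(\<lambda>p. {fst p, snd p}) ` (S1 \<times> S1 - Id) = leaf_space"
    by (force simp: leaf_space_def image_def)
  have preimage: "{p \<in> S1 \<times> S1 - Id. {fst p, snd p} \<in> leaf_space} = S1 \<times> S1 - Id"
    using image by blast
  have top: "topspace leaf_topology = leaf_space"
  proof (rule antisym)
    show "topspace leaf_topology \<subseteq> leaf_space"
      using openin_topspace[of leaf_topology] openin_leaf_topology by blast
    have "openin leaf_topology leaf_space"
      unfolding openin_leaf_topology preimage by simp
    then show "leaf_space \<subseteq> topspace leaf_topology" by (rule openin_subset)
  qed
  show ?thesis
    unfolding quotient_map_def top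
    using image by (simp add: openin_leaf_topology)
qed

definition linked :: "complex set \<Rightarrow> complex set \<Rightarrow> bool"
  where "linked l m \<longleftrightarrow> (\<forall>C \<in> components (S1 - l). \<exists>!p. p \<in> C \<and> p \<in> m)"

definition lamination :: "complex set set \<Rightarrow> bool"
  where "lamination \<Lambda> \<longleftrightarrow>
    closedin leaf_topology \<Lambda> \<and> (\<forall>l\<in>\<Lambda>. \<forall>m\<in>\<Lambda>. \<not> linked l m)"

definition endpoints :: "complex set set \<Rightarrow> complex set"
  where "endpoints \<Lambda> = \<Union>\<Lambda>"

definition dense_lamination :: "complex set set \<Rightarrow> bool"
  where "dense_lamination \<Lambda> \<longleftrightarrow> lamination \<Lambda> \<and> S1 \<subseteq> closure (endpoints \<Lambda>)"

definition invariant_lamination :: "(complex \<Rightarrow> complex) set \<Rightarrow> complex set set \<Rightarrow> bool"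
  where "invariant_lamination \<Gamma> \<Lambda> \<longleftrightarrow> lamination \<Lambda> \<and> (\<forall>g\<in>\<Gamma>. (\<lambda>l. g ` l) ` \<Lambda> = \<Lambda>)"

text \<open>The hyperbolic plane is taken in the projective (Klein) model: it is the open unit disk,
  the circle is its boundary at infinity, geodesics are open chords, and the ideal polygon with
  ideal vertices \<open>V\<close> is the convex hull of \<open>V\<close>.\<close>

definition geodesic :: "complex set \<Rightarrow> complex set"
  where "geodesic l = convex hull l \<inter> ball 0 1"

definition gap :: "complex set set \<Rightarrow> complex set \<Rightarrow> bool"
  where "gap \<Lambda> P \<longleftrightarrow> (\<exists>C \<in> components (ball 0 1 - (\<Union>l\<in>\<Lambda>. geodesic l)). P = closure C)"

definition ideal_polygon :: "complex set \<Rightarrow> bool"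
  where "ideal_polygon P \<longleftrightarrow> (\<exists>V \<subseteq> S1. finite V \<and> 3 \<le> card V \<and> P = convex hull V)"

definition very_full :: "complex set set \<Rightarrow> bool"
  where "very_full \<Lambda> \<longleftrightarrow> (\<forall>P. gap \<Lambda> P \<longrightarrow> ideal_polygon P)"

text \<open>An edge of a gap \<open>P\<close> is, with its ideal endpoints included, the closed chord
  \<open>convex hull l\<close>; gaps are closed convex sets, so this is an edge in the sense of
  \<^const>\<open>edge_of\<close>.\<close>

definition loose :: "complex set set \<Rightarrow> bool"
  where "loose \<Lambda> \<longleftrightarrow> (\<forall>l\<in>\<Lambda>. \<forall>m\<in>\<Lambda>. l \<noteq> m \<longrightarrow> l \<inter> m \<noteq> {} \<longrightarrow>
    (\<exists>P. gap \<Lambda> P \<and> (convex hull l) edge_of P \<and> (convex hull m) edge_of P))"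


section \<open>Pseudo-fibered groups\<close>

definition laminar_group :: "(complex \<Rightarrow> complex) set \<Rightarrow> bool"
  where "laminar_group \<Gamma> \<longleftrightarrow>
    discrete_subgroup \<Gamma> \<and> (\<exists>\<Lambda>. dense_lamination \<Lambda> \<and> invariant_lamination \<Gamma> \<Lambda>)"

definition pseudo_fibered :: "(complex \<Rightarrow> complex) set \<Rightarrow> bool"
  where "pseudo_fibered \<Gamma> \<longleftrightarrow>
    laminar_group \<Gamma> \<and>
    (\<exists>X. finite X \<and> X \<subseteq> \<Gamma> \<and> generate Homeo_plus X = \<Gamma>) \<and>
    (\<exists>\<Lambda>\<^sub>1 \<Lambda>\<^sub>2. invariant_lamination \<Gamma> \<Lambda>\<^sub>1 \<and> very_full \<Lambda>\<^sub>1 \<and> loose \<Lambda>\<^sub>1 \<and>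
       invariant_lamination \<Gamma> \<Lambda>\<^sub>2 \<and> very_full \<Lambda>\<^sub>2 \<and> loose \<Lambda>\<^sub>2 \<and>
       endpoints \<Lambda>\<^sub>1 \<inter> endpoints \<Lambda>\<^sub>2 = {}) \<and>
    (\<forall>g\<in>\<Gamma>. g \<noteq> \<one>\<^bsub>Homeo_plus\<^esub> \<longrightarrow> countable {z \<in> S1. g z = z})"

end

theory Submission imports Defs "HOL-Algebra.Multiplicative_Group" begin

text \<open>A continuous periodic height \<open>f\<close> on the line defines a lamination: \<open>cis s\<close> and \<open>cis t\<close> are
  equivalent if \<open>f s = f t\<close> and \<open>f \<ge> f s\<close> between \<open>s\<close> and \<open>t\<close>. Classes are pairwise unlinked, and
  if they are finite, their convex hulls fill the disk, so the boundary edges of the hulls form a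
  very full loose lamination. A circle homeomorphism that respects the relation preserves it.

  Let \<open>p = 2 * pi / N\<close> with \<open>N\<close> a multiple of both group orders. The group is generated by rotations
  through multiples of \<open>p\<close> and their conjugates under a Moebius involution \<open>\<phi>\<close> that maps the
  complement of the arc of radius \<open>p / 2\<close> about \<open>1\<close> strictly into this arc. Ping-pong gives
  injectivity and discreteness, and nontrivial elements fix at most two points because they are
  Moebius.

  Invariant heights have period \<open>p\<close> and are built from a self-similar function \<open>stem\<close> on an interval
  that \<open>\<phi>\<close> moves off itself. Where \<open>\<phi>\<close> is expanding, its action determines the height by a
  functional equation, and ties can be pulled back until they reach the interval. There, points tied
  to other points have base 6 expansions ending in the digits 0 and 5 only. Building a second height
  from an interval shifted by 2/5, which in base 6 is 0.222\<dots>, makes the endpoints of the two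
  laminations disjoint.\<close>

section \<open>Chords of the circle\<close>

text \<open>The obstacle is disjointness of endpoints. On an arc where a height is strictly
  monotone, every point is tied to the place where the height first returns to its value; the whole
  arc would consist of endpoints and meet the dense endpoint set of the other lamination. So the
  height must oscillate at every scale and still have finite classes. The hairs of
  \<open>stem\<close>, its excursions from 1/2 to 3/4 and back, achieve this: a tie above 1/2 stays
  inside one hair or inside the last sixth, so a point with infinitely many base 6 digits between 1
  and 4 and no terminating expansion is caught in hairs that shrink to it.

  Invariance shapes \<open>stem\<close> as well. The involution exchanges the rising and the falling
  slope of an arch but keeps the orientation, so \<open>stem\<close> and its mirror image
  \<open>stem (1 - x)\<close> must have the same ties; hence the two end pieces of equal size and
  the symmetric hairs. Two hairs give base 6. With one hair the base would be 4, and the fixed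
  points 1/3 and 2/3 of multiplication by 4 modulo 1 are closer to the integers than the combined
  tolerance 1/4 + 1/4.\<close>

definition side :: "complex \<Rightarrow> complex \<Rightarrow> complex \<Rightarrow> real"
  where "side u v x = Im (cnj (v - u) * (x - u))"

text \<open>\<open>side\<close> is twice the signed area of the triangle \<open>u\<close>,
  \<open>v\<close>, \<open>x\<close>, so a negative product says that the line through
  \<open>w\<close> and \<open>v\<close> strictly separates \<open>x\<close> and \<open>y\<close>.
  Points on that line have area 0, hence chords with a common endpoint never count as
  crossing.\<close>

definition sep :: "complex \<Rightarrow> complex \<Rightarrow> complex \<Rightarrow> complex \<Rightarrow> bool"
  where "sep w v x y \<longleftrightarrow> side w v x * side w v y < 0"

lemma side_Re_Im:
  "side u v x = (Re v - Re u) * (Im x - Im u) - (Im v - Im u) * (Re x - Re u)"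
  by (simp add: side_def algebra_simps)

lemma side_swap: "side v u x = - side u v x"
  by (simp add: side_Re_Im algebra_simps)

lemma side_rotate: "side v x u = side u v x"
  by (simp add: side_Re_Im algebra_simps)

lemma side_left [simp]: "side u v u = 0" and side_right [simp]: "side u v v = 0"
  and side_same [simp]: "side u u x = 0"
  by (simp_all add: side_Re_Im)

lemma sep_commute: "sep w v x y \<longleftrightarrow> sep w v y x" "sep w v x y \<longleftrightarrow> sep v w x y"
  by (simp_all add: sep_def mult.commute side_swap[of w v])

text \<open>Rotating the midpoint of the arc to angle 0 turns the chord into the vertical line with
  real part \<open>cos ((t - s) / 2)\<close>. The second factor keeps its meaning when the arc is a
  full turn and the chord degenerates.\<close>

lemma side_cis_cap:
  "side (cis s) (cis t) z
    = 2 * sin ((t - s) / 2) * (cos ((t - s) / 2) - Re (z * cis (- ((s + t) / 2))))"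
proof -
  have st: "s = (s + t) / 2 - (t - s) / 2" "t = (s + t) / 2 + (t - s) / 2" by (auto simp: field_simps)
  define m d where "m = (s + t) / 2" and "d = (t - s) / 2"
  have s: "s = m - d" and t: "t = m + d" using st by (simp_all add: m_def d_def)
  have "side (cis (m - d)) (cis (m + d)) z
      = 2 * sin d * (cos d * ((sin m)\<^sup>2 + (cos m)\<^sup>2) - (Re z * cos m + Im z * sin m))"
    unfolding side_Re_Im by (simp add: sin_add cos_add sin_diff cos_diff algebra_simps power2_eq_square
        del: sin_cos_squared_add sin_cos_squared_add2 sin_cos_squared_add3)
  then show ?thesis
    unfolding m_def[symmetric] d_def[symmetric] unfolding s t sin_cos_squared_add
    by (simp add: algebra_simps)
qed

text \<open>Sines of half angles are positive within one turn, so on the circle the sign of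
  \<open>side\<close> is the cyclic order of the three points.\<close>

lemma side_cis:
  "side (cis s) (cis t) (cis r) = 4 * sin ((t - s) / 2) * sin ((r - t) / 2) * sin ((r - s) / 2)"
proof -
  have "Re (cis r * cis (- ((s + t) / 2))) = cos (r - (s + t) / 2)"
    by (simp add: cis_mult algebra_simps)
  moreover have "cos ((t - s) / 2) - cos (r - (s + t) / 2)
      = 2 * sin ((r - s) / 2) * sin ((r - t) / 2)"
  proof -
    have "((t - s) / 2 + (r - (s + t) / 2)) / 2 = (r - s) / 2"
      "(r - (s + t) / 2 - (t - s) / 2) / 2 = (r - t) / 2" by (auto simp: field_simps)
    then show ?thesis unfolding cos_diff_cos by (simp only:)
  qed
  ultimately show ?thesis unfolding side_cis_cap by simp
qed

lemma sin_half_pos: "0 < x \<Longrightarrow> x < 2 * pi \<Longrightarrow> 0 < sin (x / 2)"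
  by (rule sin_gt_zero) auto

lemma side_cis_pos:
  assumes "s < t" "t < r" "r < s + 2 * pi" shows "side (cis s) (cis t) (cis r) > 0"
  unfolding side_cis using assms by (intro mult_pos_pos sin_half_pos) auto

lemma side_cis_neg:
  assumes "s < r" "r < t" "t < s + 2 * pi" shows "side (cis s) (cis t) (cis r) < 0"
  using side_cis_pos[of s r t] assms side_rotate side_swap
  by (metis neg_less_0_iff_less)

lemma S1_cis: "z \<in> S1 \<Longrightarrow> \<exists>s. z = cis s"
  by (metis cis_Arg_unique dist_0_norm mem_sphere cis_Arg sgn_div_norm  divide_self_if
      complex_norm_eq_1_exp cis_conv_exp)

lemma cis_in_S1 [simp]: "cis s \<in> S1" by simp

lemma cis_eq_iff: "cis s = cis t \<longleftrightarrow> (\<exists>k::int. s = t + 2 * pi * k)"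
proof
  assume "cis s = cis t"
  then have "exp (\<i> * complex_of_real s) = exp (\<i> * complex_of_real t)" by (simp add: cis_conv_exp)
  then obtain n :: int where "\<i> * complex_of_real s = \<i> * complex_of_real t + (of_int (2 * n) * pi) * \<i>"
    unfolding exp_eq by blast
  then have "Im (\<i> * complex_of_real s) = Im (\<i> * complex_of_real t + (of_int (2 * n) * pi) * \<i>)" by simp
  then show "\<exists>k::int. s = t + 2 * pi * k" by (intro exI[of _ n]) (simp add: algebra_simps)
next
  assume "\<exists>k::int. s = t + 2 * pi * k"
  then obtain k :: int where k: "s = t + 2 * pi * k" by blast
  show "cis s = cis t" unfolding k by (simp add: complex_eq_iff cos_add sin_add)
qed

lemma cis_shift [simp]: "cis (s + 2 * pi * of_int k) = cis s"
  using cis_eq_iff by blast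

lemma cis_2pi_add [simp]: "cis (s + 2 * pi) = cis s"
  using cis_shift[of s 1] by simp

lemma shift_into:
  fixes s r p :: real assumes "p > 0"
  obtains k :: int where "s \<le> r + p * k" "r + p * k < s + p"
proof
  define k where "k = - \<lfloor>(r - s) / p\<rfloor>"
  have q: "(r - s) / p * p = r - s" using assms by simp
  have "of_int \<lfloor>(r - s) / p\<rfloor> * p \<le> (r - s) / p * p" "(r - s) / p * p < (of_int \<lfloor>(r - s) / p\<rfloor> + 1) * p"
    using assms by (intro mult_right_mono mult_strict_right_mono; linarith)+
  then have a': "p * of_int \<lfloor>(r - s) / p\<rfloor> \<le> r - s" "r - s < p * (of_int \<lfloor>(r - s) / p\<rfloor> + 1)"
    unfolding q by (simp_all only: mult.commute)
  show "s \<le> r + p * k" "r + p * k < s + p" using a' by (simp_all add: k_def algebra_simps)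
qed

lemma S1_lift:
  assumes "z \<in> S1" obtains r where "z = cis r" "s \<le> r" "r < s + 2 * pi"
proof -
  obtain r where r: "z = cis r" using S1_cis assms by blast
  obtain k :: int where "s \<le> r + 2 * pi * k" "r + 2 * pi * k < s + 2 * pi"
    using shift_into[of "2 * pi" s r] by auto
  then show ?thesis using that[of "r + 2 * pi * k"] r by simp
qed

lemma cis_inj_window:
  assumes "cis r = cis q" "s \<le> r" "r < s + 2 * pi" "s \<le> q" "q < s + 2 * pi" shows "r = q"
proof -
  obtain k :: int where k: "r = q + 2 * pi * k" using assms(1) cis_eq_iff by blast
  have "\<bar>2 * pi * k\<bar> < 2 * pi" using assms k by linarith
  then have "\<bar>real_of_int k\<bar> < 1" by (simp add: abs_mult)
  then show ?thesis using k by simp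
qed

lemma S1_lift_pair:
  assumes "w \<in> S1" "v \<in> S1" "w \<noteq> v"
  obtains s t where "w = cis s" "v = cis t" "s < t" "t < s + 2 * pi"
proof -
  obtain s where s: "w = cis s" using S1_cis assms by blast
  obtain t where t: "v = cis t" "s \<le> t" "t < s + 2 * pi" using S1_lift assms by blast
  show ?thesis using that[OF s t(1)] t s assms by (metis order_le_less)
qed

lemma side_eq_0_S1:
  assumes "w \<in> S1" "v \<in> S1" "w \<noteq> v" "x \<in> S1" "side w v x = 0" shows "x = w \<or> x = v"
proof -
  obtain s t where st: "w = cis s" "v = cis t" "s < t" "t < s + 2 * pi" using S1_lift_pair assms by blast
  obtain r where r: "x = cis r" "s \<le> r" "r < s + 2 * pi" using S1_lift assms by blast
  show ?thesis
    using side_cis_pos[of s t r] side_cis_neg[of s r t] r st assms(5)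
    by (cases r s rule: linorder_cases; cases r t rule: linorder_cases) auto
qed

text \<open>Once all lifts lie in one window, the sign depends on their order only; this is why
  increasing lifts of circle maps preserve crossing.\<close>

lemma sgn_side_cis:
  assumes "s \<le> t" "t < s + 2 * pi" "s \<le> r" "r < s + 2 * pi"
  shows "sgn (side (cis s) (cis t) (cis r))
    = (if s < t \<and> t < r then 1 else if s < r \<and> r < t then -1 else 0)"
  using side_cis_pos[of s t r] side_cis_neg[of s r t] assms
  by (cases "s = t"; cases "s = r"; cases r t rule: linorder_cases) auto

lemma sepE:
  assumes "w \<in> S1" "v \<in> S1" "x \<in> S1" "y \<in> S1" "sep w v x y" "w = cis s" "v = cis t" "s < t" "t < s + 2 * pi"
  obtains r q where "s < r" "r < t" "t < q" "q < s + 2 * pi"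
    "x = cis r \<and> y = cis q \<or> y = cis r \<and> x = cis q"
proof -
  obtain r where r: "x = cis r" "s \<le> r" "r < s + 2 * pi" using S1_lift assms by blast
  obtain q where q: "y = cis q" "s \<le> q" "q < s + 2 * pi" using S1_lift assms by blast
  have *: "(side (cis s) (cis t) (cis r) < 0 \<and> side (cis s) (cis t) (cis q) > 0) \<or>
    (side (cis s) (cis t) (cis r) > 0 \<and> side (cis s) (cis t) (cis q) < 0)"
    using assms(5) unfolding sep_def mult_less_0_iff assms r q by blast
  show ?thesis
    using * that[of r q] that[of q r] r q sgn_side_cis[of s t r] sgn_side_cis[of s t q] assms(8,9)
    by (auto simp: sgn_if split: if_splits)
qed

lemma sep_cisI:
  assumes "s < r" "r < t" "t < q" "q < s + 2 * pi"
  shows "sep (cis s) (cis t) (cis r) (cis q)"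
  unfolding sep_def using side_cis_neg[of s r t] side_cis_pos[of s t q] assms
  by (simp add: mult_less_0_iff)

lemma sep_sym:
  assumes S: "w \<in> S1" "v \<in> S1" "x \<in> S1" "y \<in> S1" and sep: "sep w v x y"
  shows "sep x y w v"
proof -
  have "w \<noteq> v" using sep by (auto simp: sep_def)
  then obtain s t where st: "w = cis s" "v = cis t" "s < t" "t < s + 2 * pi" using S1_lift_pair S by blast
  obtain r q where rq: "s < r" "r < t" "t < q" "q < s + 2 * pi"
    "x = cis r \<and> y = cis q \<or> y = cis r \<and> x = cis q"
    using sepE[OF S sep st] by blast
  \<comment> \<open>Read from \<open>r\<close> on, the cyclic order \<open>s < r < t < q\<close>
    becomes \<open>r < t < q < s + 2 * pi\<close>.\<close>
  have "sep (cis r) (cis q) (cis t) (cis (s + 2 * pi))"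
    using rq st by (intro sep_cisI) auto
  then show ?thesis using rq st sep_commute by auto
qed

text \<open>The barycentric coordinates of \<open>z\<close> are the areas of the three triangles
  with apex \<open>z\<close>, divided by the area of \<open>a\<close>, \<open>b\<close>,
  \<open>c\<close>.\<close>

lemma barycentric:
  assumes D: "side a b c > 0" and "side a b z \<ge> 0" "side b c z \<ge> 0" "side c a z \<ge> 0"
  shows "z \<in> convex hull {a, b, c}"
proof -
  let ?D = "side a b c"
  define x y w where "x = side b c z / ?D" and "y = side c a z / ?D" and "w = side a b z / ?D"
  have sum: "side b c z + side c a z + side a b z = ?D"
    by (simp add: side_Re_Im algebra_simps)
  have "x + y + w = 1" using D sum by (simp add: x_def y_def w_def add_divide_distrib[symmetric])
  moreover have "z = x *\<^sub>R a + y *\<^sub>R b + w *\<^sub>R c"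
  proof -
    have "?D *\<^sub>R z = side b c z *\<^sub>R a + side c a z *\<^sub>R b + side a b z *\<^sub>R c"
      by (simp add: complex_eq_iff side_Re_Im algebra_simps)
    then have "(1 / ?D) *\<^sub>R (?D *\<^sub>R z) = (1 / ?D) *\<^sub>R (side b c z *\<^sub>R a + side c a z *\<^sub>R b + side a b z *\<^sub>R c)" by simp
    then show ?thesis using D by (simp add: x_def y_def w_def scaleR_add_right)
  qed
  moreover have "x \<ge> 0" "y \<ge> 0" "w \<ge> 0" using assms by (simp_all add: x_def y_def w_def)
  ultimately show ?thesis unfolding convex_hull_3 by blast
qed

section \<open>Hulls of finite subsets of the circle\<close>

text \<open>\<open>\<i> * (y - x)\<close> is the normal of the chord pointing to its positive side;
  in this form the results on half-spaces and faces apply.\<close>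

lemma side_inner: "side x y w = (\<i> * (y - x)) \<bullet> w - (\<i> * (y - x)) \<bullet> x"
  by (simp add: side_Re_Im inner_complex_def algebra_simps)

lemma side_on_segment:
  assumes "z \<in> convex hull {x, y}" shows "side x y z = 0"
proof -
  obtain u v where "z = u *\<^sub>R x + v *\<^sub>R y" "u + v = 1" using assms unfolding convex_hull_2 by blast
  then have z: "z = (1 - v) *\<^sub>R x + v *\<^sub>R y" by (simp add: eq_diff_eq)
  show ?thesis unfolding z by (simp add: side_Re_Im algebra_simps)
qed

lemma convex_hull_side_nonneg:
  assumes "\<And>w. w \<in> c \<Longrightarrow> side x y w \<ge> 0"
  shows "convex hull c \<subseteq> {w. side x y w \<ge> 0}"
proof (rule hull_minimal)
  have "{w. side x y w \<ge> 0} = {w. (\<i> * (y - x)) \<bullet> w \<ge> (\<i> * (y - x)) \<bullet> x}"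
    by (auto simp: side_inner)
  then show "convex {w. side x y w \<ge> 0}" by (simp add: convex_halfspace_ge)
qed (use assms in auto)

lemma interior_convex_hull_side_pos:
  assumes "\<And>w. w \<in> c \<Longrightarrow> side x y w \<ge> 0" "x \<noteq> y" "z \<in> interior (convex hull c)"
  shows "side x y z > 0"
proof -
  have eq: "{w. side x y w \<ge> 0} = {w. (\<i> * (y - x)) \<bullet> w \<ge> (\<i> * (y - x)) \<bullet> x}"
    by (auto simp: side_inner)
  have "z \<in> interior {w. side x y w \<ge> 0}"
    using subsetD[OF interior_mono[OF convex_hull_side_nonneg] assms(3)] assms(1) by blast
  moreover have "interior {w. (\<i> * (y - x)) \<bullet> w \<ge> (\<i> * (y - x)) \<bullet> x}
      = {w. (\<i> * (y - x)) \<bullet> w > (\<i> * (y - x)) \<bullet> x}"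
    by (rule interior_halfspace_ge) (use assms(2) in simp)
  ultimately have "z \<in> {w. (\<i> * (y - x)) \<bullet> w > (\<i> * (y - x)) \<bullet> x}"
    unfolding eq by blast
  then show ?thesis unfolding side_inner by simp
qed

lemma interior_convex_hull_both_sides:
  assumes "z \<in> interior (convex hull c)" "x \<noteq> y" "side x y z = 0"
  obtains w1 w2 where "w1 \<in> c" "w2 \<in> c" "side x y w1 < 0" "side x y w2 > 0"
proof -
  have "\<exists>w\<in>c. side x y w < 0"
  proof (rule ccontr)
    assume "\<not> ?thesis"
    then have "side x y z > 0" using assms by (intro interior_convex_hull_side_pos) (auto simp: not_less)
    then show False using assms by simp
  qed
  moreover have "\<exists>w\<in>c. side x y w > 0"
  proof (rule ccontr)
    assume "\<not> ?thesis"
    then have "side y x z > 0" using assms side_swap[of x y]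
      by (intro interior_convex_hull_side_pos) (auto simp: not_less)
    then show False using assms side_swap[of x y z] by simp
  qed
  ultimately show ?thesis using that by blast
qed

lemma collinear_side_eq_0:
  assumes "a \<noteq> 0" "a \<bullet> x = b" "a \<bullet> y = b" "a \<bullet> w = b" shows "side x y w = 0"
proof -
  have 1: "Re a * (Re y - Re x) + Im a * (Im y - Im x) = 0"
    and 2: "Re a * (Re w - Re x) + Im a * (Im w - Im x) = 0"
    using assms by (simp_all add: inner_complex_def algebra_simps)
  have "Re a * side x y w = (Im w - Im x) * (Re a * (Re y - Re x) + Im a * (Im y - Im x))
      - (Im y - Im x) * (Re a * (Re w - Re x) + Im a * (Im w - Im x))"
    "Im a * side x y w = (Re y - Re x) * (Re a * (Re w - Re x) + Im a * (Im w - Im x))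
      - (Re w - Re x) * (Re a * (Re y - Re x) + Im a * (Im y - Im x))"
    by (simp_all add: side_Re_Im algebra_simps)
  then show ?thesis using 1 2 assms(1) by (auto simp: complex_eq_iff)
qed

text \<open>A vector orthogonal to \<open>y - x\<close> is a multiple of
  \<open>\<i> * (y - x)\<close>. The identity in the proof resolves \<open>w - x\<close> along these
  two orthogonal directions, and \<open>d\<close> is their common squared length.\<close>

lemma normal_side:
  assumes "a \<bullet> x = a \<bullet> y" "x \<noteq> y"
  obtains \<kappa> where "\<And>w. a \<bullet> w - a \<bullet> x = \<kappa> * side x y w"
proof
  fix w
  define d where "d = (Re y - Re x)\<^sup>2 + (Im y - Im x)\<^sup>2"
  have "d \<noteq> 0" using assms(2) by (auto simp: d_def complex_eq_iff sum_power2_eq_zero_iff)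
  have 1: "Re a * (Re y - Re x) + Im a * (Im y - Im x) = 0"
    using assms by (simp add: inner_complex_def algebra_simps)
  define k where "k = a \<bullet> (\<i> * (y - x))"
  have "d * (a \<bullet> w - a \<bullet> x) - k * side x y w
      = (Re a * (Re y - Re x) + Im a * (Im y - Im x))
        * ((Re y - Re x) * (Re w - Re x) + (Im y - Im x) * (Im w - Im x))"
    by (simp add: d_def k_def side_Re_Im inner_complex_def power2_eq_square algebra_simps)
  then have "d * (a \<bullet> w - a \<bullet> x) = k * side x y w" unfolding 1 by simp
  then show "a \<bullet> w - a \<bullet> x = k / d * side x y w" using \<open>d \<noteq> 0\<close> by (simp add: field_simps)
qed

lemma hull_S1_subset: "c \<subseteq> S1 \<Longrightarrow> convex hull c \<subseteq> cball 0 1"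
  by (intro hull_minimal) (auto simp: dist_norm)

lemma interior_hull_S1_subset: "c \<subseteq> S1 \<Longrightarrow> interior (convex hull c) \<subseteq> ball 0 1"
  using interior_mono[OF hull_S1_subset[of c]] by simp

text \<open>A supporting line at \<open>z\<close> cuts the hull in a face spanned by points of
  \<open>c\<close>. A line meets the circle in at most two points and \<open>z\<close> is not itself
  on the circle, so the face is a chord.\<close>

lemma boundary_point_on_edge:
  assumes c: "finite c" "c \<subseteq> S1" and z: "z \<in> ball 0 1" "z \<in> convex hull c" "z \<notin> interior (convex hull c)"
  obtains x y where "x \<in> c" "y \<in> c" "x \<noteq> y" "z \<in> convex hull {x, y}" "\<And>w. w \<in> c \<Longrightarrow> side x y w \<ge> 0"
proof -
  let ?P = "convex hull c"
  obtain a where a: "a \<noteq> 0" "\<And>y. y \<in> ?P \<Longrightarrow> a \<bullet> z \<le> a \<bullet> y"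
  \<comment> \<open>A hull without interior lies in a line, whose normal supports it
    trivially.\<close>
  proof (cases "interior ?P = {}")
    case True
    then obtain a b where "a \<noteq> 0" "?P \<subseteq> {x. a \<bullet> x = b}"
      using empty_interior_subset_hyperplane convex_convex_hull by metis
    then show ?thesis using that[of a] z by (metis (mono_tags) mem_Collect_eq order_refl subsetD)
  next
    case False
    then have "z \<notin> rel_interior ?P" using z by (simp add: rel_interior_nonempty_interior)
    then show ?thesis using supporting_hyperplane_rel_boundary[OF convex_convex_hull z(2)] that by metis
  qed
  define T where "T = ?P \<inter> {y. a \<bullet> y = a \<bullet> z}"
  have "T face_of ?P"
    unfolding T_def using a by (intro face_of_Int_supporting_hyperplane_ge) auto
  then obtain S' where S': "S' \<subseteq> c" "T = convex hull S'"
    using face_of_convex_hull_subset[of c T] c finite_imp_compact by metis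
  have onl: "a \<bullet> y = a \<bullet> z" if "y \<in> S'" for y
    using that hull_inc[of y S'] S' by (auto simp: T_def)
  have zT: "z \<in> convex hull S'" using z S' by (auto simp: T_def)
  then obtain x where x: "x \<in> S'" by fastforce
  have "S' \<noteq> {x}" using zT z x S' c by auto
  then obtain y where y: "y \<in> S'" "y \<noteq> x" using x by blast
  have "S' \<subseteq> {x, y}"
  proof
    fix w assume "w \<in> S'"
    then have "side x y w = 0" using x y onl a by (intro collinear_side_eq_0[of a _ "a \<bullet> z"]) auto
    then show "w \<in> {x, y}" using side_eq_0_S1[of x y w] x y S' c \<open>w \<in> S'\<close> by blast
  qed
  then have S'eq: "S' = {x, y}" using x y by blast
  obtain \<kappa> where \<kappa>: "\<And>w. a \<bullet> w - a \<bullet> x = \<kappa> * side x y w"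
    using normal_side[of a x y] onl x y by metis
  have pos: "\<kappa> * side x y w \<ge> 0" if "w \<in> c" for w
    using a(2)[of w] \<kappa>[of w] onl[OF x] that hull_inc[of w c] by simp
  show ?thesis
  \<comment> \<open>The sign of \<open>\<kappa>\<close> decides the order in which the two ends must
    be named for \<open>c\<close> to lie on the positive side.\<close>
  proof (cases "\<kappa> > 0")
    case True
    then have "side x y w \<ge> 0" if "w \<in> c" for w
      using pos[OF that] by (simp add: zero_le_mult_iff)
    moreover have "z \<in> convex hull {x, y}" using zT unfolding S'eq .
    ultimately show ?thesis using that[of x y] x y S' by blast
  next
    case False
    moreover have "\<kappa> \<noteq> 0"
    proof
      assume "\<kappa> = 0"
      then have "a \<bullet> (x + a) - a \<bullet> x = 0" using \<kappa>[of "x + a"] by simp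
      then show False using a by (simp add: inner_add_right)
    qed
    ultimately have "\<kappa> < 0" by simp
    then have "side y x w \<ge> 0" if "w \<in> c" for w
      using pos[OF that] side_swap[of x y w] by (simp add: mult_le_0_iff zero_le_mult_iff)
    moreover have "z \<in> convex hull {y, x}" using zT unfolding S'eq by (simp add: insert_commute)
    ultimately show ?thesis using that[of y x] x y S' by blast
  qed
qed

lemma edge_of_hullI:
  assumes c: "finite c" "c \<subseteq> S1" "x \<in> c" "y \<in> c" "x \<noteq> y" and pos: "\<And>w. w \<in> c \<Longrightarrow> side x y w \<ge> 0"
  shows "(convex hull {x, y}) edge_of (convex hull c)"
proof -
  let ?P = "convex hull c" and ?a = "\<i> * (y - x)"
  define T where "T = ?P \<inter> {w. ?a \<bullet> w = ?a \<bullet> x}"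
  have T: "T face_of ?P" unfolding T_def
  proof (rule face_of_Int_supporting_hyperplane_ge)
    show "?a \<bullet> x \<le> ?a \<bullet> w" if "w \<in> ?P" for w
      using convex_hull_side_nonneg[OF pos] that side_inner[of x y w] by fastforce
  qed simp
  then obtain S' where S': "S' \<subseteq> c" "T = convex hull S'"
    using face_of_convex_hull_subset[of c T] c finite_imp_compact by metis
  have "S' \<subseteq> {x, y}"
  proof
    fix w assume w: "w \<in> S'"
    then have "w \<in> T" using S' hull_inc by metis
    then have "side x y w = 0" by (simp add: T_def side_inner)
    then show "w \<in> {x, y}" using side_eq_0_S1[of x y w] c S' w by blast
  qed
  moreover have "convex hull {x, y} \<subseteq> T"
  proof (rule hull_minimal)
    have "side x y y = 0" by simp
    then show "{x, y} \<subseteq> T" unfolding side_inner using c by (auto simp: T_def hull_inc)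
    show "convex T" using T face_of_imp_convex by auto
  qed
  ultimately have "T = convex hull {x, y}" using S' hull_mono by blast
  then show ?thesis using T c by (simp add: edge_of_def aff_dim_convex_hull)
qed

lemma interior_hull_nonempty_iff:
  assumes "finite c" "c \<subseteq> S1" shows "interior (convex hull c) \<noteq> {} \<longleftrightarrow> 3 \<le> card c"
proof
  assume ne: "interior (convex hull c) \<noteq> {}"
  show "3 \<le> card c"
  proof (rule ccontr)
    assume "\<not> 3 \<le> card c"
    then have "card c \<le> 2" by simp
    then have "int (card c) - 1 \<le> 1" by simp
    then have "aff_dim c \<le> 1" using aff_dim_le_card[OF assms(1)] by linarith
    then have "aff_dim (convex hull c) \<noteq> int DIM(complex)" by (simp add: aff_dim_convex_hull)
    then show False using ne aff_dim_nonempty_interior by blast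
  qed
next
  assume c3: "3 \<le> card c"
  show "interior (convex hull c) \<noteq> {}"
  proof
    assume "interior (convex hull c) = {}"
    then obtain a b where ab: "a \<noteq> 0" "convex hull c \<subseteq> {x. a \<bullet> x = b}"
      using empty_interior_subset_hyperplane convex_convex_hull by metis
    obtain x y w where xyw: "x \<in> c" "y \<in> c" "w \<in> c" "x \<noteq> y" "x \<noteq> w" "y \<noteq> w"
    proof -
      obtain T where T: "T \<subseteq> c" "card T = 3" using c3 by (metis obtain_subset_with_card_n)
      then obtain x y w where "T = {x, y, w}" "x \<noteq> y" "x \<noteq> w" "y \<noteq> w" by (metis card_3_iff)
      then show ?thesis using that T by blast
    qed
    have "side x y w = 0" using ab xyw hull_inc[of _ c]
      by (intro collinear_side_eq_0[of a _ b]) blast+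
    then show False using side_eq_0_S1[of x y w] xyw assms by blast
  qed
qed

section \<open>Laminations from height functions\<close>

text \<open>\<open>closed_segment\<close> makes the relation symmetric without an order of
  \<open>s\<close> and \<open>t\<close>. It lives on the line because two points of the circle are
  joined by two arcs: the choice of lifts is the choice of the arc.\<close>

definition level :: "(real \<Rightarrow> real) \<Rightarrow> real \<Rightarrow> real \<Rightarrow> bool"
  where "level f s t \<longleftrightarrow> f s = f t \<and> (\<forall>r\<in>closed_segment s t. f s \<le> f r)"

lemma level_refl [simp]: "level f s s" by (simp add: level_def)

lemma level_sym: "level f s t \<Longrightarrow> level f t s"
  by (auto simp: level_def closed_segment_commute)

lemma closed_segment_real_split: "closed_segment s (u::real) \<subseteq> closed_segment s t \<union> closed_segment t u"
  by (auto simp: closed_segment_eq_real_ivl split: if_splits)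

lemma level_trans: "level f s t \<Longrightarrow> level f t u \<Longrightarrow> level f s u"
  using closed_segment_real_split[of s u t] unfolding level_def by (metis UnE subsetD)

lemma level_between:
  assumes "level f s t" "r \<in> closed_segment s t" "f r = f s" shows "level f s r"
proof -
  have "closed_segment s r \<subseteq> closed_segment s t" using assms(2)
    by (simp add: subset_closed_segment)
  then show ?thesis using assms unfolding level_def by auto
qed

lemma level_iff: "s \<le> t \<Longrightarrow> level f s t \<longleftrightarrow> f s = f t \<and> (\<forall>r. s \<le> r \<and> r \<le> t \<longrightarrow> f s \<le> f r)"
  by (auto simp: level_def closed_segment_eq_real_ivl)

definition tied :: "(real \<Rightarrow> real) \<Rightarrow> real \<Rightarrow> real \<Rightarrow> real set"
  where "tied g s t = {r \<in> closed_segment s t. g r = g s}"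

definition crel :: "(real \<Rightarrow> real) \<Rightarrow> complex \<Rightarrow> complex \<Rightarrow> bool"
  where "crel f z w \<longleftrightarrow> (\<exists>s t. z = cis s \<and> w = cis t \<and> level f s t)"

text \<open>Phrased by crossing instead of by hulls, so that closedness of \<open>lam\<close> and
  its invariance under circle maps follow directly from those of the relation.\<close>

definition edge :: "(real \<Rightarrow> real) \<Rightarrow> complex \<Rightarrow> complex \<Rightarrow> bool"
  where "edge f x y \<longleftrightarrow> x \<noteq> y \<and> crel f x y \<and> (\<forall>w v. crel f w v \<longrightarrow> \<not> sep w v x y)"

definition lam :: "(real \<Rightarrow> real) \<Rightarrow> complex set set"
  where "lam f = {{x, y} | x y. edge f x y}"

definition cls :: "(real \<Rightarrow> real) \<Rightarrow> complex \<Rightarrow> complex set"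
  where "cls f z = {w. crel f z w}"

lemma crel_sym: "crel f z w \<Longrightarrow> crel f w z"
  by (auto simp: crel_def dest: level_sym)

lemma crel_S1: "crel f z w \<Longrightarrow> z \<in> S1 \<and> w \<in> S1"
  by (auto simp: crel_def)

lemma crel_refl: "z \<in> S1 \<Longrightarrow> crel f z z"
  using S1_cis level_refl unfolding crel_def by metis

lemma cls_S1: "cls f z \<subseteq> S1"
  using crel_S1 by (auto simp: cls_def)

lemma edge_sym: "edge f x y \<Longrightarrow> edge f y x"
  by (auto simp: edge_def crel_sym sep_commute)

lemma lam_iff: "{x, y} \<in> lam f \<longleftrightarrow> edge f x y"
  by (auto simp: lam_def doubleton_eq_iff edge_sym)

lemma lamE: assumes "l \<in> lam f" obtains x y where "l = {x, y}" "edge f x y"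
  using assms by (auto simp: lam_def)

lemma edge_S1: "edge f x y \<Longrightarrow> x \<in> S1 \<and> y \<in> S1"
  using crel_S1 by (auto simp: edge_def)

lemma connected_side_component:
  assumes S: "w \<in> S1" "v \<in> S1" "w \<noteq> v"
  shows "{z \<in> S1. side w v z < 0} \<in> components (S1 - {w, v})"
proof -
  obtain s t where st: "w = cis s" "v = cis t" "s < t" "t < s + 2 * pi" using S1_lift_pair S by blast
  let ?A = "{z \<in> S1. side w v z < 0}"
  have A: "?A = cis ` {s<..<t}"
  proof (intro antisym subsetI)
    fix z assume z: "z \<in> ?A"
    then obtain r where r: "z = cis r" "s \<le> r" "r < s + 2 * pi" using S1_lift by blast
    then show "z \<in> cis ` {s<..<t}" using z sgn_side_cis[of s t r] st
      by (auto simp: sgn_if split: if_splits)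
  qed (use side_cis_neg st in auto)
  have conn: "connected ?A" unfolding A
    by (intro connected_continuous_image continuous_intros) auto
  define z where "z = cis ((s + t) / 2)"
  have z: "z \<in> ?A" unfolding A z_def using st by auto
  have sub: "?A \<subseteq> S1 - {w, v}" by auto
  \<comment> \<open>On a connected subset of the circle that avoids \<open>w\<close> and
    \<open>v\<close> the function \<open>side w v\<close> has no zero, so it keeps its sign.\<close>
  have "connected_component_set (S1 - {w, v}) z = ?A"
  proof (rule connected_component_unique[OF z sub conn])
    fix c' assume c': "z \<in> c'" "c' \<subseteq> S1 - {w, v}" "connected c'"
    have cont: "continuous_on c' (side w v)" unfolding side_def by (intro continuous_intros)
    show "c' \<subseteq> ?A"
    proof
      fix x assume x: "x \<in> c'"
      have "side w v x < 0"
      proof (rule ccontr)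
        assume "\<not> side w v x < 0"
        moreover have "is_interval (side w v ` c')"
          using connected_continuous_image[OF cont c'(3)] is_interval_connected_1 by blast
        ultimately have "0 \<in> side w v ` c'"
          using z x c'(1) unfolding is_interval_1
          by (metis (mono_tags, lifting) imageI less_eq_real_def mem_Collect_eq not_less)
        then obtain y where "y \<in> c'" "side w v y = 0" by auto
        then show False using side_eq_0_S1[OF S, of y] c' by auto
      qed
      then show "x \<in> ?A" using x c' by auto
    qed
  qed
  moreover have "z \<in> S1 - {w, v}" using z sub by blast
  ultimately show ?thesis by (metis componentsI)
qed

lemma linked_imp_sep:
  assumes S: "w \<in> S1" "v \<in> S1" "w \<noteq> v" and l: "linked {w, v} {x, y}"
  shows "sep w v x y"
proof -
  have *: "\<exists>p. p \<in> C \<and> p \<in> {x, y}" if "C \<in> components (S1 - {w, v})" for C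
    using l that unfolding linked_def by blast
  have "{z \<in> S1. side v w z < 0} \<in> components (S1 - {w, v})"
    using connected_side_component[OF S(2,1)] S(3) by (simp add: insert_commute)
  from *[OF this] obtain p where p: "p \<in> {x, y}" "side w v p > 0"
    using side_swap[of w v] by auto
  from *[OF connected_side_component[OF S]] obtain q where q: "q \<in> {x, y}" "side w v q < 0"
    by blast
  show ?thesis using p q by (auto simp: sep_def mult_less_0_iff)
qed

section \<open>The equivalence relation of a periodic height\<close>

locale circle_height =
  fixes f :: "real \<Rightarrow> real"
  assumes continuous: "continuous_on UNIV f"
    and periodic: "f (t + 2 * pi) = f t"
begin

lemma periodic_int: "f (t + 2 * pi * of_int k) = f t"
proof -
  have n: "f (t + 2 * pi * real n) = f t" for t n
    by (induction n) (use periodic in \<open>auto simp: algebra_simps\<close>, metis add.assoc add.commute)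
  show ?thesis
  proof (cases k)
    case (nonneg n) then show ?thesis using n by simp
  next
    case (neg n)
    have "t + 2 * pi * of_int k + 2 * pi * real (Suc n) = t" unfolding neg by (simp add: algebra_simps)
    then show ?thesis using n[of "t + 2 * pi * of_int k" "Suc n"] by (simp only:)
  qed
qed

lemma level_shift: "level f (s + 2 * pi * of_int k) (t + 2 * pi * of_int k) \<longleftrightarrow> level f s t"
proof -
  have *: "closed_segment (s + a) (t + a) = (\<lambda>r. r + a) ` closed_segment s t" for a
    using closed_segment_translation[of a s t] by (simp add: add.commute)
  show ?thesis unfolding level_def * by (simp add: periodic_int)
qed

lemma crel_cis_iff: "crel f (cis s) w \<longleftrightarrow> (\<exists>t. w = cis t \<and> level f s t)"
proof
  assume "crel f (cis s) w"
  then obtain s' t where *: "cis s = cis s'" "w = cis t" "level f s' t" by (auto simp: crel_def)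
  obtain k :: int where k: "s = s' + 2 * pi * k" using * cis_eq_iff by blast
  have "w = cis (t + 2 * pi * k)" "level f s (t + 2 * pi * k)"
    unfolding k using * level_shift by auto
  then show "\<exists>t. w = cis t \<and> level f s t" by blast
qed (auto simp: crel_def)

lemma crel_trans: assumes "crel f x y" "crel f y z" shows "crel f x z"
proof -
  obtain s t where s: "x = cis s" "y = cis t" "level f s t" using assms(1) by (auto simp: crel_def)
  then obtain u where "z = cis u" "level f t u" using assms(2) crel_cis_iff by blast
  then show ?thesis using s level_trans crel_cis_iff by blast
qed

lemma level_window:
  assumes "level f s t" "s \<le> t"
  obtains t' where "cis t' = cis t" "s \<le> t'" "t' < s + 2 * pi" "level f s t'"
proof -
  obtain k :: int where k: "s \<le> t + 2 * pi * k" "t + 2 * pi * k < s + 2 * pi"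
    using shift_into[of "2 * pi" s t] by auto
  \<comment> \<open>Full turns are only removed, so the new point lies between \<open>s\<close> and
    \<open>t\<close>, where \<open>level_between\<close> applies.\<close>
  have "t + 2 * pi * k \<le> t"
  proof (rule ccontr)
    assume "\<not> t + 2 * pi * k \<le> t"
    then have "0 < 2 * pi * k" by linarith
    then have "0 < k" by (simp add: zero_less_mult_iff)
    then have "2 * pi * k \<ge> 2 * pi" by simp
    then show False using k assms(2) by linarith
  qed
  then have "level f s (t + 2 * pi * k)" using k assms
    by (intro level_between[OF assms(1)])
      (auto simp: closed_segment_eq_real_ivl periodic_int level_def)
  then show ?thesis using that[of "t + 2 * pi * k"] k by auto
qed

lemma level_window_abs:
  assumes "level f s t"
  obtains t' where "cis t' = cis t" "\<bar>t' - s\<bar> \<le> 2 * pi" "level f s t'"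
proof (cases "\<bar>t - s\<bar> \<le> 2 * pi")
  case True
  then show ?thesis using that assms by blast
next
  case False
  \<comment> \<open>A tie longer than a turn sees all values of the height, so it is at the global
    minimum, and then every lift of \<open>t\<close> is tied to \<open>s\<close>.\<close>
  have min: "f s \<le> f r" for r
  proof -
    obtain k :: int where k: "min s t \<le> r + 2 * pi * k" "r + 2 * pi * k < min s t + 2 * pi"
      using shift_into[of "2 * pi" "min s t" r] by auto
    then have "r + 2 * pi * k \<in> closed_segment s t" using False by (auto simp: closed_segment_eq_real_ivl)
    then have "f s \<le> f (r + 2 * pi * k)" using assms unfolding level_def by blast
    then show ?thesis by (simp add: periodic_int)
  qed
  obtain k :: int where k: "s \<le> t + 2 * pi * k" "t + 2 * pi * k < s + 2 * pi"
    using shift_into[of "2 * pi" s t] by auto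
  have "level f s (t + 2 * pi * k)" using min assms by (auto simp: level_def periodic_int)
  then show ?thesis using that[of "t + 2 * pi * k"] k by auto
qed

lemma crel_short:
  assumes "crel f w v" "w \<noteq> v"
  obtains s t where "s < t" "t < s + 2 * pi" "level f s t" "w = cis s \<and> v = cis t \<or> w = cis t \<and> v = cis s"
proof -
  obtain s t where st: "w = cis s" "v = cis t" "level f s t" using assms by (auto simp: crel_def)
  show ?thesis
  proof (cases "s \<le> t")
    case True
    then obtain t' where "cis t' = cis t" "s \<le> t'" "t' < s + 2 * pi" "level f s t'"
      using level_window st by blast
    then show ?thesis using that[of s t'] st assms by (metis order_le_less)
  next
    case False
    then obtain s' where "cis s' = cis s" "t \<le> s'" "s' < t + 2 * pi" "level f t s'"
      using level_window[of t s] st level_sym by force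
    then show ?thesis using that[of t s'] st assms by (metis order_le_less)
  qed
qed

text \<open>Crossing ties belong to one class: the segment of the second tie starts between
  \<open>s\<close> and \<open>t\<close> and ends outside, so it passes \<open>s\<close> or
  \<open>t\<close> and its height is at most theirs. The first tie gives the converse
  inequality.\<close>

lemma crel_separated:
  assumes wv: "crel f w v" and xy: "crel f x y" and sep: "sep w v x y"
  shows "crel f w x"
proof -
  have "w \<noteq> v" using sep by (auto simp: sep_def)
  then obtain s t where st: "s < t" "t < s + 2 * pi" "level f s t"
    "w = cis s \<and> v = cis t \<or> w = cis t \<and> v = cis s" using crel_short wv by blast
  have st_rel: "crel f (cis s) (cis t)" using st by (auto simp: crel_def)
  have "sep (cis s) (cis t) x y" using st(4) sep sep_commute by auto
  then obtain r q where rq: "s < r" "r < t" "t < q" "q < s + 2 * pi"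
    "x = cis r \<and> y = cis q \<or> y = cis r \<and> x = cis q"
    using sepE[of "cis s" "cis t" x y s t] st crel_S1[OF xy] by auto
  have "crel f (cis r) (cis q)" using xy rq crel_sym by blast
  then obtain q' where q': "cis q = cis q'" "level f r q'" using crel_cis_iff by blast
  have "\<not> (s \<le> q' \<and> q' \<le> t)"
    using cis_inj_window[of q q' s] q' rq st by auto
  then have "s \<in> closed_segment r q' \<or> t \<in> closed_segment r q'"
    using rq by (auto simp: closed_segment_eq_real_ivl)
  then have "f r \<le> f s"
    using q'(2) st(3) by (auto simp: level_def)
  moreover have "f s \<le> f r" using st rq by (auto simp: level_iff)
  ultimately have "level f s r" using rq by (intro level_between[OF st(3)]) (auto simp: closed_segment_eq_real_ivl)
  then have "crel f (cis s) (cis r)" by (auto simp: crel_def)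
  then show ?thesis
    using rq(5) st(4) st_rel crel_sym crel_trans xy by metis
qed

lemma cls_crel: "w \<in> cls f u \<Longrightarrow> v \<in> cls f u \<Longrightarrow> crel f w v"
  using crel_sym[of f u w] crel_trans[of w u v] by (auto simp: cls_def)

text \<open>By \<open>crel_separated\<close> only members of the same class could cross the
  chord.\<close>

lemma edgeI_cls:
  assumes "x \<noteq> y" "crel f x y" and one: "\<And>w v. w \<in> cls f x \<Longrightarrow> v \<in> cls f x \<Longrightarrow> \<not> sep x y w v"
  shows "edge f x y"
  unfolding edge_def
proof (intro conjI allI impI notI)
  fix w v assume wv: "crel f w v" and sep: "sep w v x y"
  have "crel f w x" using crel_separated wv assms(2) sep by blast
  then have "w \<in> cls f x" "v \<in> cls f x"
    using wv crel_sym[of f w x] crel_trans[of x w v] by (auto simp: cls_def)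
  moreover have "sep x y w v" using sep_sym sep crel_S1[OF wv] crel_S1[OF assms(2)] by blast
  ultimately show False using one by blast
qed (use assms in auto)

lemma edge_one_side:
  assumes "edge f x y" "crel f w v" shows "\<not> sep x y w v"
  using assms sep_sym[of x y w v] crel_S1 edge_S1 unfolding edge_def by blast

lemma edge_cls_one_side:
  assumes "edge f x y" "x \<in> cls f u"
  shows "(\<forall>w\<in>cls f u. side x y w \<ge> 0) \<or> (\<forall>w\<in>cls f u. side y x w \<ge> 0)"
proof (rule ccontr)
  assume "\<not> ?thesis"
  then obtain w v where wv: "w \<in> cls f u" "v \<in> cls f u" "side x y w < 0" "side y x v < 0" by (auto simp: not_le)
  then have "side x y v > 0" using side_swap[of x y v] by simp
  then have "sep x y w v" using wv by (simp add: sep_def mult_less_0_iff)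
  moreover have "crel f w v" using cls_crel wv by blast
  ultimately show False using edge_one_side assms by blast
qed

lemma closed_level: "closed {p. level f (fst p) (snd p)}"
proof -
  have cont: "continuous_on UNIV (\<lambda>p::real\<times>real. f (g p))" if "continuous_on UNIV g" for g
    using continuous_on_compose2[OF continuous that] by auto
  \<comment> \<open>Parametrizing the segment over [0, 1] turns a quantifier over a varying segment
    into an intersection of closed conditions, one for each fixed \<open>u\<close>.\<close>
  have "{p. level f (fst p) (snd p)} = {p. f (fst p) = f (snd p)}
      \<inter> (\<Inter>u\<in>{0..1}. {p. f (fst p) \<le> f ((1 - u) *\<^sub>R fst p + u *\<^sub>R snd p)})"
    by (auto simp: level_def closed_segment_image_interval)
  moreover have "closed {p::real\<times>real. f (fst p) = f (snd p)}"
    by (intro closed_Collect_eq cont continuous_intros)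
  moreover have "closed {p::real\<times>real. f (fst p) \<le> f ((1 - u) *\<^sub>R fst p + u *\<^sub>R snd p)}" for u
    by (intro closed_Collect_le cont continuous_intros)
  ultimately show ?thesis by (auto intro!: closed_Int closed_INT)
qed

text \<open>Lifts can be chosen with one end in the first turn and the other at most one turn later,
  so the relation is the image of a compact set together with its transpose.\<close>

lemma closed_crel: "closed {p. crel f (fst p) (snd p)}"
proof -
  have K: "compact (({0..2 * pi} \<times> {0..4 * pi}) \<inter> {p. level f (fst p) (snd p)})" (is "compact ?K")
    by (intro compact_Int_closed compact_Times closed_level) auto
  have cont2: "continuous_on A (\<lambda>p::real\<times>real. (cis (fst p), cis (snd p)))"
    "continuous_on A (\<lambda>p::real\<times>real. (cis (snd p), cis (fst p)))" for A
    by (intro continuous_intros)+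
  have short: "\<exists>s t. x = cis s \<and> y = cis t \<and> 0 \<le> s \<and> s \<le> 2 * pi \<and> 0 \<le> t \<and> t \<le> 4 * pi \<and> level f s t"
    if xy: "x = cis s" "y = cis t" and lv: "level f s t" and le: "s \<le> t" for x y s t
  proof -
    obtain k :: int where k: "0 \<le> s + 2 * pi * k" "s + 2 * pi * k < 0 + 2 * pi"
      using shift_into[of "2 * pi" 0 s] by auto
    have "level f (s + 2 * pi * k) (t + 2 * pi * k)" using lv level_shift by blast
    from level_window[OF this] obtain t' where t': "cis t' = cis (t + 2 * pi * k)" "s + 2 * pi * k \<le> t'"
        "t' < s + 2 * pi * k + 2 * pi" "level f (s + 2 * pi * k) t'"
      using le by auto
    show ?thesis
      by (rule exI[of _ "s + 2 * pi * k"], rule exI[of _ t']) (use k t' xy in auto)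
  qed
  have "{p. crel f (fst p) (snd p)} = (\<lambda>p. (cis (fst p), cis (snd p))) ` ?K
      \<union> (\<lambda>p. (cis (snd p), cis (fst p))) ` ?K" (is "?L = ?R")
  proof (intro antisym subsetI)
    fix p assume "p \<in> ?L"
    then obtain s t where st: "fst p = cis s" "snd p = cis t" "level f s t" by (auto simp: crel_def)
    show "p \<in> ?R"
    proof (cases "s \<le> t")
      case True
      then obtain s t where *: "fst p = cis s \<and> snd p = cis t \<and> 0 \<le> s \<and> s \<le> 2 * pi \<and> 0 \<le> t \<and> t \<le> 4 * pi \<and> level f s t"
        using short st by blast
      then have "p = (\<lambda>p. (cis (fst p), cis (snd p))) (s, t)" "(s, t) \<in> ?K" by (auto simp: prod_eq_iff)
      then show ?thesis by blast
    next
      case False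
      then obtain s t where *: "snd p = cis s \<and> fst p = cis t \<and> 0 \<le> s \<and> s \<le> 2 * pi \<and> 0 \<le> t \<and> t \<le> 4 * pi \<and> level f s t"
        using short[of "snd p" t "fst p" s] st level_sym by force
      then have "p = (\<lambda>p. (cis (snd p), cis (fst p))) (s, t)" "(s, t) \<in> ?K" by (auto simp: prod_eq_iff)
      then show ?thesis by blast
    qed
  next
    fix p assume "p \<in> ?R"
    then obtain a b where "level f a b" "p = (cis a, cis b) \<or> p = (cis b, cis a)" by auto
    then have "crel f (fst p) (snd p)" using level_sym unfolding crel_def by (metis fst_conv snd_conv)
    then show "p \<in> ?L" by simp
  qed
  moreover have "compact ?R" using K by (intro compact_Un compact_continuous_image cont2)
  ultimately have "compact {p. crel f (fst p) (snd p)}" by (simp only:)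
  then show ?thesis by (rule compact_imp_closed)
qed

text \<open>Every member of the class has a lift within one turn of \<open>s\<close>. On each side
  of \<open>s\<close> the tied lifts form a compact set, and the segment from \<open>s\<close> to
  its extreme member contains all of them.\<close>

lemma finite_clsI:
  assumes fin: "\<And>t. level f s t \<Longrightarrow> finite (tied f s t)"
  shows "finite (cls f (cis s))"
proof -
  have part: "finite ({a..b} \<inter> {t. level f s t})" (is "finite ?A")
    if ab: "a = s \<or> b = s" for a b
  proof (cases "?A = {}")
    case False
    have "closed ((\<lambda>t. (s, t)) -` {p. level f (fst p) (snd p)})"
      by (intro closed_vimage closed_level continuous_intros)
    then have "closed {t. level f s t}" by (simp add: vimage_def)
    then have comp: "compact ?A" by (intro compact_Int_closed) auto
    obtain m where m: "m \<in> ?A" "\<And>t. t \<in> ?A \<Longrightarrow> t \<le> m" using compact_attains_sup[OF comp False] by blast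
    obtain n where n: "n \<in> ?A" "\<And>t. t \<in> ?A \<Longrightarrow> n \<le> t" using compact_attains_inf[OF comp False] by blast
    have "?A \<subseteq> tied f s m \<union> tied f s n"
    proof
      fix t assume t: "t \<in> ?A"
      then have "t \<in> closed_segment s m \<or> t \<in> closed_segment s n"
        using ab m(2)[OF t] n(2)[OF t] by (auto simp: closed_segment_eq_real_ivl)
      then show "t \<in> tied f s m \<union> tied f s n" using t by (auto simp: tied_def level_def)
    qed
    then show ?thesis using fin m(1) n(1) finite_subset by blast
  qed simp
  have "cls f (cis s) \<subseteq> cis ` ({s..s + 2 * pi} \<inter> {t. level f s t} \<union> {s - 2 * pi..s} \<inter> {t. level f s t})"
  proof
    fix w assume "w \<in> cls f (cis s)"
    then obtain t where "w = cis t" "level f s t" by (auto simp: cls_def crel_cis_iff)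
    then obtain t' where t': "w = cis t'" "\<bar>t' - s\<bar> \<le> 2 * pi" "level f s t'" using level_window_abs by metis
    then have "t' \<in> {s..s + 2 * pi} \<inter> {t. level f s t} \<union> {s - 2 * pi..s} \<inter> {t. level f s t}" by auto
    then show "w \<in> cis ` ({s..s + 2 * pi} \<inter> {t. level f s t} \<union> {s - 2 * pi..s} \<inter> {t. level f s t})"
      using t'(1) by blast
  qed
  moreover have "finite ({s..s + 2 * pi} \<inter> {t. level f s t} \<union> {s - 2 * pi..s} \<inter> {t. level f s t})"
    using part by blast
  ultimately show ?thesis using finite_surj by blast
qed

lemma lam_subset: "lam f \<subseteq> leaf_space"
proof
  fix l assume "l \<in> lam f"
  then obtain x y where l: "l = {x, y}" "edge f x y" by (rule lamE)
  then have "x \<in> S1" "y \<in> S1" "x \<noteq> y" using edge_S1[OF l(2)] by (auto simp: edge_def)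
  then show "l \<in> leaf_space" unfolding l leaf_space_def by blast
qed

lemma lamination_lam: "lamination (lam f)"
proof -
  \<comment> \<open>On pairs of distinct points this is the edge relation; not crossing is a closed
    condition because \<open>sep\<close> is a strict inequality.\<close>
  define C where "C = {p. crel f (fst p) (snd p)}
    \<inter> (\<Inter>q\<in>{p. crel f (fst p) (snd p)}. {p. 0 \<le> side (fst q) (snd q) (fst p) * side (fst q) (snd q) (snd p)})"
  have "closed C" unfolding C_def
    by (intro closed_Int closed_INT closed_crel ballI closed_Collect_le) (auto simp: side_def intro!: continuous_intros)
  have edge_C: "edge f (fst p) (snd p) \<longleftrightarrow> p \<in> C" if "p \<in> S1 \<times> S1 - Id" for p
    using that by (auto simp: edge_def C_def sep_def not_less)
  have "{fst p, snd p} \<in> leaf_space" if "p \<in> S1 \<times> S1 - Id" for p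
  proof -
    obtain a b where p: "p = (a, b)" by (cases p)
    show ?thesis unfolding leaf_space_def
      by (rule CollectI, rule exI[of _ a], rule exI[of _ b]) (use that p in auto)
  qed
  then have "{p \<in> S1 \<times> S1 - Id. {fst p, snd p} \<in> leaf_space - lam f} = (S1 \<times> S1 - Id) \<inter> - C"
    using edge_C unfolding Diff_iff lam_iff by blast
  then have "openin leaf_topology (leaf_space - lam f)"
    unfolding openin_leaf_topology using \<open>closed C\<close> by (auto simp: openin_open_Int open_Compl)
  moreover have "topspace leaf_topology = leaf_space"
  proof (rule antisym)
    show "topspace leaf_topology \<subseteq> leaf_space"
      using openin_topspace[of leaf_topology] openin_leaf_topology by blast
    have "(\<lambda>p. {fst p, snd p}) ` (S1 \<times> S1 - Id) = topspace leaf_topology"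
      using quotient_imp_surjective_map[OF quotient_map_leaf_topology] by simp
    moreover have "leaf_space \<subseteq> (\<lambda>p. {fst p, snd p}) ` (S1 \<times> S1 - Id)"
      by (force simp: leaf_space_def)
    ultimately show "leaf_space \<subseteq> topspace leaf_topology" by simp
  qed
  ultimately have "closedin leaf_topology (lam f)" using lam_subset by (simp add: closedin_def)
  moreover have "\<not> linked l m" if l: "l \<in> lam f" and m: "m \<in> lam f" for l m
  proof
    assume lm: "linked l m"
    obtain w v where wv: "l = {w, v}" "edge f w v" using lamE[OF l] .
    obtain x y where xy: "m = {x, y}" "edge f x y" using lamE[OF m] .
    have "sep w v x y" using lm wv xy edge_S1[OF wv(2)] by (intro linked_imp_sep) (auto simp: edge_def)
    then show False using wv xy by (auto simp: edge_def)
  qed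
  ultimately show ?thesis by (auto simp: lamination_def)
qed

end

section \<open>Gaps\<close>

lemma chord_point:
  assumes z: "z \<in> cball 0 1" and s: "s < t" "t < s + 2 * pi" and on: "side (cis s) (cis t) z = 0"
  shows "z \<in> convex hull {cis s, cis t}"
proof -
  define m d where "m = (s + t) / 2" and "d = (t - s) / 2"
  have st: "s = m - d" "t = m + d" by (auto simp: m_def d_def field_simps)
  have sd: "sin d > 0" unfolding d_def using s by (intro sin_half_pos) auto
  define w where "w = z * cis (- m)"
  have z_w: "z = w * cis m" by (simp add: w_def mult.assoc cis_mult)
  have "2 * sin d * (cos d - Re w) = 0" using on unfolding side_cis_cap by (simp add: w_def m_def d_def)
  then have Re: "Re w = cos d" using sd by simp
  have "cmod w \<le> 1" using z by (simp add: w_def norm_mult)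
  then have "(cmod w)\<^sup>2 \<le> 1" by (simp add: power_le_one)
  then have "(Im w)\<^sup>2 \<le> 1 - (cos d)\<^sup>2" by (simp add: cmod_power2 Re)
  then have "(Im w)\<^sup>2 \<le> (sin d)\<^sup>2" by (simp add: sin_squared_eq)
  then have Im: "\<bar>Im w\<bar> \<le> sin d" using sd by (simp add: abs_le_square_iff[symmetric])
  define u where "u = (sin d + Im w) / (2 * sin d)"
  have u: "0 \<le> u" "u \<le> 1" using Im sd by (auto simp: u_def field_simps)
  have "(2 * u - 1) * sin d = Im w" using sd by (simp add: u_def field_simps)
  then have "w = (1 - u) *\<^sub>R cis (- d) + u *\<^sub>R cis d"
    by (auto simp: complex_eq_iff Re algebra_simps)
  then have "z = ((1 - u) *\<^sub>R cis (- d) + u *\<^sub>R cis d) * cis m"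
    unfolding z_w by (rule arg_cong)
  then have "z = (1 - u) *\<^sub>R (cis (- d) * cis m) + u *\<^sub>R (cis d * cis m)"
    by (simp only: distrib_right mult_scaleR_left)
  then have "z = (1 - u) *\<^sub>R cis s + u *\<^sub>R cis t" by (simp add: st cis_mult add.commute)
  then show ?thesis unfolding convex_hull_2 using u
    by (intro CollectI exI[of _ "1 - u"] exI[of _ u]) auto
qed

text \<open>Together with its mirror image \<open>first_below\<close> it produces the ends of a
  slightly higher and shorter tie in \<open>exists_hull\<close>.\<close>

lemma last_below:
  fixes f :: "real \<Rightarrow> real"
  assumes "continuous_on {a..b} f" "a < b" "f a < h" "h < f b"
  obtains s where "a < s" "s < b" "f s = h" "\<And>r. s \<le> r \<Longrightarrow> r \<le> b \<Longrightarrow> h \<le> f r"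
proof -
  let ?S = "{r \<in> {a..b}. f r = h}"
  have "closed ?S" using continuous_closed_preimage_constant[OF assms(1)] by simp
  then have "compact ({a..b} \<inter> ?S)" by (rule compact_Int_closed[OF compact_Icc])
  moreover have "{a..b} \<inter> ?S = ?S" by auto
  ultimately have comp: "compact ?S" by (simp only:)
  have ne: "?S \<noteq> {}" using IVT'[of f a h b] assms by auto
  have "\<exists>s\<in>?S. \<forall>r\<in>?S. r \<le> s" using compact_attains_sup[OF comp ne] .
  then obtain s where s: "s \<in> ?S" "\<And>r. r \<in> ?S \<Longrightarrow> r \<le> s" by blast
  have "h \<le> f r" if sr: "s \<le> r" and rb: "r \<le> b" for r
  proof (rule ccontr)
    assume "\<not> h \<le> f r"
    then have r: "f r < h" by simp
    have "continuous_on {r..b} f" using assms(1) by (rule continuous_on_subset) (use s sr in auto)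
    then obtain q where "r \<le> q" "q \<le> b" "f q = h" using IVT'[of f r h b] r assms(4) rb by auto
    moreover have "q \<noteq> r" using \<open>f q = h\<close> r by auto
    ultimately show False using s(2)[of q] s(1) sr by auto
  qed
  moreover have "a \<noteq> s" "s \<noteq> b" using s(1) assms by auto
  ultimately show ?thesis using that[of s] s(1) by auto
qed

lemma first_below:
  fixes f :: "real \<Rightarrow> real"
  assumes "continuous_on {a..b} f" "a < b" "h < f a" "f b < h"
  obtains t where "a < t" "t < b" "f t = h" "\<And>r. a \<le> r \<Longrightarrow> r \<le> t \<Longrightarrow> h \<le> f r"
proof -
  have "continuous_on {-b..-a} (\<lambda>x. f (- x))"
    by (intro continuous_on_compose2[OF assms(1)] continuous_intros) auto
  from last_below[OF this, of h] assms obtain s where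
    "-b < s" "s < -a" "f (- s) = h" "\<And>r. s \<le> r \<Longrightarrow> r \<le> -a \<Longrightarrow> h \<le> f (- r)" by auto
  then show ?thesis using that[of "-s"] by (metis minus_le_iff minus_less_iff minus_minus neg_le_iff_le)
qed

section \<open>Hulls of finite classes and the gaps\<close>

locale finite_circle_height = circle_height +
  assumes finite_class: "z \<in> S1 \<Longrightarrow> finite (cls f z)"
begin

lemma global_min: obtains s where "\<And>r. f s \<le> f r"
proof -
  obtain s where s: "s \<in> {0..2*pi}" "\<And>r. r \<in> {0..2*pi} \<Longrightarrow> f s \<le> f r"
    using continuous_attains_inf[OF compact_Icc _ continuous_on_subset[OF continuous subset_UNIV], of 0 "2 * pi"]
    by auto
  show ?thesis
  proof
    fix r
    obtain k :: int where "0 \<le> r + 2 * pi * k" "r + 2 * pi * k < 0 + 2 * pi"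
      using shift_into[of "2 * pi" 0 r] by auto
    then show "f s \<le> f r" using s(2)[of "r + 2 * pi * k"] periodic_int by auto
  qed
qed

text \<open>Among the ties whose chord cuts off the point, take a shortest one: the point lies in the hull of
  its class.\<close>

lemma exists_hull:
  assumes z: "z \<in> ball 0 1"
  shows "\<exists>u\<in>S1. z \<in> convex hull (cls f u)"
proof -
  have nz: "cmod z < 1" using z by simp
  obtain m where m: "\<And>r. f m \<le> f r" using global_min by blast
  \<comment> \<open>\<open>cap s t\<close> says that \<open>z\<close> lies in the closed cap over
    the arc from \<open>s\<close> to \<open>t\<close>. It holds for every full turn and fails for
    \<open>s = t\<close>, because \<open>z\<close> is inside the disk.\<close>
  define cap where "cap s t \<longleftrightarrow> cos ((t - s) / 2) \<le> Re (z * cis (- ((s + t) / 2)))" for s t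
  have Re_less: "\<bar>Re (z * cis a)\<bar> < 1" for a
    using abs_Re_le_cmod[of "z * cis a"] nz by (simp add: norm_mult)
  define Q where "Q = {p. m \<le> fst p \<and> fst p \<le> snd p \<and> snd p \<le> m + 2 * pi \<and> level f (fst p) (snd p) \<and> cap (fst p) (snd p)}"
  have cl2: "closed {p. cap (fst p) (snd p)}" "closed {p::real\<times>real. fst p \<le> snd p}"
    unfolding cap_def by (intro closed_Collect_le continuous_intros; simp)+
  have "Q = ({m..m + 2 * pi} \<times> {m..m + 2 * pi}) \<inter> ({p. level f (fst p) (snd p)} \<inter> ({p. cap (fst p) (snd p)} \<inter> {p. fst p \<le> snd p}))"
    by (auto simp: Q_def)
  moreover have "compact (({m..m + 2 * pi} \<times> {m..m + 2 * pi}) \<inter> ({p. level f (fst p) (snd p)} \<inter> ({p. cap (fst p) (snd p)} \<inter> {p. fst p \<le> snd p})))"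
    by (intro compact_Int_closed compact_Times closed_Int closed_level cl2) auto
  ultimately have "compact Q" by simp
  \<comment> \<open>The window starts at a global minimum so that the full turn is a tie and there
    is something to minimize over.\<close>
  moreover have "(m, m + 2 * pi) \<in> Q"
    using m periodic Re_less[of "- ((m + (m + 2 * pi)) / 2)"] by (auto simp: Q_def cap_def level_def)
  moreover have "continuous_on Q (\<lambda>p. snd p - fst p)" by (intro continuous_intros)
  ultimately have "\<exists>p\<in>Q. \<forall>q\<in>Q. snd p - fst p \<le> snd q - fst q"
    by (intro continuous_attains_inf) auto
  then obtain p where p: "p \<in> Q" "\<And>q. q \<in> Q \<Longrightarrow> snd p - fst p \<le> snd q - fst q" by blast
  obtain s t where pst: "p = (s, t)" by (cases p)
  have st: "m \<le> s" "s \<le> t" "t \<le> m + 2 * pi" and lv: "level f s t" and cp: "cap s t"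
    using p(1) by (auto simp: Q_def pst)
  have min: "t - s \<le> t' - s'" if "m \<le> s'" "s' \<le> t'" "t' \<le> m + 2 * pi" "level f s' t'" "cap s' t'" for s' t'
    using p(2)[of "(s', t')"] that by (auto simp: Q_def pst)
  have "s \<noteq> t" using cp Re_less[of "- ((s + t) / 2)"] by (auto simp: cap_def)
  then have lt: "s < t" using st by simp
  have le: "f s \<le> f r" if "s \<le> r" "r \<le> t" for r using lv that st by (auto simp: level_iff)
  have side_pos: "side (cis s') (cis t') z > 0" if "s' < t'" "t' < s' + 2 * pi" "\<not> cap s' t'" for s' t'
    unfolding side_cis_cap using that sin_half_pos[of "t' - s'"] by (auto simp: cap_def)
  show ?thesis
  proof (cases "\<exists>r. s < r \<and> r < t \<and> f r = f s")
    case True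
    \<comment> \<open>An intermediate point of the same height splits the tie into two shorter ones,
      neither of which cuts off \<open>z\<close>; so \<open>z\<close> lies in the triangle.\<close>
    then obtain r where r: "s < r" "r < t" "f r = f s" by blast
    have lsr: "level f s r" using r le by (auto simp: level_iff)
    have "f s = f t" using lv by (simp add: level_def)
    then have lrt: "level f r t" using r le by (auto simp: level_iff)
    have sr: "side (cis s) (cis r) z > 0"
      using min[of s r] r st lsr by (intro side_pos) auto
    have rt: "side (cis r) (cis t) z > 0"
      using min[of r t] r st lrt by (intro side_pos) auto
    have "t \<noteq> s + 2 * pi"
    proof
      assume "t = s + 2 * pi"
      then have "cis t = cis s" by simp
      then show False using sr rt side_swap[of "cis s" "cis r" z] by simp
    qed
    then have "t < s + 2 * pi" using st by simp
    then have D: "side (cis s) (cis r) (cis t) > 0" using r by (intro side_cis_pos) auto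
    have "sin ((t - s) / 2) \<ge> 0" using st lt by (intro sin_ge_zero) auto
    then have "side (cis s) (cis t) z \<le> 0"
      unfolding side_cis_cap using cp by (intro mult_nonneg_nonpos) (auto simp: cap_def)
    then have ts: "side (cis t) (cis s) z \<ge> 0" using side_swap[of "cis s" "cis t" z] by simp
    have "z \<in> convex hull {cis s, cis r, cis t}"
      using barycentric[OF D] sr rt ts by simp
    moreover have "{cis s, cis r, cis t} \<subseteq> cls f (cis s)"
      using lsr lv by (auto simp: cls_def crel_cis_iff intro: level_refl)
    ultimately show ?thesis using hull_mono cis_in_S1 by blast
  next
    case False
    then have gt: "f s < f r" if "s < r" "r < t" for r using le[of r] that by force
    show ?thesis
    proof (cases "cos ((t - s) / 2) = Re (z * cis (- ((s + t) / 2)))")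
      case True
      have "t \<noteq> s + 2 * pi"
      proof
        assume "t = s + 2 * pi"
        then show False using True Re_less[of "- ((s + t) / 2)"] by simp
      qed
      then have "t < s + 2 * pi" using st by simp
      moreover have "side (cis s) (cis t) z = 0" unfolding side_cis_cap using True by simp
      ultimately have "z \<in> convex hull {cis s, cis t}" using lt nz by (intro chord_point) auto
      moreover have "{cis s, cis t} \<subseteq> cls f (cis s)"
        using lv by (auto simp: cls_def crel_cis_iff intro: level_refl)
      ultimately show ?thesis using hull_mono cis_in_S1 by blast
    next
      case False
      \<comment> \<open>Here \<open>z\<close> is strictly inside the cap and the height strictly
        exceeds \<open>f s\<close> between the ends. Both ends can then be moved inwards to a
        slightly larger height without losing \<open>z\<close>, against minimality.\<close>
      define G where "G p = Re (z * cis (- ((fst p + snd p) / 2))) - cos ((snd p - fst p) / 2)" for p :: "real \<times> real"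
      have "continuous_on UNIV G" unfolding G_def by (intro continuous_intros) auto
      moreover have "G (s, t) > 0" using False cp by (auto simp: G_def cap_def)
      ultimately have "open {p. 0 < G p}" "(s, t) \<in> {p. 0 < G p}"
        by (auto intro!: open_Collect_less continuous_on_const)
      then obtain d where d: "d > 0" "ball (s, t) d \<subseteq> {p. 0 < G p}" using open_contains_ball by blast
      define e where "e = min (d / 2) ((t - s) / 3)"
      have e: "e > 0" "e \<le> d / 2" "e \<le> (t - s) / 3"
        using d lt by (simp_all only: e_def min.cobounded1 min.cobounded2 min_less_iff_conj) auto
      have near: "cap s' t'" if "s \<le> s'" "s' < s + e" "t - e < t'" "t' \<le> t" for s' t'
      proof -
        have "dist (s, t) (s', t') \<le> \<bar>s - s'\<bar> + \<bar>t - t'\<bar>"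
          using sqrt_sum_squares_le_sum_abs[of "s - s'" "t - t'"] by (simp add: dist_Pair_Pair dist_real_def)
        then have "(s', t') \<in> ball (s, t) d" using that e by auto
        then have "0 < G (s', t')" using d by auto
        then show ?thesis by (simp add: G_def cap_def)
      qed
      have conts: "continuous_on A f" for A using continuous continuous_on_subset by blast
      have "3 * e \<le> t - s" using e(3) by (simp add: pos_le_divide_eq mult.commute)
      then have le3: "s + e \<le> t - e" using e(1) by linarith
      obtain c where c: "c \<in> {s + e..t - e}" "\<And>r. r \<in> {s + e..t - e} \<Longrightarrow> f c \<le> f r"
        using continuous_attains_inf[of "{s + e..t - e}" f] conts le3 by auto
      have "f s < f c" using c e by (intro gt) auto
      then obtain h where h: "f s < h" "h < f c" using dense by blast
      have "h < f (s + e)" "h < f (t - e)" using c(2)[of "s + e"] c(2)[of "t - e"] h le3 by auto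
      moreover have "f t < h" using h lv by (simp add: level_def)
      ultimately have hs: "f s < h" "h < f (s + e)" and ht: "h < f (t - e)" "f t < h" using h by auto
      obtain s' where s': "s < s'" "s' < s + e" "f s' = h" "\<And>r. s' \<le> r \<Longrightarrow> r \<le> s + e \<Longrightarrow> h \<le> f r"
        using last_below[OF conts _ hs] e by auto
      obtain t' where t': "t - e < t'" "t' < t" "f t' = h" "\<And>r. t - e \<le> r \<Longrightarrow> r \<le> t' \<Longrightarrow> h \<le> f r"
        using first_below[OF conts _ ht] e by auto
      have "h \<le> f r" if "s' \<le> r" "r \<le> t'" for r
        using s'(4)[of r] t'(4)[of r] c(2)[of r] h that by (cases "r \<le> s + e"; cases "t - e \<le> r") auto
      then have "level f s' t'" using s' t' le3 by (auto simp: level_iff)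
      then have "t - s \<le> t' - s'" using near[of s' t'] s' t' st le3 by (intro min) auto
      then show ?thesis using s' t' by simp
    qed
  qed
qed

lemma cls_eqI: "crel f x y \<Longrightarrow> cls f x = cls f y"
  using crel_sym[of f x y] crel_trans[of x y] crel_trans[of y x] by (auto simp: cls_def)

lemma cls_self: "x \<in> S1 \<Longrightarrow> x \<in> cls f x"
  by (simp add: cls_def crel_refl)

lemma edge_at:
  assumes x: "x \<in> S1" and y: "y \<in> cls f x" "y \<noteq> x"
  shows "\<exists>y. edge f x y"
proof -
  obtain s where s: "x = cis s" using S1_cis x by blast
  \<comment> \<open>The edge sought leads to the next member of the class counterclockwise: no
    member lies on the arc between.\<close>
  define R where "R = {r. s < r \<and> r < s + 2 * pi \<and> cis r \<in> cls f x}"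
  have "inj_on cis R" using cis_inj_window[of _ _ s] by (force simp: R_def inj_on_def)
  moreover have "cis ` R \<subseteq> cls f x" by (auto simp: R_def)
  ultimately have fin: "finite R" using finite_class[OF x] finite_subset inj_on_finite by metis
  obtain r where r: "y = cis r" "s \<le> r" "r < s + 2 * pi" using S1_lift y cls_S1 by blast
  then have "r \<in> R" using y s by (cases "r = s") (auto simp: R_def)
  then have "R \<noteq> {}" by blast
  then have Min: "Min R \<in> R" "\<And>q. q \<in> R \<Longrightarrow> Min R \<le> q"
    using fin Min_in Min_le by blast+
  let ?y = "cis (Min R)"
  have neq: "x \<noteq> ?y" using cis_inj_window[of s "Min R" s] Min(1) s by (auto simp: R_def)
  have "edge f x ?y"
  proof (rule edgeI_cls)
    show "crel f x ?y" using Min(1) by (simp add: R_def cls_def)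
    fix w v assume wv: "w \<in> cls f x" "v \<in> cls f x"
    show "\<not> sep x ?y w v"
    proof
      assume "sep x ?y w v"
      moreover have "w \<in> S1" "v \<in> S1" "s < Min R" "Min R < s + 2 * pi"
        using wv subsetD[OF cls_S1] Min(1) by (simp_all add: R_def)
      ultimately obtain r where r: "s < r" "r < Min R" "w = cis r \<or> v = cis r"
        using sepE[OF x cis_in_S1 _ _ _ s HOL.refl] by metis
      then have "r \<in> R" using wv Min(1) by (auto simp: R_def)
      then show False using Min(2) r by force
    qed
  qed (rule neq)
  then show ?thesis by blast
qed

text \<open>A point \<open>r *\<^sub>R x\<close> close to the circle lies in the hull of a class, so
  some member \<open>y\<close> satisfies \<open>r \<le> x \<bullet> y\<close> and is close to
  \<open>x\<close>. The class has further members, since a single point of the circle is not inside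
  the disk.\<close>

lemma dense_lam: "S1 \<subseteq> closure (endpoints (lam f))"
proof
  fix x :: complex assume x: "x \<in> S1"
  show "x \<in> closure (endpoints (lam f))"
  proof (unfold closure_approachable, intro allI impI)
    fix e :: real assume e: "e > 0"
    define r where "r = max 0 (1 - e\<^sup>2 / 4)"
    have r: "0 \<le> r" "r < 1" "2 - 2 * r < e\<^sup>2" using e by (auto simp: r_def max_def)
    have "r *\<^sub>R x \<in> ball 0 1" using x r by auto
    then obtain u where u: "u \<in> S1" "r *\<^sub>R x \<in> convex hull (cls f u)" using exists_hull by blast
    have "\<exists>y\<in>cls f u. r \<le> x \<bullet> y"
    proof (rule ccontr)
      assume "\<not> ?thesis"
      then have "convex hull (cls f u) \<subseteq> {y. x \<bullet> y < r}"
        by (intro hull_minimal convex_halfspace_lt) auto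
      then have "x \<bullet> (r *\<^sub>R x) < r" using u by blast
      then show False using x by (simp add: dot_square_norm)
    qed
    then obtain y where y: "y \<in> cls f u" "r \<le> x \<bullet> y" by blast
    then have yS: "y \<in> S1" using cls_S1 by blast
    have "x \<bullet> x = 1" "y \<bullet> y = 1" using x yS by (simp_all add: dot_square_norm)
    then have "(dist y x)\<^sup>2 = 2 - 2 * (x \<bullet> y)"
      unfolding dist_norm power2_norm_eq_inner inner_diff_left inner_diff_right inner_commute[of y x] by simp
    then have "(dist y x)\<^sup>2 < e\<^sup>2" using r y by simp
    then have "dist y x < e" using e by (intro power_less_imp_less_base[of _ 2 e]) auto
    moreover have "y \<in> endpoints (lam f)"
    proof -
      have "cls f u \<noteq> {y}" using u \<open>r *\<^sub>R x \<in> ball 0 1\<close> yS by auto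
      then obtain y' where "y' \<in> cls f u" "y' \<noteq> y" using y by blast
      then have "y' \<in> cls f y" using cls_crel[OF y(1), of y'] by (simp add: cls_def[of f y])
      then obtain v where "edge f y v" using edge_at[OF yS] \<open>y' \<noteq> y\<close> by blast
      then show ?thesis by (auto simp: endpoints_def lam_def)
    qed
    ultimately show "\<exists>y\<in>endpoints (lam f). dist y x < e" by blast
  qed
qed

lemma interior_hull_disjoint_leaf:
  assumes "u \<in> S1" "l \<in> lam f" shows "interior (convex hull (cls f u)) \<inter> convex hull l = {}"
proof (rule ccontr)
  assume "\<not> ?thesis"
  then obtain z where z: "z \<in> interior (convex hull (cls f u))" "z \<in> convex hull l" by blast
  obtain x y where l: "l = {x, y}" "edge f x y" using lamE assms by blast
  have "side x y z = 0" using z l side_on_segment by blast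
  then obtain w v where wv: "w \<in> cls f u" "v \<in> cls f u" "side x y w < 0" "side x y v > 0"
    using interior_convex_hull_both_sides z(1) l(2) unfolding edge_def by metis
  then have "sep x y w v" by (simp add: sep_def mult_less_0_iff)
  then show False using edge_one_side l(2) cls_crel wv by blast
qed

lemma boundary_in_leaf:
  assumes "u \<in> S1" "z \<in> ball 0 1" "z \<in> convex hull (cls f u)" "z \<notin> interior (convex hull (cls f u))"
  shows "\<exists>l\<in>lam f. z \<in> geodesic l"
proof -
  obtain x y where xy: "x \<in> cls f u" "y \<in> cls f u" "x \<noteq> y" "z \<in> convex hull {x, y}"
    "\<And>w. w \<in> cls f u \<Longrightarrow> side x y w \<ge> 0"
    using boundary_point_on_edge[OF finite_class[OF assms(1)] cls_S1 assms(2-4)] by blast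
  have "crel f u x" using xy(1) by (simp add: cls_def)
  then have eq: "cls f x = cls f u" using cls_eqI by metis
  have "edge f x y"
  proof (rule edgeI_cls)
    show "\<not> sep x y w v" if "w \<in> cls f x" "v \<in> cls f x" for w v
      using xy(5) that mult_nonneg_nonneg unfolding sep_def eq by (metis not_less)
  qed (use xy cls_crel in auto)
  then show ?thesis using xy assms(2) by (intro bexI[of _ "{x, y}"]) (auto simp: lam_iff geodesic_def)
qed

lemma components_complement:
  "components (ball 0 1 - (\<Union>l\<in>lam f. geodesic l))
    = {interior (convex hull (cls f u)) | u. u \<in> S1 \<and> interior (convex hull (cls f u)) \<noteq> {}}"
    (is "components ?U = ?C")
proof (rule components_open_unique)
  let ?I = "\<lambda>u. interior (convex hull (cls f u))"
  have sub: "?I u \<subseteq> ball 0 1" for u using interior_hull_S1_subset cls_S1 by blast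
  have le: "?I u \<subseteq> ?I v" if uv: "u \<in> S1" "v \<in> S1" and ne: "?I u \<inter> ?I v \<noteq> {}" for u v
  proof (rule interior_maximal)
    \<comment> \<open>Otherwise the interior of one hull meets the frontier of the other, which
      inside the disk is made of leaves; but leaves avoid the interiors of all hulls.\<close>
    show "?I u \<subseteq> convex hull (cls f v)"
    proof (rule ccontr)
      assume "\<not> ?thesis"
      then have "?I u \<inter> frontier (convex hull (cls f v)) \<noteq> {}"
        using ne interior_subset[of "convex hull (cls f v)"]
        by (intro connected_Int_frontier convex_connected convex_interior convex_convex_hull) blast+
      then obtain z where z: "z \<in> ?I u" "z \<in> frontier (convex hull (cls f v))" by blast
      have "closed (convex hull (cls f v))"
        using finite_class[OF uv(2)] by (simp add: compact_imp_closed finite_imp_compact_convex_hull)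
      then have "z \<in> convex hull (cls f v)" "z \<notin> ?I v" using z(2) by (auto simp: frontier_def)
      then obtain l where "l \<in> lam f" "z \<in> geodesic l"
        using boundary_in_leaf uv z(1) sub by blast
      then show False using interior_hull_disjoint_leaf[OF uv(1)] z(1) by (auto simp: geodesic_def)
    qed
  qed simp
  show "pairwise disjnt ?C"
  proof (unfold pairwise_def disjnt_def, intro ballI impI)
    fix X Y assume "X \<in> ?C" "Y \<in> ?C" and neq: "X \<noteq> Y"
    then obtain u v where uv: "u \<in> S1" "v \<in> S1" "X = ?I u" "Y = ?I v" by blast
    show "X \<inter> Y = {}"
    proof (rule ccontr)
      assume "X \<inter> Y \<noteq> {}"
      then have "?I u \<subseteq> ?I v" "?I v \<subseteq> ?I u" using le[of u v] le[of v u] uv by blast+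
      then show False using neq uv by blast
    qed
  qed
  show "\<Union>?C = ?U"
  proof (intro antisym subsetI)
    fix z assume "z \<in> \<Union>?C"
    then obtain u where "u \<in> S1" "z \<in> ?I u" by blast
    then show "z \<in> ?U" using sub interior_hull_disjoint_leaf[of u] by (force simp: geodesic_def)
  next
    fix z assume z: "z \<in> ?U"
    then obtain u where u: "u \<in> S1" "z \<in> convex hull (cls f u)" using exists_hull by blast
    then have "z \<in> ?I u" using boundary_in_leaf[of u z] z by blast
    then show "z \<in> \<Union>?C" using u by blast
  qed
  show "open X \<and> connected X \<and> X \<noteq> {}" if "X \<in> ?C" for X
    using that by (auto intro!: convex_connected convex_interior convex_convex_hull)
qed

lemma gap_iff:
  "gap (lam f) P \<longleftrightarrow> (\<exists>u\<in>S1. P = convex hull (cls f u) \<and> 3 \<le> card (cls f u))"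
proof -
  have closure: "closure (interior (convex hull (cls f u))) = convex hull (cls f u)"
    if "u \<in> S1" "interior (convex hull (cls f u)) \<noteq> {}" for u
    using that finite_class[of u] convex_closure_interior[OF convex_convex_hull that(2)]
    by (simp add: compact_imp_closed finite_imp_compact_convex_hull)
  have card: "interior (convex hull (cls f u)) \<noteq> {} \<longleftrightarrow> 3 \<le> card (cls f u)" if "u \<in> S1" for u
    using interior_hull_nonempty_iff[OF finite_class[OF that] cls_S1] .
  show ?thesis
  proof
    assume "gap (lam f) P"
    then obtain u where "u \<in> S1" "interior (convex hull (cls f u)) \<noteq> {}"
      "P = closure (interior (convex hull (cls f u)))"
      unfolding gap_def components_complement by auto
    then show "\<exists>u\<in>S1. P = convex hull (cls f u) \<and> 3 \<le> card (cls f u)" using closure card by auto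
  next
    assume "\<exists>u\<in>S1. P = convex hull (cls f u) \<and> 3 \<le> card (cls f u)"
    then obtain u where "u \<in> S1" "P = convex hull (cls f u)" "3 \<le> card (cls f u)" by blast
    then show "gap (lam f) P"
      unfolding gap_def components_complement using closure[of u] card[of u] by blast
  qed
qed

lemma very_full_lam: "very_full (lam f)"
  unfolding very_full_def gap_iff ideal_polygon_def using finite_class cls_S1 by metis

text \<open>Leaves with a common endpoint have all their endpoints in the class of that point, so
  the class has at least three members and its hull is a gap with both leaves on its
  boundary.\<close>

lemma loose_lam: "loose (lam f)"
  unfolding loose_def
proof (intro ballI impI)
  fix l m assume lm: "l \<in> lam f" "m \<in> lam f" "l \<noteq> m" "l \<inter> m \<noteq> {}"
  then obtain x where x: "x \<in> l" "x \<in> m" by blast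
  have other: "\<exists>y. k = {x, y} \<and> edge f x y" if k: "k \<in> lam f" "x \<in> k" for k
  proof -
    obtain a b where "k = {a, b}" "edge f a b" using lamE[OF k(1)] .
    then show ?thesis using k(2) edge_sym by (metis insert_commute insertE singletonD)
  qed
  obtain y y' where y: "l = {x, y}" "edge f x y" and y': "m = {x, y'}" "edge f x y'"
    using other[of l] other[of m] lm x by blast
  have xS: "x \<in> S1" using edge_S1 y by blast
  let ?c = "cls f x"
  have c: "finite ?c" "?c \<subseteq> S1" using finite_class xS cls_S1 by auto
  have mem: "x \<in> ?c" "y \<in> ?c" "y' \<in> ?c" using y y' cls_self xS by (auto simp: cls_def edge_def)
  have "card {x, y, y'} = 3" using y y' lm(3) by (auto simp: edge_def)
  then have "3 \<le> card ?c" using card_mono[OF c(1), of "{x, y, y'}"] mem by simp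
  then have "gap (lam f) (convex hull ?c)" using xS gap_iff by blast
  moreover have "(convex hull {x, v}) edge_of (convex hull ?c)" if e: "edge f x v" for v
  proof -
    have v: "v \<in> ?c" "x \<noteq> v" using e by (auto simp: cls_def edge_def)
    show ?thesis
      using edge_cls_one_side[OF e mem(1)]
    proof
      assume "\<forall>w\<in>?c. 0 \<le> side x v w"
      then show ?thesis using edge_of_hullI[OF c mem(1) v] by blast
    next
      assume "\<forall>w\<in>?c. 0 \<le> side v x w"
      then show ?thesis using edge_of_hullI[OF c v(1) mem(1)] v(2) by (metis insert_commute)
    qed
  qed
  ultimately show "\<exists>P. gap (lam f) P \<and> (convex hull l) edge_of P \<and> (convex hull m) edge_of P"
    using y y' by blast
qed

end

section \<open>A self-similar function\<close>

text \<open>The graph is replaced by six affine copies of itself, running through the heights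
  0, 1/2, 3/4, 1/2, 3/4, 1/2, 1.\<close>

definition stem_step :: "(real \<Rightarrow> real) \<Rightarrow> real \<Rightarrow> real"
  where "stem_step g x = g (6 * x) / 2 + g (6 * x - 1) / 4 - (1 - g (3 - 6 * x)) / 4
    + g (6 * x - 3) / 4 - (1 - g (5 - 6 * x)) / 4 + g (6 * x - 5) / 2"

text \<open>An invariant of \<open>stem_step\<close>. The linear bounds survive the passage to the
  limit and keep its values strictly between 0 and 1 inside the interval; strict inequalities would
  not survive.\<close>

definition clamped :: "(real \<Rightarrow> real) \<Rightarrow> bool"
  where "clamped g \<longleftrightarrow> (\<forall>x\<le>0. g x = 0) \<and> (\<forall>x\<ge>1. g x = 1)
    \<and> (\<forall>x. 0 \<le> x \<and> x \<le> 1 \<longrightarrow> x / 2 \<le> g x \<and> g x \<le> (3 + x) / 4)"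

text \<open>For a clamped \<open>g\<close> only one of the six summands varies on each piece, the
  others having reached their constant values. A sum instead of a case distinction makes continuity
  evident.\<close>

lemma stem_step_pieces:
  assumes "clamped g"
  shows "x \<le> 1/6 \<Longrightarrow> stem_step g x = g (6 * x) / 2"
    "1/6 \<le> x \<Longrightarrow> x \<le> 1/3 \<Longrightarrow> stem_step g x = 1/2 + g (6 * x - 1) / 4"
    "1/3 \<le> x \<Longrightarrow> x \<le> 1/2 \<Longrightarrow> stem_step g x = 1/2 + g (3 - 6 * x) / 4"
    "1/2 \<le> x \<Longrightarrow> x \<le> 2/3 \<Longrightarrow> stem_step g x = 1/2 + g (6 * x - 3) / 4"
    "2/3 \<le> x \<Longrightarrow> x \<le> 5/6 \<Longrightarrow> stem_step g x = 1/2 + g (5 - 6 * x) / 4"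
    "5/6 \<le> x \<Longrightarrow> stem_step g x = 1/2 + g (6 * x - 5) / 2"
  using assms by (simp_all add: stem_step_def clamped_def field_simps)

lemma six_pieces:
  fixes x :: real
  obtains "x \<le> 1/6" | "1/6 \<le> x" "x \<le> 1/3" | "1/3 \<le> x" "x \<le> 1/2"
    | "1/2 \<le> x" "x \<le> 2/3" | "2/3 \<le> x" "x \<le> 5/6" | "5/6 \<le> x"
  by linarith

lemma clampedD:
  assumes "clamped g"
  shows "x \<le> 0 \<Longrightarrow> g x = 0" "x \<ge> 1 \<Longrightarrow> g x = 1"
    "0 \<le> x \<Longrightarrow> x \<le> 1 \<Longrightarrow> x / 2 \<le> g x" "0 \<le> x \<Longrightarrow> x \<le> 1 \<Longrightarrow> g x \<le> (3 + x) / 4"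
  using assms unfolding clamped_def by blast+

lemma clamped_bounds: assumes "clamped g" shows "0 \<le> g x \<and> g x \<le> 1"
proof -
  consider "x \<le> 0" | "x \<ge> 1" | "0 \<le> x" "x \<le> 1" by linarith
  then show ?thesis using clampedD[OF assms, of x] by cases auto
qed

lemma clamped_stem_step: assumes g: "clamped g" shows "clamped (stem_step g)"
proof -
  have le: "x / 2 \<le> g x" "g x \<le> (3 + x) / 4" if "0 \<le> x" "x \<le> 1" for x
    using clampedD[OF g] that by blast+
  have "x / 2 \<le> stem_step g x \<and> stem_step g x \<le> (3 + x) / 4" if x: "0 \<le> x" "x \<le> 1" for x
  proof (cases x rule: six_pieces)
    case 1
    then show ?thesis using le(1)[of "6 * x"] clamped_bounds[OF g, of "6 * x"] x
      by (simp add: stem_step_pieces(1)[OF g])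
  next
    case 2
    then show ?thesis using clamped_bounds[OF g, of "6 * x - 1"] by (simp add: stem_step_pieces(2)[OF g])
  next
    case 3
    then show ?thesis using clamped_bounds[OF g, of "3 - 6 * x"] by (simp add: stem_step_pieces(3)[OF g])
  next
    case 4
    then show ?thesis using clamped_bounds[OF g, of "6 * x - 3"] by (simp add: stem_step_pieces(4)[OF g])
  next
    case 5
    then show ?thesis using clamped_bounds[OF g, of "5 - 6 * x"] by (simp add: stem_step_pieces(5)[OF g])
  next
    case 6
    then show ?thesis using le(2)[of "6 * x - 5"] clamped_bounds[OF g, of "6 * x - 5"] x
      by (simp add: stem_step_pieces(6)[OF g])
  qed
  moreover have "stem_step g x = 0" if "x \<le> 0" for x
    using that clampedD(1)[OF g] by (simp add: stem_step_pieces(1)[OF g])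
  moreover have "stem_step g x = 1" if "x \<ge> 1" for x
    using that clampedD(2)[OF g] by (simp add: stem_step_pieces(6)[OF g])
  ultimately show ?thesis by (auto simp: clamped_def)
qed

lemma stem_step_contraction:
  assumes g: "clamped g" and h: "clamped h" and d: "\<And>x. \<bar>g x - h x\<bar> \<le> d"
  shows "\<bar>stem_step g x - stem_step h x\<bar> \<le> d / 2"
proof -
  have dd: "\<bar>g y / 2 - h y / 2\<bar> \<le> d / 2" "\<bar>g y / 4 - h y / 4\<bar> \<le> d / 2" for y
    using d[of y] by (auto simp: abs_if field_simps split: if_splits)
  show ?thesis
    by (cases x rule: six_pieces)
      (use dd in \<open>simp_all add: stem_step_pieces[OF g] stem_step_pieces[OF h]\<close>)
qed

definition stem_iter :: "nat \<Rightarrow> real \<Rightarrow> real"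
  where "stem_iter n = (stem_step ^^ n) (\<lambda>x. max 0 (min 1 x))"

definition stem :: "real \<Rightarrow> real"
  where "stem x = lim (\<lambda>n. stem_iter n x)"

lemma clamped_stem_iter: "clamped (stem_iter n)"
proof (induction n)
  case 0 show ?case by (auto simp: stem_iter_def clamped_def)
next
  case (Suc n) then show ?case by (simp add: stem_iter_def clamped_stem_step)
qed

lemma continuous_stem_iter: "continuous_on UNIV (stem_iter n)"
proof (induction n)
  case 0 show ?case unfolding stem_iter_def by (auto intro!: continuous_intros)
next
  case (Suc n)
  have "continuous_on UNIV (\<lambda>x. stem_iter n (q x))" if "continuous_on UNIV q" for q :: "real \<Rightarrow> real"
    using continuous_on_compose2[OF Suc that] by auto
  note * = this
  have "continuous_on UNIV (\<lambda>x. stem_iter n (6 * x))" "continuous_on UNIV (\<lambda>x. stem_iter n (6 * x - 1))"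
    "continuous_on UNIV (\<lambda>x. stem_iter n (3 - 6 * x))" "continuous_on UNIV (\<lambda>x. stem_iter n (6 * x - 3))"
    "continuous_on UNIV (\<lambda>x. stem_iter n (5 - 6 * x))" "continuous_on UNIV (\<lambda>x. stem_iter n (6 * x - 5))"
    by (intro * continuous_intros)+
  then have "continuous_on UNIV (stem_step (stem_iter n))"
    unfolding stem_step_def[abs_def]
    by (intro continuous_on_add continuous_on_diff continuous_on_divide continuous_on_const) auto
  then show ?case by (simp add: stem_iter_def)
qed

lemma stem_iter_diff: "\<bar>stem_iter (Suc n) x - stem_iter n x\<bar> \<le> (1 / 2) ^ n"
proof (induction n arbitrary: x)
  case 0
  show ?case using clamped_bounds[OF clamped_stem_iter, of 0 x] clamped_bounds[OF clamped_stem_iter, of "Suc 0" x]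
    by (simp add: abs_le_iff)
next
  case (Suc n)
  have "\<bar>stem_step (stem_iter (Suc n)) x - stem_step (stem_iter n) x\<bar> \<le> (1 / 2) ^ n / 2"
    using Suc by (intro stem_step_contraction clamped_stem_iter)
  then show ?case by (simp add: stem_iter_def)
qed

lemma uniform_limit_stem: "uniform_limit UNIV stem_iter stem sequentially"
proof -
  define D where "D i x = stem_iter (Suc i) x - stem_iter i x" for i x
  have "uniform_limit UNIV (\<lambda>n x. \<Sum>i<n. D i x) (\<lambda>x. suminf (\<lambda>i. D i x)) sequentially"
    by (rule Weierstrass_m_test[where M = "\<lambda>n. (1 / 2) ^ n"])
      (use stem_iter_diff in \<open>auto simp: D_def intro!: summable_geometric\<close>)
  then have "uniform_limit UNIV (\<lambda>n x. (\<Sum>i<n. D i x) + stem_iter 0 x)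
      (\<lambda>x. suminf (\<lambda>i. D i x) + stem_iter 0 x) sequentially"
    by (intro uniform_limit_add uniform_limit_const)
  moreover have "(\<Sum>i<n. D i x) + stem_iter 0 x = stem_iter n x" for n x
    unfolding D_def using sum_lessThan_telescope[of "\<lambda>i. stem_iter i x" n] by simp
  ultimately have *: "uniform_limit UNIV stem_iter (\<lambda>x. suminf (\<lambda>i. D i x) + stem_iter 0 x) sequentially"
    by simp
  have "stem x = suminf (\<lambda>i. D i x) + stem_iter 0 x" for x
    unfolding stem_def by (intro limI tendsto_uniform_limitI[OF *]) auto
  then have "stem = (\<lambda>x. suminf (\<lambda>i. D i x) + stem_iter 0 x)" by (rule ext)
  then show ?thesis using * by simp
qed

lemma tendsto_stem: "(\<lambda>n. stem_iter n x) \<longlonglongrightarrow> stem x"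
  using tendsto_uniform_limitI[OF uniform_limit_stem] by auto

lemma continuous_stem: "continuous_on UNIV stem"
  using uniform_limit_theorem[OF _ uniform_limit_stem] continuous_stem_iter by auto

lemma clamped_stem: "clamped stem"
proof -
  have "stem x = 0" if "x \<le> 0" for x
    using tendsto_stem[of x] clampedD(1)[OF clamped_stem_iter that] by (simp add: LIMSEQ_const_iff)
  moreover have "stem x = 1" if "x \<ge> 1" for x
    using tendsto_stem[of x] clampedD(2)[OF clamped_stem_iter that] by (simp add: LIMSEQ_const_iff)
  moreover have "x / 2 \<le> stem x" "stem x \<le> (3 + x) / 4" if "0 \<le> x" "x \<le> 1" for x
  proof -
    have "x / 2 \<le> stem_iter n x \<and> stem_iter n x \<le> (3 + x) / 4" for n
      using clampedD(3,4)[OF clamped_stem_iter[of n]] that by blast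
    then show "x / 2 \<le> stem x" "stem x \<le> (3 + x) / 4"
      by (blast intro: LIMSEQ_le_const[OF tendsto_stem[of x]] LIMSEQ_le_const2[OF tendsto_stem[of x]])+
  qed
  ultimately show ?thesis by (auto simp: clamped_def)
qed

lemma stem_step_stem: "stem_step stem = stem"
proof
  fix x
  have "(\<lambda>n. stem_step (stem_iter n) x) \<longlonglongrightarrow> stem_step stem x"
    unfolding stem_step_def by (intro tendsto_intros tendsto_stem) auto
  moreover have "(\<lambda>n. stem_step (stem_iter n) x) \<longlonglongrightarrow> stem x"
    using LIMSEQ_Suc[OF tendsto_stem[of x]] by (simp add: stem_iter_def)
  ultimately show "stem_step stem x = stem x" using LIMSEQ_unique by blast
qed

lemmas stem_pieces = stem_step_pieces[OF clamped_stem, unfolded stem_step_stem]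

lemma stem_bounds: "0 \<le> stem x" "stem x \<le> 1"
  using clamped_bounds[OF clamped_stem] by auto

lemma stem_0 [simp]: "x \<le> 0 \<Longrightarrow> stem x = 0" and stem_1 [simp]: "x \<ge> 1 \<Longrightarrow> stem x = 1"
  using clampedD[OF clamped_stem] by blast+

lemma stem_pos: "0 < x \<Longrightarrow> 0 < stem x"
  using clampedD(3)[OF clamped_stem, of x] by (cases "x \<le> 1") auto

lemma stem_less_1: assumes "x < 1" shows "stem x < 1"
proof (cases "0 \<le> x")
  case True
  then have "stem x \<le> (3 + x) / 4" using clampedD(4)[OF clamped_stem] assms by simp
  then show ?thesis using assms by simp
qed simp

lemma stem_less_half: "x < 1/6 \<Longrightarrow> stem x < 1/2"
  using stem_less_1[of "6 * x"] by (simp add: stem_pieces(1))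

lemma stem_gt_half: "5/6 < x \<Longrightarrow> 1/2 < stem x"
  using stem_pos[of "6 * x - 5"] by (simp add: stem_pieces(6))

lemma stem_ge_half: "1/6 \<le> x \<Longrightarrow> 1/2 \<le> stem x"
  by (cases x rule: six_pieces) (use stem_bounds in \<open>auto simp: stem_pieces\<close>)

lemma stem_half: "stem (1/6) = 1/2" "stem (1/2) = 1/2" "stem (5/6) = 1/2"
  using stem_pieces(1)[of "1/6"] stem_pieces(3)[of "1/2"] stem_pieces(5)[of "5/6"] by simp_all

text \<open>These are the feet of the hairs: \<open>stem\<close> is positive to the right of 0, so a
  copy placed on height 1/2 touches this height at its foot only.\<close>

lemma stem_eq_half: assumes "stem x = 1/2" shows "x \<in> {1/6, 1/2, 5/6}"
proof -
  have x: "1/6 \<le> x" "x \<le> 5/6" using stem_less_half[of x] stem_gt_half[of x] assms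
    by (simp_all only: not_less[symmetric]) auto
  have zero: "y \<le> 0" if "stem y = 0" for y using stem_pos[of y] that by (cases "y > 0") auto
  show ?thesis
  proof (cases x rule: six_pieces)
    case 1
    then show ?thesis using x by simp
  next
    case 2
    then have "6 * x - 1 \<le> 0" using assms by (intro zero) (simp add: stem_pieces(2))
    then have "x = 1/6" using x by linarith
    then show ?thesis by simp
  next
    case 3
    then have "3 - 6 * x \<le> 0" using assms by (intro zero) (simp add: stem_pieces(3))
    then have "x = 1/2" using 3 by linarith
    then show ?thesis by simp
  next
    case 4
    then have "6 * x - 3 \<le> 0" using assms by (intro zero) (simp add: stem_pieces(4))
    then have "x = 1/2" using 4 by linarith
    then show ?thesis by simp
  next
    case 5
    then have "5 - 6 * x \<le> 0" using assms by (intro zero) (simp add: stem_pieces(5))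
    then have "x = 5/6" using x by linarith
    then show ?thesis by simp
  next
    case 6
    then show ?thesis using x by simp
  qed
qed

text \<open>The reflection exchanges the two hairs, and each of them is a rising copy followed by
  its mirror image.\<close>

lemma stem_symmetric: assumes "1/6 \<le> x" "x \<le> 5/6" shows "stem (1 - x) = stem x"
  by (cases x rule: six_pieces) (use assms in \<open>auto simp: stem_pieces algebra_simps\<close>)

text \<open>Up to points of \<open>\<int> / 6 ^ k\<close> the base 6 digits are eventually all 0 or 5. Multiplication by \<open>6 ^ l\<close>
  fixes 2/5 modulo 1, at distance more than 1/6 + 1/6 from the integers, so translation by 2/5 moves
  this set off itself.\<close>

definition digital :: "real set"
  where "digital = {v. \<exists>k. \<forall>l\<ge>k. \<exists>m::int. \<bar>6 ^ l * v - m\<bar> \<le> 1/6}"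

lemma digital_scale:
  assumes "6 * v - real_of_int j \<in> digital" shows "v \<in> digital"
proof -
  obtain k where k: "\<And>l. l \<ge> k \<Longrightarrow> \<exists>m::int. \<bar>6 ^ l * (6 * v - j) - m\<bar> \<le> 1/6"
    using assms by (auto simp: digital_def)
  have "\<exists>m::int. \<bar>6 ^ l * v - m\<bar> \<le> 1/6" if "l \<ge> Suc k" for l
  proof -
    obtain l' where l: "l = Suc l'" "l' \<ge> k" using \<open>l \<ge> Suc k\<close> by (cases l) auto
    obtain m :: int where "\<bar>6 ^ l' * (6 * v - j) - m\<bar> \<le> 1/6" using k[OF l(2)] by blast
    then have "\<bar>6 ^ l * v - of_int (m + 6 ^ l' * j)\<bar> \<le> 1/6" by (simp add: l algebra_simps)
    then show ?thesis by blast
  qed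
  then show ?thesis unfolding digital_def by blast
qed

lemma digital_uminus: assumes "v \<in> digital" shows "- v \<in> digital"
proof -
  obtain k where k: "\<And>l. l \<ge> k \<Longrightarrow> \<exists>m::int. \<bar>6 ^ l * v - m\<bar> \<le> 1/6"
    using assms by (auto simp: digital_def)
  have "\<exists>m::int. \<bar>6 ^ l * (- v) - m\<bar> \<le> 1/6" if "l \<ge> k" for l
  proof -
    obtain m :: int where "\<bar>6 ^ l * v - m\<bar> \<le> 1/6" using k[OF \<open>l \<ge> k\<close>] by blast
    then have "\<bar>6 ^ l * (- v) - of_int (- m)\<bar> \<le> 1/6" by (simp add: abs_if split: if_splits)
    then show ?thesis by blast
  qed
  then show ?thesis unfolding digital_def by blast
qed

lemma digital_scale_neg: "real_of_int j - 6 * v \<in> digital \<Longrightarrow> v \<in> digital"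
  using digital_uminus[of "j - 6 * v"] digital_scale[of v j] by simp

lemma digital_of_int: "of_int i \<in> digital"
proof -
  have "\<bar>6 ^ l * of_int i - of_int (6 ^ l * i)\<bar> \<le> (1/6 :: real)" for l by simp
  then show ?thesis unfolding digital_def by blast
qed

lemma digital_sixth: "6 * v = of_int i \<Longrightarrow> v \<in> digital"
  using digital_scale[of v 0] digital_of_int[of i] by simp

lemma digital_shift:
  assumes "v \<in> digital" "v + real_of_int c / 5 \<in> digital" "c mod 5 = 2 \<or> c mod 5 = 3" shows False
proof -
  obtain k where k: "\<And>l. l \<ge> k \<Longrightarrow> \<exists>m::int. \<bar>6 ^ l * v - m\<bar> \<le> 1/6"
    using assms by (auto simp: digital_def)
  obtain k' where k': "\<And>l. l \<ge> k' \<Longrightarrow> \<exists>m::int. \<bar>6 ^ l * (v + c / 5) - m\<bar> \<le> 1/6"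
    using assms by (auto simp: digital_def)
  define l where "l = max k k'"
  obtain m :: int where m: "\<bar>6 ^ l * v - m\<bar> \<le> 1/6" using k[of l] by (auto simp: l_def)
  obtain m' :: int where m': "\<bar>6 ^ l * (v + c / 5) - m'\<bar> \<le> 1/6" using k'[of l] by (auto simp: l_def)
  have "\<bar>6 ^ l * c / 5 - (m' - m)\<bar> \<le> 1/3" using m m' by (simp add: algebra_simps abs_if split: if_splits)
  then have "\<bar>6 ^ l * c - 5 * (m' - m)\<bar> \<le> 5/3" by (simp add: abs_if field_simps split: if_splits)
  moreover have "6 ^ l * c - 5 * (m' - m) = of_int (6 ^ l * c - 5 * (m' - m))" by simp
  \<comment> \<open>An integer of absolute value at most 5/3 has absolute value at most 1, but this
    one is congruent to \<open>c\<close> modulo 5, since 6 is congruent to 1.\<close>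
  ultimately have *: "\<bar>6 ^ l * c - 5 * (m' - m)\<bar> \<le> 1" by linarith
  have "(6::int) ^ l mod 5 = 1" using power_mod[of "6::int" 5 l] by simp
  then have "(6 ^ l * c - 5 * (m' - m)) mod 5 = c mod 5"
    by (metis (no_types) mod_mult_left_eq mult_1 mod_diff_right_eq mod_mult_self1_is_0 diff_zero mod_mod_trivial)
  then show False using * assms(3) by presburger
qed

text \<open>The trace of a tie that starts on a rising copy and ends beyond its top: from
  \<open>v\<close> up to 1 the function must not drop below its value at \<open>v\<close>.\<close>

definition late_min :: "real \<Rightarrow> bool"
  where "late_min v \<longleftrightarrow> 0 \<le> v \<and> v \<le> 1 \<and> (\<forall>r. v \<le> r \<and> r \<le> 1 \<longrightarrow> stem v \<le> stem r)"

lemma late_min_low: assumes "late_min v" "v \<le> 1/6" shows "late_min (6 * v)"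
  unfolding late_min_def
proof (intro conjI allI impI)
  fix r assume r: "6 * v \<le> r \<and> r \<le> 1"
  then have "stem v \<le> stem (r / 6)" using assms by (auto simp: late_min_def)
  then show "stem (6 * v) \<le> stem r" using r assms by (simp add: stem_pieces(1))
qed (use assms in \<open>auto simp: late_min_def\<close>)

lemma late_min_high: assumes "late_min v" "5/6 \<le> v" shows "late_min (6 * v - 5)"
  unfolding late_min_def
proof (intro conjI allI impI)
  fix r assume r: "6 * v - 5 \<le> r \<and> r \<le> 1"
  then have "stem v \<le> stem ((r + 5) / 6)" using assms by (auto simp: late_min_def)
  moreover have "6 * ((r + 5) / 6) - 5 = r" by (simp add: field_simps)
  then have "stem ((r + 5) / 6) = 1/2 + stem r / 2"
    using stem_pieces(6)[of "(r + 5) / 6"] r assms by simp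
  ultimately show "stem (6 * v - 5) \<le> stem r" using assms by (simp add: stem_pieces(6))
qed (use assms in \<open>auto simp: late_min_def\<close>)

lemma late_min_mid: assumes "late_min v" "1/6 \<le> v" "v \<le> 5/6" shows "stem v = 1/2"
proof -
  have "stem v \<le> stem (5/6)" using assms by (simp add: late_min_def)
  then show ?thesis using stem_ge_half[OF assms(2)] stem_half(3) by linarith
qed

text \<open>Zooming into the first or last sixth reads a digit 0 or 5. A late minimum elsewhere is
  at height 1/2, because the foot at 5/6 comes later; so it is one of the three feet and its
  expansion terminates.\<close>

lemma late_min_digit:
  assumes "late_min v" shows "(\<exists>m::int. \<bar>6 ^ l * v - m\<bar> \<le> 1/6) \<or> 6 ^ Suc l * v \<in> \<int>"
  using assms
proof (induction l arbitrary: v)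
  case 0
  consider "v \<le> 1/6" | "5/6 \<le> v" | "1/6 \<le> v" "v \<le> 5/6" by linarith
  then show ?case
  proof cases
    case 1
    then have "\<bar>6 ^ 0 * v - of_int 0\<bar> \<le> 1/6" using 0 by (auto simp: late_min_def)
    then show ?thesis by blast
  next
    case 2
    then have "\<bar>6 ^ 0 * v - of_int 1\<bar> \<le> 1/6" using 0 by (auto simp: late_min_def)
    then show ?thesis by blast
  next
    case 3
    then have "v \<in> {1/6, 1/2, 5/6}" using late_min_mid 0 stem_eq_half by blast
    then have "6 * v = of_int 1 \<or> 6 * v = of_int 3 \<or> 6 * v = of_int 5" by auto
    then have "6 * v \<in> \<int>" using Ints_of_int by metis
    then show ?thesis by simp
  qed
next
  case (Suc l)
  consider "v \<le> 1/6" | "5/6 \<le> v" | "1/6 \<le> v" "v \<le> 5/6" by linarith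
  then show ?case
  proof cases
    case 1
    then show ?thesis using Suc.IH[OF late_min_low[OF Suc.prems]] by (simp add: mult.assoc mult.left_commute)
  next
    case 2
    have "6 ^ Suc l * (6 * v - 5) \<in> \<int> \<Longrightarrow> 6 ^ Suc (Suc l) * v \<in> \<int>"
    proof -
      assume "6 ^ Suc l * (6 * v - 5) \<in> \<int>"
      moreover have "6 ^ Suc l * (5::real) \<in> \<int>" by (intro Ints_mult Ints_power) auto
      moreover have "6 ^ Suc (Suc l) * v = 6 ^ Suc l * (6 * v - 5) + 6 ^ Suc l * 5" by (simp add: algebra_simps)
      ultimately show ?thesis using Ints_add by metis
    qed
    moreover have "\<exists>m::int. \<bar>6 ^ Suc l * v - m\<bar> \<le> 1/6" if "\<bar>6 ^ l * (6 * v - 5) - of_int m\<bar> \<le> 1/6" for m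
      using that by (intro exI[of _ "m + 6 ^ l * 5"]) (simp add: algebra_simps)
    ultimately show ?thesis using Suc.IH[OF late_min_high[OF Suc.prems 2]] by blast
  next
    case 3
    then have "v \<in> {1/6, 1/2, 5/6}" using late_min_mid Suc.prems stem_eq_half by blast
    then have "6 * v = of_int 1 \<or> 6 * v = of_int 3 \<or> 6 * v = of_int 5" by auto
    then have "6 * v \<in> \<int>" using Ints_of_int by metis
    then have "6 ^ Suc l * (6 * v) \<in> \<int>" by (intro Ints_mult[OF Ints_power]) auto
    then show ?thesis by (simp add: mult.assoc mult.left_commute)
  qed
qed

lemma late_min_digital: assumes "late_min v" shows "v \<in> digital"
proof (cases "\<exists>l. 6 ^ Suc l * v \<in> \<int>")
  case True
  then obtain l i where l: "6 ^ Suc l * v = of_int i" by (auto elim: Ints_cases)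
  have "\<exists>m::int. \<bar>6 ^ k * v - m\<bar> \<le> 1/6" if "k \<ge> Suc l" for k
  proof -
    obtain d where d: "k = Suc l + d" using le_Suc_ex[OF \<open>k \<ge> Suc l\<close>] by blast
    have "6 ^ k * v = 6 ^ d * (6 ^ Suc l * v)" unfolding d power_add by (simp only: mult_ac)
    also have "\<dots> = of_int (6 ^ d * i)" unfolding l by simp
    finally have "\<bar>6 ^ k * v - of_int (6 ^ d * i)\<bar> \<le> 1/6" by simp
    then show ?thesis by blast
  qed
  then show ?thesis unfolding digital_def by blast
next
  case False
  then show ?thesis using late_min_digit[OF assms] unfolding digital_def by blast
qed

text \<open>Two late minima of equal height other than 1/2 lie in the same end piece, and zooming
  into it multiplies their distance by 6. After finitely many zooms height 1/2 must be reached,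
  where only three points are available.\<close>

lemma late_min_finite_aux:
  assumes "late_min v" "late_min y" "stem v = stem y" "(1/6) ^ k \<le> y - v"
  shows "finite {r. late_min r \<and> stem r = stem v}"
  using assms
proof (induction k arbitrary: v y)
  case 0
  \<comment> \<open>Distance 1 is impossible, because \<open>stem\<close> differs at 0 and
    1.\<close>
  then have "v = 0" "y = 1" by (auto simp: late_min_def)
  then show ?case using 0 by simp
next
  case (Suc k)
  have vy: "v \<le> y" using Suc.prems(4) by (smt (verit) zero_le_power divide_nonneg_nonneg)
  consider "stem v < 1/2" | "stem v = 1/2" | "stem v > 1/2" by linarith
  then show ?case
  proof cases
    case 1
    then have lt: "r < 1/6" if "stem r = stem v" for r using stem_ge_half[of r] that by force
    have v: "v < 1/6" "y < 1/6" using lt[of v] lt[of y] Suc.prems by auto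
    have "finite {r. late_min r \<and> stem r = stem (6 * v)}"
      using late_min_low[of v] late_min_low[of y] Suc.prems v
      by (intro Suc.IH[of _ "6 * y"]) (auto simp: stem_pieces(1))
    moreover have "{r. late_min r \<and> stem r = stem v} \<subseteq> (\<lambda>r. r / 6) ` {r. late_min r \<and> stem r = stem (6 * v)}"
    proof
      fix r assume r: "r \<in> {r. late_min r \<and> stem r = stem v}"
      then have "r < 1/6" using lt by blast
      then have "6 * r \<in> {r. late_min r \<and> stem r = stem (6 * v)}"
        using r late_min_low[of r] v by (simp add: stem_pieces(1))
      then show "r \<in> (\<lambda>r. r / 6) ` {r. late_min r \<and> stem r = stem (6 * v)}" by (intro image_eqI[of _ _ "6 * r"]) auto
    qed
    ultimately show ?thesis using finite_surj by blast
  next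
    case 2
    then have "{r. late_min r \<and> stem r = stem v} \<subseteq> {1/6, 1/2, 5/6}"
      using stem_eq_half by (intro subsetI) simp
    then show ?thesis using finite_subset by blast
  next
    case 3
    have gt: "5/6 < r" if "late_min r" "stem r = stem v" for r
      using that 3 stem_half(3) by (auto simp: late_min_def not_less dest!: spec[of _ "5/6"])
    have v: "v > 5/6" "y > 5/6" using gt[of v] gt[of y] Suc.prems by auto
    have "finite {r. late_min r \<and> stem r = stem (6 * v - 5)}"
      using late_min_high[of v] late_min_high[of y] Suc.prems v
      by (intro Suc.IH[of _ "6 * y - 5"]) (auto simp: stem_pieces(6))
    moreover have "{r. late_min r \<and> stem r = stem v} \<subseteq> (\<lambda>r. (r + 5) / 6) ` {r. late_min r \<and> stem r = stem (6 * v - 5)}"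
    proof
      fix r assume r: "r \<in> {r. late_min r \<and> stem r = stem v}"
      then have "r > 5/6" using gt by blast
      then have "6 * r - 5 \<in> {r. late_min r \<and> stem r = stem (6 * v - 5)}"
        using r late_min_high[of r] v by (simp add: stem_pieces(6))
      then show "r \<in> (\<lambda>r. (r + 5) / 6) ` {r. late_min r \<and> stem r = stem (6 * v - 5)}"
        by (intro image_eqI[of _ _ "6 * r - 5"]) auto
    qed
    ultimately show ?thesis using finite_surj by blast
  qed
qed

lemma sixth_power_below: assumes "(d::real) > 0" obtains k where "(1/6) ^ k \<le> d"
  using real_arch_pow_inv[OF assms, of "1/6"] by (auto intro: less_imp_le)

lemma late_min_finite: "finite {r. late_min r \<and> stem r = c}"
proof (cases "\<exists>v y. late_min v \<and> late_min y \<and> stem v = c \<and> stem y = c \<and> v < y")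
  case True
  then obtain v y where vy: "late_min v" "late_min y" "stem v = c" "stem y = c" "v < y" by blast
  obtain k where "(1/6) ^ k \<le> y - v" using sixth_power_below[of "y - v"] vy by auto
  then show ?thesis using late_min_finite_aux[of v y k] vy by simp
next
  case False
  then have "\<forall>v\<in>{r. late_min r \<and> stem r = c}. \<forall>y\<in>{r. late_min r \<and> stem r = c}. v = y"
    by (metis (mono_tags) linorder_neqE_linordered_idom mem_Collect_eq)
  then have "\<exists>v. {r. late_min r \<and> stem r = c} \<subseteq> {v}" by blast
  then show ?thesis using finite_subset by blast
qed

section \<open>Transfer of ties along changes of coordinates\<close>

lemma level_transfer:
  assumes im: "\<phi> ` closed_segment s t = closed_segment (\<phi> s) (\<phi> t)" and B: "B > 0"
    and eq: "\<And>x. x \<in> closed_segment s t \<Longrightarrow> g x = A + B * h (\<phi> x)"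
  shows "level g s t \<longleftrightarrow> level h (\<phi> s) (\<phi> t)"
proof -
  have "g s = A + B * h (\<phi> s)" "g t = A + B * h (\<phi> t)" using eq by auto
  then have "level h (\<phi> s) (\<phi> t) \<longleftrightarrow> g s = g t \<and> (\<forall>x\<in>closed_segment s t. h (\<phi> s) \<le> h (\<phi> x))"
    unfolding level_def im[symmetric] using B by auto
  moreover have "h (\<phi> s) \<le> h (\<phi> x) \<longleftrightarrow> g s \<le> g x" if "x \<in> closed_segment s t" for x
    using eq[OF that] eq[of s] B by simp
  ultimately show ?thesis unfolding level_def by simp
qed

lemma tied_transfer:
  assumes im: "\<phi> ` closed_segment s t = closed_segment (\<phi> s) (\<phi> t)" and B: "B > 0"
    and eq: "\<And>x. x \<in> closed_segment s t \<Longrightarrow> g x = A + B * h (\<phi> x)"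
  shows "tied h (\<phi> s) (\<phi> t) = \<phi> ` tied g s t"
proof -
  have "h (\<phi> x) = h (\<phi> s) \<longleftrightarrow> g x = g s" if "x \<in> closed_segment s t" for x
    using eq[OF that] eq[of s] B by simp
  then show ?thesis unfolding tied_def im[symmetric] by auto
qed

lemma tied_commute: "g s = g t \<Longrightarrow> tied g t s = tied g s t"
  by (auto simp: tied_def closed_segment_commute)

lemma affine_segment:
  fixes a c :: real
  shows "(\<lambda>x. a * x + c) ` closed_segment s t = closed_segment (a * s + c) (a * t + c)"
  unfolding closed_segment_image_interval image_image
  by (intro image_cong) (auto simp: algebra_simps)

lemma level_affine:
  assumes "B > 0" "\<And>x. x \<in> closed_segment s t \<Longrightarrow> g x = A + B * h (a * x + c)"
  shows "level g s t \<longleftrightarrow> level h (a * s + c) (a * t + c)"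
  using level_transfer[where \<phi> = "\<lambda>x. a * x + c" and g = g and h = h, OF affine_segment] assms by blast

lemma tied_affine:
  assumes "B > 0" "\<And>x. x \<in> closed_segment s t \<Longrightarrow> g x = A + B * h (a * x + c)"
  shows "tied h (a * s + c) (a * t + c) = (\<lambda>x. a * x + c) ` tied g s t"
  using tied_transfer[where \<phi> = "\<lambda>x. a * x + c" and g = g and h = h, OF affine_segment] assms by blast

definition regular_pair :: "real \<Rightarrow> real \<Rightarrow> bool"
  where "regular_pair v y \<longleftrightarrow> v \<in> digital \<and> y \<in> digital \<and> finite (tied stem v y)"

text \<open>\<open>a = -6\<close> covers the falling sides of the hairs; a reflection exchanges the
  digits 0 and 5, so \<open>digital\<close> is kept.\<close>

lemma regular_pair_piece:
  assumes eq: "\<And>x. x \<in> closed_segment v y \<Longrightarrow> stem x = A + B * stem (a * x + of_int j)"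
    and a: "a = 6 \<or> a = -6" and B: "B > 0"
    and reg: "regular_pair (a * v + of_int j) (a * y + of_int j)"
  shows "regular_pair v y"
proof -
  have "finite ((\<lambda>x. a * x + of_int j) ` tied stem v y)"
    using tied_affine[where g = stem and h = stem and a = a and c = "of_int j", OF B eq] reg by (simp add: regular_pair_def)
  moreover have "inj_on (\<lambda>x. a * x + of_int j) (tied stem v y)" using a by (auto simp: inj_on_def)
  ultimately have "finite (tied stem v y)" using finite_imageD by blast
  moreover have "x \<in> digital" if "a * x + of_int j \<in> digital" for x
    using digital_scale[of x "-j"] digital_scale_neg[of j x] that a by auto
  ultimately show ?thesis using reg by (auto simp: regular_pair_def)
qed

lemma stem_hair_pieces:
  assumes "q = 1 \<or> q = 3"
  shows "x \<in> {q / 6..(q + 1) / 6} \<Longrightarrow> stem x = 1/2 + 1/4 * stem (6 * x + - q)"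
    "x \<in> {(q + 1) / 6..(q + 2) / 6} \<Longrightarrow> stem x = 1/2 + 1/4 * stem (- 6 * x + (q + 2))"
  using assms stem_pieces(2-5)[of x] by (auto simp: add.commute)

text \<open>A tie above height 1/2 cannot pass a foot, so it is confined between two consecutive
  feet; \<open>q\<close> tells which hair it is.\<close>

lemma level_in_hair:
  assumes lv: "level stem v y" and vy: "v \<le> y" and high: "1/2 < stem v" and v: "v \<le> 5/6"
  obtains q where "q = 1 \<or> q = (3::real)" "q / 6 < v" "y < (q + 2) / 6"
proof -
  have ge: "stem v \<le> stem r" if "v \<le> r" "r \<le> y" for r using lv vy that by (auto simp: level_iff)
  have v6: "1/6 < v" using stem_less_half[of v] stem_half(1) high by (metis less_asym linorder_neqE_linordered_idom)
  have no: "\<not> (v \<le> r \<and> r \<le> y)" if "stem r = 1/2" for r using ge[of r] high that by auto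
  have "v \<noteq> 1/2" "v \<noteq> 5/6" using stem_half(2,3) high by (metis less_irrefl)+
  then show ?thesis using that[of 1] that[of 3] no[OF stem_half(2)] no[OF stem_half(3)] v v6
    by (cases "v < 1/2") auto
qed

text \<open>Each zoom into a piece multiplies the length of the tie by 6, so zooming stops: either
  at height 1/2, or with a tie across the tip of a hair, whose ends are late minima of the two
  sides.\<close>

lemma regular_pair_aux:
  assumes "0 \<le> v" "v \<le> 1" "0 \<le> y" "y \<le> 1" "level stem v y" "(1/6) ^ k \<le> \<bar>y - v\<bar>"
  shows "regular_pair v y"
  using assms
proof (induction k arbitrary: v y)
  case 0
  then have "v = 0 \<and> y = 1 \<or> v = 1 \<and> y = 0" by auto
  then show ?case using 0 by (auto simp: level_def)
next
  case (Suc k)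
  have main: "regular_pair v y" if v: "0 \<le> v" and y: "y \<le> 1" and lt: "v < y" and lv: "level stem v y"
    and d: "(1/6) ^ Suc k \<le> y - v" for v y
  proof -
    have seg: "closed_segment v y = {v..y}" using lt by (simp add: closed_segment_eq_real_ivl)
    have ge: "stem v \<le> stem r" if "v \<le> r" "r \<le> y" for r using lv lt that by (auto simp: level_iff)
    have eq: "stem v = stem y" using lv by (simp add: level_def)
    have step: "regular_pair v y"
      if piece: "\<And>x. x \<in> closed_segment v y \<Longrightarrow> stem x = A + B * stem (a * x + of_int j)"
        and a: "a = 6 \<or> a = -6" and B: "B > 0"
        and bounds: "0 \<le> a * v + of_int j" "a * v + of_int j \<le> 1" "0 \<le> a * y + of_int j" "a * y + of_int j \<le> 1"
      for A B a j
    proof (rule regular_pair_piece[OF piece a B])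
      have "\<bar>(a * y + of_int j) - (a * v + of_int j)\<bar> = 6 * (y - v)" using a lt by auto
      then have "(1/6) ^ k \<le> \<bar>(a * y + of_int j) - (a * v + of_int j)\<bar>" using d by simp
      then show "regular_pair (a * v + of_int j) (a * y + of_int j)"
        using level_affine[where g = stem and h = stem and a = a and c = "of_int j", OF B piece] lv bounds by (intro Suc.IH) auto
    qed
    consider "stem v < 1/2" | "stem v = 1/2" | "stem v > 1/2" "v > 5/6" | "stem v > 1/2" "v \<le> 5/6" by linarith
    then show ?thesis
    proof cases
      case 1
      then have "y < 1/6" using stem_ge_half[of y] eq by force
      then show ?thesis using v lt
        by (intro step[of 0 "1/2" 6 0]) (auto simp: seg stem_pieces(1))
    next
      case 2
      then have sub: "tied stem v y \<subseteq> {1/6, 1/2, 5/6}" using stem_eq_half by (intro subsetI) (simp add: tied_def)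
      moreover have "x \<in> digital" if "x \<in> {1/6, 1/2, 5/6}" for x
        using digital_sixth[of x 1] digital_sixth[of x 3] digital_sixth[of x 5] that by auto
      moreover have "v \<in> tied stem v y" "y \<in> tied stem v y" using eq by (auto simp: tied_def)
      ultimately show ?thesis unfolding regular_pair_def using finite_subset by blast
    next
      case 3
      then show ?thesis using lt y
        by (intro step[of "1/2" "1/2" 6 "-5"]) (auto simp: seg stem_pieces(6))
    next
      case 4
      then obtain q where q: "q = 1 \<or> q = (3::real)" and vq: "q / 6 < v" "y < (q + 2) / 6"
        using level_in_hair[OF lv _ 4] lt by auto
      obtain j where j: "q = of_int j" using q by (metis of_int_1 of_int_numeral)
      note up = stem_hair_pieces(1)[OF q] and down = stem_hair_pieces(2)[OF q]
      consider "y \<le> (q + 1) / 6" | "(q + 1) / 6 \<le> v" | "v < (q + 1) / 6" "(q + 1) / 6 < y" by linarith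
      then show ?thesis
      proof cases
        case 1
        then show ?thesis using vq lt up
          by (intro step[of "1/2" "1/4" 6 "- j"]) (auto simp: seg j)
      next
        case 2
        then show ?thesis using vq lt down
          by (intro step[of "1/2" "1/4" "-6" "j + 2"]) (auto simp: seg j)
      next
        case 3
        \<comment> \<open>Across the tip: scaled so that the tip is at 1, every tied point of either
          side becomes a late minimum of one fixed height, and there are finitely many of
          these.\<close>
        have late_up: "late_min (6 * r + - q)" if r: "v \<le> r" "r \<le> (q + 1) / 6" "stem r = stem v" for r
          unfolding late_min_def
        proof (intro conjI allI impI)
          fix x assume x: "6 * r + - q \<le> x \<and> x \<le> 1"
          have "stem r \<le> stem ((x + q) / 6)" using ge[of "(x + q) / 6"] r x 3 by simp
          moreover have "stem r = 1/2 + 1/4 * stem (6 * r + - q)" using up r vq by auto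
          moreover have "stem ((x + q) / 6) = 1/2 + 1/4 * stem (6 * ((x + q) / 6) + - q)"
            using r x vq by (intro up) auto
          moreover have "6 * ((x + q) / 6) + - q = x" by (simp add: field_simps)
          ultimately show "stem (6 * r + - q) \<le> stem x" by simp
        qed (use r vq in auto)
        have late_down: "late_min (- 6 * r + (q + 2))" if r: "(q + 1) / 6 \<le> r" "r \<le> y" "stem r = stem v" for r
          unfolding late_min_def
        proof (intro conjI allI impI)
          fix x assume x: "- 6 * r + (q + 2) \<le> x \<and> x \<le> 1"
          have "stem r \<le> stem ((q + 2 - x) / 6)" using ge[of "(q + 2 - x) / 6"] r x 3 by simp
          moreover have "stem r = 1/2 + 1/4 * stem (- 6 * r + (q + 2))" using down r vq by auto
          moreover have "stem ((q + 2 - x) / 6) = 1/2 + 1/4 * stem (- 6 * ((q + 2 - x) / 6) + (q + 2))"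
            using r x vq by (intro down) auto
          moreover have "- 6 * ((q + 2 - x) / 6) + (q + 2) = x" by (simp add: field_simps)
          ultimately show "stem (- 6 * r + (q + 2)) \<le> stem x" by simp
        qed (use r vq in auto)
        let ?Z = "{r. late_min r \<and> stem r = (stem v - 1/2) * 4}"
        have "tied stem v y \<subseteq> (\<lambda>x. (x + q) / 6) ` ?Z \<union> (\<lambda>x. (q + 2 - x) / 6) ` ?Z"
        proof
          fix r assume r: "r \<in> tied stem v y"
          then have r': "v \<le> r" "r \<le> y" "stem r = stem v" by (auto simp: tied_def seg)
          show "r \<in> (\<lambda>x. (x + q) / 6) ` ?Z \<union> (\<lambda>x. (q + 2 - x) / 6) ` ?Z"
          proof (cases "r \<le> (q + 1) / 6")
            case True
            then have "6 * r + - q \<in> ?Z" using late_up[of r] r' up[of r] vq by auto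
            then show ?thesis by (intro UnI1 image_eqI[of _ _ "6 * r + - q"]) auto
          next
            case False
            then have "- 6 * r + (q + 2) \<in> ?Z" using late_down[of r] r' down[of r] vq by auto
            then show ?thesis by (intro UnI2 image_eqI[of _ _ "- 6 * r + (q + 2)"]) auto
          qed
        qed
        then have "finite (tied stem v y)"
          by (rule finite_subset) (intro finite_UnI finite_imageI late_min_finite)
        moreover have "v \<in> digital"
          using late_min_digital[OF late_up[of v]] digital_scale[of v j] 3 j by simp
        moreover have "y \<in> digital"
          using late_min_digital[OF late_down[of y]] digital_scale_neg[of "j + 2" y] 3 j eq by (simp add: algebra_simps)
        ultimately show ?thesis by (simp add: regular_pair_def)
      qed
    qed
  qed
  have "0 < (1/6::real) ^ Suc k" by simp
  then have "0 < \<bar>y - v\<bar>" using Suc.prems(6) by (rule less_le_trans)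
  then have "v \<noteq> y" by simp
  then show ?case
  proof (cases "v < y")
    case True
    then show ?thesis using main[of v y] Suc.prems by auto
  next
    case False
    then have "regular_pair y v" using main[of y v] Suc.prems \<open>v \<noteq> y\<close> level_sym by auto
    then show ?thesis using Suc.prems(5) tied_commute[of stem v y] by (auto simp: regular_pair_def level_def)
  qed
qed

lemma level_stem_regular:
  assumes "0 \<le> v" "v \<le> 1" "0 \<le> y" "y \<le> 1" "level stem v y" "v \<noteq> y"
  shows "regular_pair v y"
proof -
  obtain k where "(1/6) ^ k \<le> \<bar>y - v\<bar>" using sixth_power_below[of "\<bar>y - v\<bar>"] assms(6) by auto
  then show ?thesis using regular_pair_aux assms by blast
qed

section \<open>Ties of the mirror image\<close>

lemma stem_reverse_low: "x \<le> 1/6 \<Longrightarrow> stem (1 - x) = 1/2 + stem (1 - 6 * x) / 2"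
  using stem_pieces(6)[of "1 - x"] by (simp add: algebra_simps)

lemma stem_reverse_high: "5/6 \<le> x \<Longrightarrow> stem (1 - x) = stem (1 - (6 * x - 5)) / 2"
  using stem_pieces(1)[of "1 - x"] by (simp add: algebra_simps)

text \<open>The mirror image is built from copies of itself in the same places: its end pieces are
  scaled mirror images, and its middle part is that of \<open>stem\<close>. So ties in an end piece
  are handled by zooming, those between 1/6 and 5/6 by symmetry.\<close>

lemma level_stem_reverse:
  assumes "0 \<le> v" "v \<le> 1" "0 \<le> y" "y \<le> 1" "level stem v y"
  shows "level (\<lambda>x. stem (1 - x)) v y"
proof -
  let ?r = "\<lambda>x. stem (1 - x)"
  have main: "level ?r v y" if "0 \<le> v" "v < y" "y \<le> 1" "level stem v y" "(1/6) ^ k \<le> y - v" for k v y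
    using that
  proof (induction k arbitrary: v y)
    case 0
    then have "v = 0" "y = 1" by auto
    then show ?case using 0 by (auto simp: level_def)
  next
    case (Suc k)
    have seg: "closed_segment v y = {v..y}" using Suc.prems(2) by (simp add: closed_segment_eq_real_ivl)
    have ge: "stem v \<le> stem r" if "v \<le> r" "r \<le> y" for r using Suc.prems that by (auto simp: level_iff)
    have eq: "stem v = stem y" using Suc.prems(4) by (simp add: level_def)
    have mid: "level ?r v y" if "1/6 \<le> v" "y \<le> 5/6"
    proof -
      have "?r x = stem x" if "x \<in> closed_segment v y" for x
        using stem_symmetric[of x] that \<open>1/6 \<le> v\<close> \<open>y \<le> 5/6\<close> by (auto simp: seg)
      then show ?thesis using Suc.prems(4) unfolding level_def by auto
    qed
    have step: "level ?r v y"
      if "\<And>x. x \<in> closed_segment v y \<Longrightarrow> stem x = A + B * stem (6 * x + c)"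
        and "\<And>x. x \<in> closed_segment v y \<Longrightarrow> ?r x = A' + B' * ?r (6 * x + c)"
        and B: "B > 0" "B' > 0" and bounds: "0 \<le> 6 * v + c" "6 * y + c \<le> 1"
      for A B A' B' c
    proof -
      have "level stem (6 * v + c) (6 * y + c)"
        using level_affine[where g = stem and h = stem and a = 6 and c = c, OF B(1) that(1)] Suc.prems(4) by simp
      then have "level ?r (6 * v + c) (6 * y + c)"
        using Suc.prems bounds by (intro Suc.IH) auto
      then show ?thesis using level_affine[where g = ?r and h = ?r and a = 6 and c = c, OF B(2) that(2)] by simp
    qed
    consider "stem v < 1/2" | "stem v = 1/2" | "stem v > 1/2" "v > 5/6" | "stem v > 1/2" "v \<le> 5/6" by linarith
    then show ?case
    proof cases
      case 1
      then have "y < 1/6" using stem_ge_half[of y] eq by force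
      then show ?thesis using Suc.prems
        by (intro step[of 0 "1/2" 0 "1/2" "1/2"]) (auto simp: seg stem_pieces(1) stem_reverse_low)
    next
      case 2
      then have "v \<in> {1/6, 1/2, 5/6}" "y \<in> {1/6, 1/2, 5/6}" using stem_eq_half eq by metis+
      then show ?thesis by (intro mid) auto
    next
      case 3
      then show ?thesis using Suc.prems
        by (intro step[of "1/2" "1/2" "-5" 0 "1/2"]) (auto simp: seg stem_pieces(6) stem_reverse_high)
    next
      case 4
      then obtain q where "q = 1 \<or> q = (3::real)" "q / 6 < v" "y < (q + 2) / 6"
        using level_in_hair[OF Suc.prems(4) _ 4] Suc.prems(2) by auto
      then show ?thesis by (intro mid) auto
    qed
  qed
  consider "v = y" | "v < y" | "y < v" by linarith
  then show ?thesis
  proof cases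
    case 1 then show ?thesis by simp
  next
    case 2
    obtain k where "(1/6) ^ k \<le> y - v" using sixth_power_below[of "y - v"] 2 by auto
    then show ?thesis using main 2 assms by blast
  next
    case 3
    obtain k where "(1/6) ^ k \<le> v - y" using sixth_power_below[of "v - y"] 3 by auto
    then show ?thesis using main[of y v k] 3 assms level_sym by blast
  qed
qed

text \<open>Both points can lie in the same end piece at every scale, so zooming need not stop; but
  each zoom halves the possible defect, which therefore tends to 0.\<close>

lemma late_min_reverse:
  assumes "late_min v" "0 \<le> r" "r \<le> v" shows "stem (1 - v) \<le> stem (1 - r)"
proof -
  have approx: "stem (1 - v) \<le> stem (1 - r) + (1/2) ^ k" if "late_min v" "0 \<le> r" "r \<le> v" for k v r
    using that
  proof (induction k arbitrary: v r)
    case 0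
    then show ?case using stem_bounds[of "1 - v"] stem_bounds[of "1 - r"] by simp
  next
    case (Suc k)
    consider "v \<le> 1/6" | "1/6 \<le> v" "v \<le> 5/6" | "5/6 \<le> v" "r \<le> 5/6" | "5/6 \<le> r" by linarith
    then show ?case
    proof cases
      case 1
      then show ?thesis using Suc.IH[OF late_min_low[OF Suc.prems(1)], of "6 * r"] Suc.prems
        by (simp add: stem_reverse_low)
    next
      case 2
      then have "stem (1 - v) = 1/2" using late_min_mid Suc.prems stem_symmetric by metis
      moreover have "1/2 \<le> stem (1 - r)" using 2 Suc.prems by (intro stem_ge_half) auto
      ultimately show ?thesis by (simp add: add_increasing2)
    next
      case 3
      then have "stem (1 - v) \<le> 1/2" using stem_pieces(1)[of "1 - v"] stem_bounds[of "6 * (1 - v)"] by simp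
      moreover have "1/2 \<le> stem (1 - r)" using 3 by (intro stem_ge_half) auto
      ultimately show ?thesis by (simp add: add_increasing2)
    next
      case 4
      then show ?thesis using Suc.IH[OF late_min_high[OF Suc.prems(1)], of "6 * r - 5"] Suc.prems
        by (simp add: stem_reverse_high)
    qed
  qed
  have "(\<lambda>k. stem (1 - r) + (1/2) ^ k) \<longlonglongrightarrow> stem (1 - r) + 0"
    by (intro tendsto_intros LIMSEQ_realpow_zero) auto
  then show ?thesis using LIMSEQ_le_const[of _ "stem (1 - r) + 0" "stem (1 - v)"] approx[OF assms] by auto
qed

section \<open>Heights invariant under an involution\<close>

lemma continuous_segment_image:
  fixes \<phi> :: "real \<Rightarrow> real"
  assumes cont: "continuous_on (closed_segment s t) \<phi>"
    and sub: "\<And>x. x \<in> closed_segment s t \<Longrightarrow> \<phi> x \<in> closed_segment (\<phi> s) (\<phi> t)"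
  shows "\<phi> ` closed_segment s t = closed_segment (\<phi> s) (\<phi> t)"
proof
  have "connected (\<phi> ` closed_segment s t)" using cont by (intro connected_continuous_image) auto
  then have "convex (\<phi> ` closed_segment s t)" using is_interval_connected_1 is_interval_convex_1 by blast
  then show "closed_segment (\<phi> s) (\<phi> t) \<subseteq> \<phi> ` closed_segment s t"
    by (intro closed_segment_subset) auto
qed (use sub in blast)

lemma mono_segment_image:
  fixes \<phi> :: "real \<Rightarrow> real"
  assumes "continuous_on {s..t} \<phi>" "s \<le> t" "\<And>x y. s \<le> x \<Longrightarrow> x \<le> y \<Longrightarrow> y \<le> t \<Longrightarrow> \<phi> x \<le> \<phi> y"
  shows "\<phi> ` closed_segment s t = closed_segment (\<phi> s) (\<phi> t)"
  using assms by (intro continuous_segment_image) (auto simp: closed_segment_eq_real_ivl)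

lemma antimono_segment_image:
  fixes \<phi> :: "real \<Rightarrow> real"
  assumes "continuous_on {s..t} \<phi>" "s \<le> t" "\<And>x y. s \<le> x \<Longrightarrow> x \<le> y \<Longrightarrow> y \<le> t \<Longrightarrow> \<phi> y \<le> \<phi> x"
  shows "\<phi> ` closed_segment s t = closed_segment (\<phi> s) (\<phi> t)"
proof (rule continuous_segment_image)
  have "\<phi> t \<le> \<phi> s" using assms by auto
  then show "\<phi> x \<in> closed_segment (\<phi> s) (\<phi> t)" if "x \<in> closed_segment s t" for x
    using assms(2) assms(3)[of s x] assms(3)[of x t] that by (auto simp: closed_segment_eq_real_ivl)
qed (use assms in \<open>simp add: closed_segment_eq_real_ivl\<close>)

lemma periodic_extension:
  fixes g :: "real \<Rightarrow> real"
  assumes cont: "continuous_on {0..1} g" and ends: "g 0 = g 1"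
  shows "continuous_on UNIV (\<lambda>x. g (frac x))" "frac (x + 1) = frac x"
    "0 \<le> x \<Longrightarrow> x \<le> 1 \<Longrightarrow> g (frac x) = g x"
proof -
  show "frac (x + 1) = frac x" by (simp add: frac_def)
  have eq: "g (frac x) = g (x - of_int n)" if "of_int n \<le> x" "x \<le> of_int n + 1" for x and n :: int
  proof (cases "x = of_int n + 1")
    case True
    then have "frac x = 0" by (simp add: frac_def)
    then show ?thesis using True ends by simp
  next
    case False
    then have "\<lfloor>x\<rfloor> = n" using that by (intro floor_unique) auto
    then show ?thesis by (simp add: frac_def)
  qed
  show "0 \<le> x \<Longrightarrow> x \<le> 1 \<Longrightarrow> g (frac x) = g x" using eq[of 0 x] by simp
  have on: "continuous_on {of_int n..of_int n + 1} (\<lambda>x. g (frac x))" for n :: int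
  proof -
    have "continuous_on {of_int n..of_int n + 1} (\<lambda>x. g (x - of_int n))"
      by (intro continuous_on_compose2[OF cont] continuous_intros) auto
    then show ?thesis by (rule continuous_on_eq) (use eq in auto)
  qed
  have "isCont (\<lambda>x. g (frac x)) x" for x
  proof -
    \<comment> \<open>This choice puts \<open>x\<close> into the interior of
      [\<open>n\<close>, \<open>n + 2\<close>] even when \<open>x\<close> is an integer, where two
      pieces meet.\<close>
    define n where "n = \<lceil>x\<rceil> - 1"
    have n: "of_int n < x" "x \<le> of_int n + 1" unfolding n_def by linarith+
    have "continuous_on ({of_int n..of_int n + 1} \<union> {of_int (n + 1)..of_int (n + 1) + 1}) (\<lambda>x. g (frac x))"
      by (intro continuous_on_closed_Un on) auto
    moreover have "{of_int n..of_int n + 1} \<union> {of_int (n + 1)..of_int (n + 1) + 1} = {of_int n..of_int n + (2::real)}"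
      by auto
    ultimately have "continuous_on {of_int n..of_int n + 2} (\<lambda>x. g (frac x))" by simp
    then show ?thesis using n by (intro continuous_on_interior[of "{of_int n..of_int n + 2}"]) auto
  qed
  then show "continuous_on UNIV (\<lambda>x. g (frac x))" by (simp add: continuous_at_imp_continuous_on)
qed

lemma digital_add_int: "v \<in> digital \<Longrightarrow> v + real_of_int i \<in> digital"
proof -
  assume v: "v \<in> digital"
  then obtain k where k: "\<And>l. l \<ge> k \<Longrightarrow> \<exists>m::int. \<bar>6 ^ l * v - m\<bar> \<le> 1/6" by (auto simp: digital_def)
  have "\<exists>m::int. \<bar>6 ^ l * (v + i) - m\<bar> \<le> 1/6" if "l \<ge> k" for l
  proof -
    obtain m :: int where "\<bar>6 ^ l * v - m\<bar> \<le> 1/6" using k[OF \<open>l \<ge> k\<close>] by blast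
    then have "\<bar>6 ^ l * (v + i) - of_int (m + 6 ^ l * i)\<bar> \<le> 1/6" by (simp add: algebra_simps)
    then show ?thesis by blast
  qed
  then show ?thesis unfolding digital_def by blast
qed

lemma digital_reverse: "1 - v \<in> digital \<Longrightarrow> v \<in> digital"
  using digital_add_int[OF digital_uminus[of "1 - v"], of 1] by simp

text \<open>The lift of the involution, in a coordinate where the rotation by \<open>p\<close> is the unit translation.
  Up to translation it swaps \<open>[0, al]\<close> with \<open>[be, 1]\<close>, and it expands \<open>[al, be]\<close> onto the rest of
  the circle.\<close>

locale strip =
  fixes N :: nat and F u :: "real \<Rightarrow> real" and al be :: real
  assumes N: "N \<ge> 2"
    and F_cont: "continuous_on UNIV F" and F_mono: "strict_mono F"
    and F_shift1: "F (x + real N) = F x + real N" and F_F: "F (F x) = x + real N"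
    and al: "al = F 1 - N" and be: "be = F 0"
    and order: "0 < al" "al < be" "be < 1"
    and expand: "\<lbrakk>al \<le> x; x \<le> y; y \<le> be\<rbrakk> \<Longrightarrow> 2 * (y - x) \<le> F y - F x"
    and u_cont: "continuous_on {0..al} u" and u_mono: "strict_mono_on {0..al} u"
    and u_0: "u 0 = 0" and u_al: "u al = 1"
begin

lemma F_le_iff [simp]: "F x \<le> F y \<longleftrightarrow> x \<le> y" using F_mono strict_mono_less_eq by blast
lemma F_less_iff [simp]: "F x < F y \<longleftrightarrow> x < y" using F_mono strict_mono_less by blast

lemma F_shift: "F (x + real N * of_int k) = F x + real N * of_int k"
proof -
  have n: "F (x + real N * real n) = F x + real N * real n" for x n
  proof (induction n)
    case (Suc n)
    have eq: "x + real N * real (Suc n) = x + real N * real n + real N" by (simp add: algebra_simps)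
    show ?case unfolding eq F_shift1 Suc by (simp add: algebra_simps)
  qed simp
  show ?thesis
  proof (cases k)
    case (nonneg n) then show ?thesis using n by simp
  next
    case (neg n)
    have "x + real N * of_int k + real N * real (Suc n) = x" unfolding neg by (simp add: algebra_simps)
    then have "F x = F (x + real N * of_int k) + real N * real (Suc n)"
      using n[of "x + real N * of_int k" "Suc n"] by (simp only:)
    then show ?thesis unfolding neg by (simp add: algebra_simps)
  qed
qed

lemma F_diff: "F (x - real N) = F x - real N" using F_shift[of x "-1"] by simp

lemma F_0: "F 0 = be" and F_al: "F al = 1" and F_be: "F be = N" and F_1: "F 1 = al + N"
  using F_diff F_F by (simp_all add: al be)

text \<open>The letters in the names stand for the intervals \<open>J\<close> =
  [0, \<open>al\<close>], \<open>M\<close> = [\<open>al\<close>, \<open>be\<close>],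
  \<open>K\<close> = [\<open>be\<close>, 1] and \<open>U\<close> = [1, \<open>N\<close>].
  \<open>F\<close> maps them onto \<open>K\<close>, \<open>U\<close>, \<open>J\<close> shifted by
  \<open>N\<close>, and \<open>M\<close> shifted by \<open>N\<close>.\<close>

lemma F_J: "0 \<le> x \<Longrightarrow> x \<le> al \<Longrightarrow> be \<le> F x \<and> F x \<le> 1"
  using F_le_iff[of 0 x] F_le_iff[of x al] by (simp only: F_0 F_al)

lemma F_M: "al \<le> x \<Longrightarrow> x \<le> be \<Longrightarrow> 1 \<le> F x \<and> F x \<le> N"
  using F_le_iff[of al x] F_le_iff[of x be] by (simp only: F_be F_al)

lemma F_K: "be \<le> x \<Longrightarrow> x \<le> 1 \<Longrightarrow> N \<le> F x \<and> F x \<le> al + N"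
  using F_le_iff[of be x] F_le_iff[of x 1] by (simp only: F_be F_1)

lemma F_U: "1 \<le> x \<Longrightarrow> x \<le> real N \<Longrightarrow> al \<le> F x - N \<and> F x - N \<le> be"
proof -
  assume x: "1 \<le> x" "x \<le> real N"
  have "F 1 \<le> F x" "F x \<le> F (0 + real N)" using x by simp_all
  then show ?thesis unfolding F_1 F_shift1 F_0 by linarith
qed

lemma F_cont_on: "continuous_on A F" using F_cont continuous_on_subset by blast

lemma F_segment: "F ` closed_segment s t = closed_segment (F s) (F t)"
  by (intro continuous_segment_image F_cont_on) (auto simp: closed_segment_eq_real_ivl)

lemma u_le: "0 \<le> x \<Longrightarrow> x \<le> y \<Longrightarrow> y \<le> al \<Longrightarrow> u x \<le> u y"
  using strict_mono_onD[OF u_mono, of x y] by (cases "x = y") auto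

lemma u_less: "0 \<le> x \<Longrightarrow> x < y \<Longrightarrow> y \<le> al \<Longrightarrow> u x < u y"
  using strict_mono_onD[OF u_mono, of x y] by auto

lemma u_range: "0 \<le> x \<Longrightarrow> x \<le> al \<Longrightarrow> 0 \<le> u x \<and> u x \<le> 1"
  using u_le[of 0 x] u_le[of x al] u_0 u_al by auto

lemma u_surj: assumes "0 \<le> s" "s \<le> t" "t \<le> al" "u s \<le> r" "r \<le> u t" obtains x where "s \<le> x" "x \<le> t" "u x = r"
proof -
  have "continuous_on {s..t} u" using u_cont by (rule continuous_on_subset) (use assms in auto)
  then show ?thesis using IVT'[of u s r t] assms that by auto
qed

text \<open>The height of period 1 is a copy of \<open>stem\<close> on \<open>[0, al]\<close>, its mirror image under \<open>F\<close> on \<open>[be, 1]\<close>,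
  and \<open>1 + height (F x) / 2\<close> on \<open>[al, be]\<close>; the series below solves this functional equation.\<close>

definition clip :: "real \<Rightarrow> real" where "clip x = u (max 0 (min al x))"

text \<open>On [0, 1] each \<open>stem\<close> term is constantly 1 outside its own slope, so one
  formula covers the rising slope, the plateau at height 1 and the falling slope.\<close>

definition base :: "real \<Rightarrow> real"
  where "base x = stem (clip (frac x)) + stem (1 - clip (F (frac x) - N)) - 1"

text \<open>On [0, 1] this is \<open>F\<close> of the point clamped to
  [\<open>al\<close>, \<open>be\<close>]. The linear terms extend it continuously, as
  \<open>F be - F al = N - 1\<close>. On the slopes it is a constant integer, where the height is 0,
  so the series reduces there to its first term.\<close>

definition fold :: "real \<Rightarrow> real"
  where "fold x = F (max al (min be (frac x))) - (real N - 1) * frac x + (real N - 1) * x"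

definition height :: "real \<Rightarrow> real"
  where "height x = (\<Sum>k. (1/2) ^ k * base ((fold ^^ k) x))"

lemma clip_cont: "continuous_on UNIV clip"
  unfolding clip_def[abs_def]
  by (intro continuous_on_compose2[OF u_cont] continuous_intros) (use order in auto)

lemma clip_simps: "x \<le> 0 \<Longrightarrow> clip x = 0" "x \<ge> al \<Longrightarrow> clip x = 1" "0 \<le> x \<Longrightarrow> x \<le> al \<Longrightarrow> clip x = u x"
  using order u_0 u_al by (auto simp: clip_def max_def min_def)

lemma base_eqs:
  shows "0 \<le> x \<Longrightarrow> x \<le> al \<Longrightarrow> stem (clip x) + stem (1 - clip (F x - N)) - 1 = stem (u x)"
    "al \<le> x \<Longrightarrow> x \<le> be \<Longrightarrow> stem (clip x) + stem (1 - clip (F x - N)) - 1 = 1"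
    "be \<le> x \<Longrightarrow> x \<le> 1 \<Longrightarrow> stem (clip x) + stem (1 - clip (F x - N)) - 1 = stem (1 - u (F x - N))"
proof -
  have N': "real N \<ge> 2" using N by simp
  show "0 \<le> x \<Longrightarrow> x \<le> al \<Longrightarrow> stem (clip x) + stem (1 - clip (F x - N)) - 1 = stem (u x)"
    using F_J[of x] clip_simps(1)[of "F x - N"] clip_simps(3)[of x] N' by simp
  show "al \<le> x \<Longrightarrow> x \<le> be \<Longrightarrow> stem (clip x) + stem (1 - clip (F x - N)) - 1 = 1"
    using F_M[of x] clip_simps(1)[of "F x - N"] clip_simps(2)[of x] by simp
  show "be \<le> x \<Longrightarrow> x \<le> 1 \<Longrightarrow> stem (clip x) + stem (1 - clip (F x - N)) - 1 = stem (1 - u (F x - N))"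
    using F_K[of x] clip_simps(3)[of "F x - N"] clip_simps(2)[of x] order by simp
qed

lemma base_props:
  shows "continuous_on UNIV base" "base (x + 1) = base x"
    "0 \<le> x \<Longrightarrow> x \<le> 1 \<Longrightarrow> base x = stem (clip x) + stem (1 - clip (F x - N)) - 1"
proof -
  let ?g = "\<lambda>x. stem (clip x) + stem (1 - clip (F x - N)) - 1"
  have cont: "continuous_on {0..1} ?g"
    by (intro continuous_intros continuous_on_compose2[OF continuous_stem] continuous_on_compose2[OF clip_cont] F_cont_on) auto
  have ends: "?g 0 = ?g 1"
    using base_eqs(1)[of 0] base_eqs(3)[of 1] order u_0 u_al by (simp add: F_1)
  show "continuous_on UNIV base" unfolding base_def[abs_def] by (rule periodic_extension(1)[OF cont ends])
  show "base (x + 1) = base x" unfolding base_def periodic_extension(2)[OF cont ends] ..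
  show "0 \<le> x \<Longrightarrow> x \<le> 1 \<Longrightarrow> base x = ?g x"
    unfolding base_def by (rule periodic_extension(3)[OF cont ends])
qed

lemma fold_props:
  shows "continuous_on UNIV fold" "fold (x + 1) = fold x + (real N - 1)"
    "0 \<le> x \<Longrightarrow> x \<le> 1 \<Longrightarrow> fold x = F (max al (min be x))"
proof -
  let ?g = "\<lambda>x. F (max al (min be x)) - (real N - 1) * x"
  have cont: "continuous_on {0..1} ?g"
    by (intro continuous_intros continuous_on_compose2[OF F_cont]) auto
  have ends: "?g 0 = ?g 1" using order by (simp add: F_al F_be max_def min_def)
  have fold_g: "fold = (\<lambda>x. ?g (frac x) + (real N - 1) * x)" by (simp add: fold_def fun_eq_iff)
  show "continuous_on UNIV fold" unfolding fold_g
    by (intro continuous_intros periodic_extension(1)[OF cont ends])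
  show "fold (x + 1) = fold x + (real N - 1)"
    unfolding fold_g periodic_extension(2)[OF cont ends] by (simp add: algebra_simps)
  show "0 \<le> x \<Longrightarrow> x \<le> 1 \<Longrightarrow> fold x = F (max al (min be x))"
    unfolding fold_g using periodic_extension(3)[OF cont ends, of x] by simp
qed

lemma base_int: "base (x + of_int k) = base x"
proof -
  have "frac (x + of_int k) = frac x" by (simp add: frac_def)
  then show ?thesis by (simp add: base_def)
qed

lemma fold_int: "fold (x + of_int k) = fold x + of_int ((int N - 1) * k)"
proof -
  have "frac (x + of_int k) = frac x" by (simp add: frac_def)
  then show ?thesis by (simp add: fold_def algebra_simps)
qed

lemma fold_iter_int: "(fold ^^ n) (x + of_int k) = (fold ^^ n) x + of_int ((int N - 1) ^ n * k)"
  by (induction n) (simp_all only: funpow.simps o_apply id_apply fold_int power_0 power_Suc mult.assoc mult_1)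

lemma base_range: "0 \<le> base x \<and> base x \<le> 1"
proof -
  have r: "0 \<le> frac x" "frac x \<le> 1" using frac_ge_0 frac_lt_1[of x] by auto
  consider "frac x \<le> al" | "al \<le> frac x" "frac x \<le> be" | "be \<le> frac x" by linarith
  then show ?thesis unfolding base_def
    using base_eqs[of "frac x"] stem_bounds r by cases auto
qed

lemma fold_iter_cont: "continuous_on UNIV (fold ^^ n)"
proof (induction n)
  case (Suc n)
  then show ?case using continuous_on_compose2[OF fold_props(1) Suc] by (simp add: o_def)
qed simp

lemma height_summand: "norm ((1/2) ^ k * base ((fold ^^ k) x)) \<le> (1/2) ^ k"
  using base_range[of "(fold ^^ k) x"] by (simp add: abs_mult mult_left_le)

lemma height_summable: "summable (\<lambda>k. (1/2) ^ k * base ((fold ^^ k) x))"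
  by (rule summable_comparison_test'[of "\<lambda>k. (1/2) ^ k" 0]) (use height_summand in \<open>auto intro: summable_geometric\<close>)

lemma height_cont: "continuous_on UNIV height"
proof -
  have "uniform_limit UNIV (\<lambda>n x. \<Sum>k<n. (1/2) ^ k * base ((fold ^^ k) x)) height sequentially"
    unfolding height_def[abs_def]
    by (rule Weierstrass_m_test[where M = "\<lambda>k. (1/2) ^ k"]) (use height_summand in \<open>auto intro: summable_geometric\<close>)
  moreover have "continuous_on UNIV (\<lambda>x. \<Sum>k<n. (1/2) ^ k * base ((fold ^^ k) x))" for n
    by (intro continuous_intros continuous_on_compose2[OF base_props(1) fold_iter_cont]) auto
  ultimately show ?thesis using uniform_limit_theorem by (metis (no_types, lifting) always_eventually sequentially_bot)
qed

lemma height_int: "height (x + of_int k) = height x"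
  unfolding height_def fold_iter_int base_int ..

lemma height_nat: "height (x + real n) = height x" "height (x - real n) = height x"
  using height_int[of x "int n"] height_int[of x "- int n"] by simp_all

lemma height_unfold: "height x = base x + height (fold x) / 2"
proof -
  have "height x = base x + (\<Sum>k. (1/2) ^ Suc k * base ((fold ^^ Suc k) x))"
    unfolding height_def using suminf_split_head[OF height_summable[of x]] by simp
  also have "(\<lambda>k. (1/2) ^ Suc k * base ((fold ^^ Suc k) x)) = (\<lambda>k. 1/2 * ((1/2) ^ k * base ((fold ^^ k) (fold x))))"
    by (simp add: funpow_swap1 fun_eq_iff)
  also have "(\<Sum>k. 1/2 * ((1/2) ^ k * base ((fold ^^ k) (fold x)))) = 1/2 * height (fold x)"
    unfolding height_def by (rule suminf_mult[OF height_summable])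
  finally show ?thesis by simp
qed

lemma height_nonneg: "0 \<le> height x"
  unfolding height_def using base_range by (intro suminf_nonneg height_summable) auto

text \<open>The functional equation at 0 reads \<open>height 0 = height 0 / 2\<close>.\<close>

lemma height_0: "height 0 = 0"
proof -
  have "fold 0 = 0 + of_int 1" using fold_props(3)[of 0] order by (simp add: F_al max_def min_def)
  then have "height (fold 0) = height 0" using height_int by metis
  moreover have "base 0 = 0" using base_props(3)[of 0] base_eqs(1)[of 0] order u_0 by simp
  ultimately show ?thesis using height_unfold[of 0] by simp
qed

lemma height_of_int: "height (of_int k) = 0"
  using height_int[of 0 k] height_0 by simp

lemma height_J: assumes "0 \<le> x" "x \<le> al" shows "height x = stem (u x)"
proof -
  have "fold x = of_int 1" using fold_props(3)[of x] assms order by (simp add: F_al max_def min_def)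
  then have "height (fold x) = 0" using height_of_int by metis
  then show ?thesis using height_unfold[of x] base_props(3)[of x] base_eqs(1)[of x] assms order by simp
qed

lemma height_M: assumes "al \<le> x" "x \<le> be" shows "height x = 1 + height (F x) / 2"
  using height_unfold[of x] base_props(3)[of x] base_eqs(2)[of x] fold_props(3)[of x] assms order
  by (simp add: max_def min_def)

lemma height_K: assumes "be \<le> x" "x \<le> 1" shows "height x = stem (1 - u (F x - N))"
proof -
  have "fold x = of_int (int N)" using fold_props(3)[of x] assms order by (simp add: F_be max_def min_def)
  then have "height (fold x) = 0" using height_of_int by metis
  then show ?thesis using height_unfold[of x] base_props(3)[of x] base_eqs(3)[of x] assms order by simp
qed

lemma height_F_J: assumes "0 \<le> x" "x \<le> al" shows "height (F x) = stem (1 - u x)"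
  using height_K[of "F x"] F_J assms by (simp add: F_F)

lemma height_F_K: assumes "be \<le> x" "x \<le> 1" shows "height (F x) = stem (u (F x - N))"
  using height_J[of "F x - N"] F_K[of x] assms height_nat(2)[of "F x" N] by simp

text \<open>The equation on [\<open>al\<close>, \<open>be\<close>] read backwards:
  \<open>F x - N\<close> lies there, and \<open>F\<close> returns it to \<open>x\<close>.\<close>

lemma height_F_U: assumes "1 \<le> x" "x \<le> real N" shows "height (F x) = 1 + height x / 2"
  using height_M[of "F x - N"] F_U[of x] assms height_nat[of "F x" N] height_nat[of x N] by (simp add: F_diff F_F)

lemma height_M_ge: "al \<le> x \<Longrightarrow> x \<le> be \<Longrightarrow> 1 \<le> height x"
  using height_M height_nonneg[of "F x"] by simp

lemma height_J_less: "0 \<le> x \<Longrightarrow> x < al \<Longrightarrow> height x < 1"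
  using height_J[of x] u_less[of x al] u_al stem_less_1[of "u x"] by simp

lemma height_K_less: assumes "be < x" "x \<le> 1" shows "height x < 1"
proof -
  have "0 < F x - N" using F_less_iff[of be x] assms by (simp add: F_be)
  then have "0 < u (F x - N)" using u_less[of 0 "F x - N"] F_K[of x] assms u_0 by simp
  then show ?thesis using height_K[of x] assms stem_less_1 by simp
qed

lemma height_pos: assumes "0 < x" "x < 1" shows "0 < height x"
proof -
  consider "x \<le> al" | "al \<le> x" "x \<le> be" | "be \<le> x" by linarith
  then show ?thesis
  proof cases
    case 1
    then show ?thesis using height_J[of x] u_less[of 0 x] u_0 assms stem_pos[of "u x"] by simp
  next
    case 2
    then show ?thesis using height_M_ge by force
  next
    case 3
    have "F x - N < al" using F_less_iff[of x 1] assms by (simp add: F_1)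
    then have "u (F x - N) < 1" using u_less[of "F x - N" al] F_K[of x] assms u_al 3 by simp
    then show ?thesis using height_K[of x] 3 assms stem_pos[of "1 - u (F x - N)"] by simp
  qed
qed

lemma height_eq_0: assumes "height x = 0" shows "x \<in> \<int>"
proof -
  obtain k :: int where k: "0 \<le> x + 1 * of_int k" "x + 1 * of_int k < 0 + 1" using shift_into[of 1 0 x] by auto
  have "x + of_int k = 0" using height_pos[of "x + of_int k"] k height_int[of x k] assms by force
  then have "x = of_int (- k)" by simp
  then show ?thesis by (metis Ints_of_int)
qed

lemma level_height_int: "level height (s + of_int k) (t + of_int k) \<longleftrightarrow> level height s t"
proof -
  have "(\<lambda>x. 1 * x + of_int k) ` closed_segment s t = closed_segment (1 * s + of_int k) (1 * t + of_int k)"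
    by (rule affine_segment)
  then have im: "(\<lambda>x. x + of_int k) ` closed_segment s t = closed_segment (s + of_int k) (t + of_int k)" by simp
  have "level height s t \<longleftrightarrow> level height ((\<lambda>x. x + of_int k) s) ((\<lambda>x. x + of_int k) t)"
    by (rule level_transfer[where A = 0 and B = 1]) (use im height_int in auto)
  then show ?thesis by simp
qed

text \<open>The height is 0 at every integer, so a tie at positive height stays inside one
  period.\<close>

lemma level_no_int:
  assumes "level height s t" "height s \<noteq> 0" "s \<le> t"
  obtains k :: int where "0 < s + of_int k" "t + of_int k < 1"
proof -
  obtain k :: int where k: "0 \<le> s + 1 * of_int k" "s + 1 * of_int k < 0 + 1" using shift_into[of 1 0 s] by auto
  have no: "\<not> (s \<le> of_int j \<and> of_int j \<le> t)" for j
  proof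
    assume "s \<le> of_int j \<and> of_int j \<le> t"
    then have "height s \<le> height (of_int j)" using assms by (auto simp: level_iff)
    then show False using height_of_int height_nonneg[of s] assms(2) by simp
  qed
  have "s + of_int k \<noteq> 0"
  proof
    assume "s + of_int k = 0"
    then have "s = of_int (- k)" by simp
    then show False using no[of "- k"] assms(3) by simp
  qed
  moreover have "t + of_int k < 1"
    using no[of "1 - k"] k by (simp add: algebra_simps)
  ultimately show ?thesis using that[of k] k by simp
qed

lemma late_min_J:
  assumes s: "0 \<le> s" "s \<le> al" and ge: "\<And>x. s \<le> x \<Longrightarrow> x \<le> al \<Longrightarrow> height s \<le> height x"
  shows "late_min (u s)"
  unfolding late_min_def
proof (intro conjI allI impI)
  fix r assume "u s \<le> r \<and> r \<le> 1"
  then obtain x where x: "s \<le> x" "x \<le> al" "u x = r" using u_surj[of s al r] s u_al by auto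
  then show "stem (u s) \<le> stem r" using ge[of x] height_J[of s] height_J[of x] s by simp
qed (use u_range s in auto)

lemma late_min_K:
  assumes t: "be \<le> t" "t \<le> 1" and ge: "\<And>x. be \<le> x \<Longrightarrow> x \<le> t \<Longrightarrow> height t \<le> height x"
  shows "late_min (1 - u (F t - N))"
  unfolding late_min_def
proof (intro conjI allI impI)
  fix r assume r: "1 - u (F t - N) \<le> r \<and> r \<le> 1"
  then obtain y where y: "0 \<le> y" "y \<le> F t - N" "u y = 1 - r"
    using u_surj[of 0 "F t - N" "1 - r"] F_K[of t] t u_0 by auto
  have Fx: "F (F y) - N = y" by (simp add: F_F)
  have "be \<le> F y" using F_le_iff[of 0 y] y(1) by (simp only: F_0)
  moreover have "F y \<le> t" using F_le_iff[of "F y" t] y(2) by (simp add: F_F)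
  ultimately have "height t \<le> height (F y)" using ge by blast
  moreover have "height (F y) = stem r"
    using height_K[of "F y"] \<open>be \<le> F y\<close> \<open>F y \<le> t\<close> t Fx y by simp
  ultimately show "stem (1 - u (F t - N)) \<le> stem r" using height_K[of t] t by simp
qed (use u_range[of "F t - N"] F_K[of t] t in auto)

text \<open>The height is at least 1 on [\<open>al\<close>, \<open>be\<close>] and less than 1 on
  the slopes apart from their tops. A tie that starts inside the rising slope and leaves it must
  therefore cross the whole middle and end on the falling slope, and its two ends are late
  minima.\<close>

lemma level_cases:
  assumes lv: "level height s t" and st: "0 < s" "s < t" "t < 1"
  obtains (J) "t \<le> al" | (K) "be \<le> s" | (M) "al \<le> s" "t \<le> be"
    | (JK) "s < al" "be < t" "late_min (u s)" "late_min (1 - u (F t - N))" "height s < 1"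
proof -
  have ge: "height s \<le> height r" if "s \<le> r" "r \<le> t" for r using lv st that by (auto simp: level_iff)
  have eq: "height s = height t" using lv by (simp add: level_def)
  consider "t \<le> al" | "be \<le> s" | "al \<le> s" "t \<le> be" | "s < al" "al < t" | "al \<le> s" "s < be" "be < t" by linarith
  then show ?thesis
  proof cases
    case 4
    then have lt: "height s < 1" using height_J_less st by simp
    then have "be < t" using height_M_ge[of t] 4 eq by force
    then show ?thesis using JK late_min_J[of s] late_min_K[of t] ge eq lt 4 st order by auto
  next
    case 5
    then show ?thesis using height_M_ge[of s] height_K_less[of t] eq st by simp
  qed (use J K M in auto)
qed

lemma level_J:
  assumes "0 \<le> s" "s \<le> t" "t \<le> al"
  shows "level height s t \<longleftrightarrow> level stem (u s) (u t)"
    "tied stem (u s) (u t) = u ` tied height s t"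
proof -
  have seg: "closed_segment s t = {s..t}" using assms by (simp add: closed_segment_eq_real_ivl)
  have im: "u ` closed_segment s t = closed_segment (u s) (u t)"
    using u_cont by (rule mono_segment_image[OF continuous_on_subset]) (use assms u_le in auto)
  have eq: "height x = 0 + 1 * stem (u x)" if "x \<in> closed_segment s t" for x
    using that assms height_J[of x] by (simp add: seg)
  show "level height s t \<longleftrightarrow> level stem (u s) (u t)"
    using level_transfer[where \<phi> = u and g = height and h = stem, OF im _ eq] by simp
  show "tied stem (u s) (u t) = u ` tied height s t"
    using tied_transfer[where \<phi> = u and g = height and h = stem, OF im _ eq] by simp
qed

lemma level_K:
  assumes "be \<le> s" "s \<le> t" "t \<le> 1"
  shows "level height s t \<longleftrightarrow> level stem (1 - u (F s - N)) (1 - u (F t - N))"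
    "tied stem (1 - u (F s - N)) (1 - u (F t - N)) = (\<lambda>x. 1 - u (F x - N)) ` tied height s t"
    "(\<lambda>x. 1 - u (F x - N)) ` closed_segment s t = closed_segment (1 - u (F s - N)) (1 - u (F t - N))"
proof -
  let ?\<phi> = "\<lambda>x. 1 - u (F x - N)"
  have seg: "closed_segment s t = {s..t}" using assms by (simp add: closed_segment_eq_real_ivl)
  have "F x - N \<in> {0..al}" if "x \<in> {s..t}" for x using F_K[of x] that assms by auto
  then have "continuous_on {s..t} ?\<phi>"
    by (intro continuous_intros continuous_on_compose2[OF u_cont] F_cont_on image_subsetI) auto
  moreover have "?\<phi> y \<le> ?\<phi> x" if "s \<le> x" "x \<le> y" "y \<le> t" for x y
    using u_le[of "F x - N" "F y - N"] F_K[of x] F_K[of y] that assms by simp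
  ultimately show im: "?\<phi> ` closed_segment s t = closed_segment (?\<phi> s) (?\<phi> t)"
    using assms by (intro antimono_segment_image) auto
  have eq: "height x = 0 + 1 * stem (?\<phi> x)" if "x \<in> closed_segment s t" for x
    using that assms height_K[of x] by (simp add: seg)
  show "level height s t \<longleftrightarrow> level stem (?\<phi> s) (?\<phi> t)"
    using level_transfer[where \<phi> = ?\<phi> and g = height and h = stem, OF im _ eq] by simp
  show "tied stem (?\<phi> s) (?\<phi> t) = ?\<phi> ` tied height s t"
    using tied_transfer[where \<phi> = ?\<phi> and g = height and h = stem, OF im _ eq] by simp
qed

lemma level_M:
  assumes "al \<le> s" "s \<le> t" "t \<le> be"
  shows "level height s t \<longleftrightarrow> level height (F s) (F t)"
    "tied height (F s) (F t) = F ` tied height s t"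
proof -
  have seg: "closed_segment s t = {s..t}" using assms by (simp add: closed_segment_eq_real_ivl)
  have eq: "height x = 1 + 1/2 * height (F x)" if "x \<in> closed_segment s t" for x
    using that assms height_M[of x] by (simp add: seg)
  show "level height s t \<longleftrightarrow> level height (F s) (F t)"
    using level_transfer[where \<phi> = F and g = height and h = height, OF F_segment _ eq] by simp
  show "tied height (F s) (F t) = F ` tied height s t"
    using tied_transfer[where \<phi> = F and g = height and h = height, OF F_segment _ eq] by simp
qed

text \<open>Full turns must be allowed on the right, because \<open>F\<close> may carry a tie to one
  that runs the other way round the circle.\<close>

lemma level_F:
  assumes "level height s t" shows "\<exists>k::int. level height (F s) (F t + real N * of_int k)"
proof -
  have height_N: "height (x + real N * of_int k) = height x" for x k
    using height_int[of x "int N * k"] by simp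
  have level_N: "level height (x + real N * of_int k) (y + real N * of_int k) \<longleftrightarrow> level height x y" for x y k
    using level_height_int[of x "int N * k" y] by simp
  have main: "\<exists>k::int. level height (F s) (F t + real N * of_int k)"
    if lv: "level height s t" and lt: "s < t" for s t
  proof (cases "height s = 0")
    case True
    \<comment> \<open>Ties at height 0 join integers. Up to full turns their images lie in
      [\<open>al\<close>, \<open>be\<close>] at height 1, the minimum of that interval, so they are
      tied there.\<close>
    have in_M: "\<exists>k::int. al \<le> F x + real N * of_int k \<and> F x + real N * of_int k \<le> be \<and> height (F x) = 1"
      if x: "x \<in> \<int>" for x
    proof -
      have Npos: "real N > 0" using N by simp
      obtain k :: int where k: "0 \<le> x + real N * of_int k" "x + real N * of_int k < 0 + real N"
        using shift_into[OF Npos, of 0 x] by auto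
      define y where "y = x + real N * of_int k"
      have Fy: "F y = F x + real N * of_int k" by (simp add: y_def F_shift)
      have hy: "height y = 0"
        using x height_of_int height_N by (auto simp: y_def elim: Ints_cases)
      show ?thesis
      proof (cases "y = 0")
        case True
        then have "F x + real N * of_int k = be" using Fy F_0 by simp
        moreover have "height (F x) = 1"
          using height_N[of "F x" k] calculation height_M[of be] order F_be height_of_int[of "int N"] by simp
        ultimately show ?thesis using order by (intro exI[of _ k]) auto
      next
        case False
        have "y \<in> \<int>" using x by (auto simp: y_def intro!: Ints_add Ints_mult)
        then obtain i where "y = of_int i" by (rule Ints_cases)
        then have y1: "1 \<le> y" "y \<le> N" using False k by (auto simp: y_def[symmetric])
        have "height (F x) = 1" using height_F_U[OF y1] hy height_N[of "F x" k] Fy by simp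
        moreover have "F x + real N * of_int (k - 1) = F y - N" using Fy by (simp add: algebra_simps)
        ultimately show ?thesis using F_U[OF y1] by metis
      qed
    qed
    have "height t = 0" using lv True by (simp add: level_def)
    then obtain j k :: int where j: "al \<le> F s + real N * of_int j" "F s + real N * of_int j \<le> be" "height (F s) = 1"
      and k: "al \<le> F t + real N * of_int k" "F t + real N * of_int k \<le> be" "height (F t) = 1"
      using in_M[OF height_eq_0[OF True]] in_M[OF height_eq_0[of t]] by blast
    have "1 \<le> height r" if "r \<in> closed_segment (F s + real N * of_int j) (F t + real N * of_int k)" for r
      using height_M_ge[of r] that j k by (auto simp: closed_segment_eq_real_ivl split: if_splits)
    moreover have "height (F s + real N * of_int j) = 1" "height (F t + real N * of_int k) = 1"
      using j k height_N by simp_all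
    ultimately have "level height (F s + real N * of_int j) (F t + real N * of_int k)"
      by (simp add: level_def)
    moreover have "F t + real N * of_int k = F t + real N * of_int (k - j) + real N * of_int j"
      by (simp add: algebra_simps)
    ultimately show ?thesis using level_N by metis
  next
    case False
    obtain i :: int where i: "0 < s + of_int i" "t + of_int i < 1" using level_no_int[OF lv False] lt by auto
    \<comment> \<open>\<open>F\<close> commutes with translations by multiples of \<open>N\<close>,
      so the tie is moved by such a multiple; \<open>j\<close> is the period among 0, ...,
      \<open>N - 1\<close> in which it ends up.\<close>
    define j where "j = (- i) mod int N"
    define k where "k = (- i) div int N"
    have jk: "- i = int N * k + j" by (simp add: j_def k_def)
    have jr: "0 \<le> j" "j < int N" using N by (auto simp: j_def)
    define s' t' where "s' = s - real N * of_int k" and "t' = t - real N * of_int k"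
    have bounds: "of_int j < s'" "s' < t'" "t' < of_int j + 1"
    proof -
      have "of_int (- i) = real N * of_int k + of_int j" unfolding jk by simp
      then show "of_int j < s'" "t' < of_int j + 1" using i by (auto simp: s'_def t'_def)
    qed (use lt in \<open>simp add: s'_def t'_def\<close>)
    have lv': "level height s' t'" using level_N[of s "- k" t] lv by (simp add: s'_def t'_def)
    have Fs': "F s' = F s + real N * of_int (- k)" "F t' = F t + real N * of_int (- k)"
      using F_shift[of s "- k"] F_shift[of t "- k"] by (simp_all add: s'_def t'_def)
    have seg: "closed_segment s' t' = {s'..t'}" using bounds by (simp add: closed_segment_eq_real_ivl)
    have transfer: "level height (F s') (F t')"
      if eq: "\<And>x. x \<in> closed_segment s' t' \<Longrightarrow> height (F x) = A + B * g (\<phi> x)"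
        and im: "\<phi> ` closed_segment s' t' = closed_segment (\<phi> s') (\<phi> t')"
        and B: "B > 0" and lvg: "level g (\<phi> s') (\<phi> t')" for A B g \<phi>
    proof -
      have "level (\<lambda>x. height (F x)) s' t'"
        using level_transfer[where g = "\<lambda>x. height (F x)" and h = g and \<phi> = \<phi>, OF im B eq] lvg by blast
      moreover have "level (\<lambda>x. height (F x)) s' t' \<longleftrightarrow> level height (F s') (F t')"
        by (rule level_transfer[where \<phi> = F and A = 0 and B = 1]) (auto simp: F_segment)
      ultimately show ?thesis by blast
    qed
    have "\<exists>k::int. level height (F s') (F t' + real N * of_int k)"
    proof (cases "j = 0")
      case False
      \<comment> \<open>Away from period 0 the heights along \<open>F\<close> are
        \<open>1 + h / 2\<close> with \<open>h\<close> the old height, which preserves ties.\<close>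
      then have "1 \<le> j" "j \<le> int N - 1" using jr by auto
      then have "1 \<le> real_of_int j" "real_of_int j \<le> real N - 1" by linarith+
      then have "level height (F s') (F t')" using bounds
        by (intro transfer[where A = 1 and B = "1/2" and g = height and \<phi> = "\<lambda>x. x"] lv')
          (auto simp: seg height_F_U)
      then show ?thesis by (intro exI[of _ 0]) simp
    next
      case True
      then have st: "0 < s'" "s' < t'" "t' < 1" using bounds by auto
      from lv' st show ?thesis
      proof (cases rule: level_cases)
        case J
        have im: "u ` closed_segment s' t' = closed_segment (u s') (u t')"
          using u_cont by (rule mono_segment_image[OF continuous_on_subset]) (use J st u_le in auto)
        have "level (\<lambda>x. stem (1 - x)) (u s') (u t')"
          using level_J[of s' t'] lv' J st u_range[of s'] u_range[of t'] by (intro level_stem_reverse) auto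
        then have "level height (F s') (F t')" using J st im
          by (intro transfer[where A = 0 and B = 1 and g = "\<lambda>x. stem (1 - x)" and \<phi> = u])
            (auto simp: seg height_F_J)
        then show ?thesis by (intro exI[of _ 0]) simp
      next
        case K
        have "level (\<lambda>x. stem (1 - x)) (1 - u (F s' - N)) (1 - u (F t' - N))"
          using level_K(1)[of s' t'] lv' K st u_range[of "F s' - N"] u_range[of "F t' - N"] F_K[of s'] F_K[of t']
          by (intro level_stem_reverse) auto
        then have "level height (F s') (F t')" using K st level_K(3)[of s' t']
          by (intro transfer[where A = 0 and B = 1 and g = "\<lambda>x. stem (1 - x)" and \<phi> = "\<lambda>x. 1 - u (F x - N)"])
            (auto simp: seg height_F_K)
        then show ?thesis by (intro exI[of _ 0]) simp
      next
        case M
        have "height (F x) = - 2 + 2 * height x" if "x \<in> closed_segment s' t'" for x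
          using height_M[of x] that M by (simp add: seg)
        then have "level height (F s') (F t')"
          by (intro transfer[where A = "- 2" and B = 2 and g = height and \<phi> = "\<lambda>x. x"] lv') auto
        then show ?thesis by (intro exI[of _ 0]) simp
      next
        case JK
        \<comment> \<open>A tie across the middle: \<open>F t' - N\<close> lies on the rising slope
          and \<open>F s'\<close> on the falling one, so the image tie crosses the middle from the
          former to the latter. Its ends have equal height by \<open>level_stem_reverse\<close>, and
          \<open>late_min_reverse\<close> keeps the slopes above them.\<close>
        let ?v = "u s'" and ?y = "1 - u (F t' - N)"
        have FtJ: "0 \<le> F t' - N" "F t' - N \<le> al" using F_K[of t'] JK st by auto
        have FsK: "be \<le> F s'" "F s' \<le> 1" using F_J[of s'] JK st by auto
        have stems: "stem ?v = height s'" "stem ?y = height s'"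
          using height_J[of s'] height_K[of t'] JK st lv' by (auto simp: level_def)
        have v01: "0 \<le> ?v" "?v \<le> 1" "0 \<le> ?y" "?y \<le> 1" using JK by (auto simp: late_min_def)
        have "level stem ?v ?y"
          using JK(3,4) stems v01 unfolding level_def late_min_def by (auto simp: closed_segment_eq_real_ivl split: if_splits)
        then have "level (\<lambda>x. stem (1 - x)) ?v ?y" using v01 by (intro level_stem_reverse) auto
        then have veq: "stem (1 - ?v) = stem (1 - ?y)" by (simp add: level_def)
        have hs: "height (F s') = stem (1 - ?v)" using height_F_J[of s'] JK st by simp
        have ht: "height (F t' - N) = stem (1 - ?y)" using height_J[OF FtJ] by simp
        have "height (F s') \<le> height r" if r: "F t' - N \<le> r" "r \<le> F s'" for r
        proof -
          consider "r \<le> al" | "al \<le> r" "r \<le> be" | "be \<le> r" by linarith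
          then show ?thesis
          proof cases
            case 1
            have "stem (1 - ?y) \<le> stem (1 - (1 - u r))"
              using u_le[of "F t' - N" r] u_range[of r] r 1 FtJ by (intro late_min_reverse[OF JK(4)]) auto
            then show ?thesis using height_J[of r] 1 r FtJ hs veq by simp
          next
            case 2
            then show ?thesis using height_M_ge[of r] hs stem_bounds[of "1 - ?v"] by simp
          next
            case 3
            have "F r - N \<le> s'" using r F_le_iff[of r "F s'"] by (simp add: F_F)
            then have "stem (1 - ?v) \<le> stem (1 - u (F r - N))"
              using u_le[of "F r - N" s'] u_range[of "F r - N"] F_K[of r] 3 r FsK JK st
              by (intro late_min_reverse[OF JK(3)]) auto
            then show ?thesis using height_K[of r] 3 r FsK hs by simp
          qed
        qed
        moreover have "F t' - N \<le> F s'" using FtJ FsK order by simp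
        ultimately have "level height (F t' - N) (F s')" using hs ht veq by (auto simp: level_iff)
        then have "level height (F s') (F t' + real N * of_int (- 1))" using level_sym by simp
        then show ?thesis by blast
      qed
    qed
    then obtain m :: int where "level height (F s') (F t' + real N * of_int m)" by blast
    then have "level height (F s + real N * of_int (- k)) (F t + real N * of_int m + real N * of_int (- k))"
      unfolding Fs' by (simp add: algebra_simps)
    then show ?thesis unfolding level_N by blast
  qed
  consider "s = t" | "s < t" | "t < s" by linarith
  then show ?thesis
  proof cases
    case 1
    then show ?thesis by (intro exI[of _ 0]) simp
  next
    case 2
    then show ?thesis using main assms by blast
  next
    case 3
    then obtain k :: int where "level height (F t) (F s + real N * of_int k)"
      using main[of t s] assms level_sym by blast
    then have "level height (F s + real N * of_int k) (F t + real N * of_int (- k) + real N * of_int k)"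
      using level_sym by simp
    then show ?thesis unfolding level_N by blast
  qed
qed

end

section \<open>Finiteness of ties and the digits of tied points\<close>

context strip begin

lemma tied_height_int:
  "tied height (s + of_int k) (t + of_int k) = (\<lambda>x. x + of_int k) ` tied height s t"
proof -
  have im: "(\<lambda>x. x + of_int k) ` closed_segment s t = closed_segment (s + of_int k) (t + of_int k)"
    using affine_segment[of 1 "of_int k" s t] by simp
  show ?thesis
    using tied_transfer[where \<phi> = "\<lambda>x. x + of_int k" and g = height and h = height and A = 0 and B = 1, OF im]
      height_int by simp
qed

text \<open>The middle is higher than the tie, so all tied points are on the slopes, where they
  correspond to late minima of one height.\<close>

lemma finite_tied_JK:
  assumes lv: "level height s t" and st: "0 < s" "s < al" "be < t" "t < 1" and lt: "height s < 1"
  shows "finite (tied height s t)"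
proof -
  have ge: "height s \<le> height r" if "s \<le> r" "r \<le> t" for r
    using lv that st order by (auto simp: level_iff)
  let ?Z = "{r. late_min r \<and> stem r = height s}"
  let ?\<phi> = "\<lambda>x. 1 - u (F x - N)"
  have "inj_on u {0..al}" using u_mono by (rule strict_mono_on_imp_inj_on)
  then have 1: "finite (u -` ?Z \<inter> {0..al})" by (intro finite_vimage_IntI late_min_finite)
  have "inj_on ?\<phi> {be..1}"
  proof (rule inj_onI)
    fix x y assume xy: "x \<in> {be..1}" "y \<in> {be..1}" "?\<phi> x = ?\<phi> y"
    then have "F x - N = F y - N"
      using inj_onD[OF \<open>inj_on u {0..al}\<close>, of "F x - N" "F y - N"] F_K[of x] F_K[of y] by auto
    then show "x = y" using F_le_iff[of x y] F_le_iff[of y x] by auto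
  qed
  then have 2: "finite (?\<phi> -` ?Z \<inter> {be..1})" by (intro finite_vimage_IntI late_min_finite)
  have "tied height s t \<subseteq> (u -` ?Z \<inter> {0..al}) \<union> (?\<phi> -` ?Z \<inter> {be..1})"
  proof
    fix r assume "r \<in> tied height s t"
    then have r: "s \<le> r" "r \<le> t" "height r = height s"
      using st order by (auto simp: tied_def closed_segment_eq_real_ivl)
    have "r < al \<or> be < r"
    proof (rule ccontr)
      assume "\<not> (r < al \<or> be < r)"
      then show False using height_M_ge[of r] r lt by simp
    qed
    then show "r \<in> (u -` ?Z \<inter> {0..al}) \<union> (?\<phi> -` ?Z \<inter> {be..1})"
    proof
      assume "r < al"
      then have "late_min (u r)" using r st order ge by (intro late_min_J) auto
      then show ?thesis using height_J[of r] r \<open>r < al\<close> st by simp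
    next
      assume "be < r"
      then have "late_min (?\<phi> r)" using r st order ge by (intro late_min_K) auto
      then show ?thesis using height_K[of r] r \<open>be < r\<close> st by simp
    qed
  qed
  then show ?thesis using 1 2 finite_subset by blast
qed

lemma half_power_below: assumes "(d::real) > 0" obtains k where "(1/2) ^ k \<le> d"
  using real_arch_pow_inv[OF assms, of "1/2"] by (auto intro: less_imp_le)

text \<open>The predicate \<open>Q\<close> is any property that spreads backwards along the group generated by
  \<open>F\<close> and the unit translation.\<close>

lemma level_height_regular:
  assumes Q_int: "\<And>x k. Q (x + real_of_int k) \<Longrightarrow> Q x" and Q_F: "\<And>x. Q (F x) \<Longrightarrow> Q x"
    and Q_J: "\<And>x. 0 \<le> x \<Longrightarrow> x \<le> al \<Longrightarrow> u x \<in> digital \<Longrightarrow> Q x"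
    and lv: "level height s t" and neq: "s \<noteq> t"
  shows "Q s \<and> Q t \<and> finite (tied height s t)"
proof -
  have zero: "Q s \<and> Q t \<and> finite (tied height s t)"
    if lv: "level height s t" and lt: "s < t" and h0: "height s = 0" for s t
  proof -
    have Q0: "Q x" if hx: "height x = 0" for x
    proof -
      obtain i where "x = of_int i" using height_eq_0[OF hx] by (rule Ints_cases)
      moreover have "Q 0" using Q_J[of 0] order u_0 digital_of_int[of 0] by simp
      ultimately show ?thesis using Q_int[of x "- i"] by simp
    qed
    have "tied height s t \<subseteq> of_int ` {\<lfloor>s\<rfloor>..\<lceil>t\<rceil>}"
    proof
      fix r assume "r \<in> tied height s t"
      then have r: "s \<le> r" "r \<le> t" "height r = 0"
        using h0 lt by (auto simp: tied_def closed_segment_eq_real_ivl)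
      obtain i where "r = of_int i" using height_eq_0[OF r(3)] by (rule Ints_cases)
      then show "r \<in> of_int ` {\<lfloor>s\<rfloor>..\<lceil>t\<rceil>}" using r by (auto simp: floor_le_iff le_ceiling_iff)
    qed
    then have "finite (tied height s t)" by (rule finite_subset) auto
    then show ?thesis using Q0 h0 lv by (simp add: level_def)
  qed
  have main: "Q s \<and> Q t \<and> finite (tied height s t)"
    if "level height s t" "s < t" "(1/2) ^ k \<le> t - s" for s t k
    using that
  proof (induction k arbitrary: s t)
    case (0 s t)
    \<comment> \<open>A tie of length at least 1 does not fit strictly inside one period.\<close>
    have "height s = 0"
    proof (rule ccontr)
      assume "height s \<noteq> 0"
      then obtain k :: int where "0 < s + of_int k" "t + of_int k < 1"
        using level_no_int[of s t] 0 by auto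
      then show False using 0 by simp
    qed
    then show ?case using zero 0 by blast
  next
    case (Suc k s t)
    show ?case
    proof (cases "height s = 0")
      case True
      then show ?thesis using zero Suc.prems by blast
    next
      case False
      obtain i :: int where i: "0 < s + of_int i" "t + of_int i < 1"
        using level_no_int[OF Suc.prems(1) False] Suc.prems(2) by auto
      define s' t' where "s' = s + of_int i" and "t' = t + of_int i"
      have st: "0 < s'" "s' < t'" "t' < 1" using i Suc.prems(2) by (auto simp: s'_def t'_def)
      have lv': "level height s' t'" unfolding s'_def t'_def level_height_int by (rule Suc.prems(1))
      have "Q s' \<and> Q t' \<and> finite (tied height s' t')"
        using lv' st
      proof (cases rule: level_cases)
        case J
        have us: "u s' \<noteq> u t'" using u_less[of s' t'] st J by simp
        have "regular_pair (u s') (u t')"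
          using level_J(1)[of s' t'] lv' st J u_range[of s'] u_range[of t'] us
          by (intro level_stem_regular) auto
        moreover have "inj_on u (tied height s' t')"
          by (rule inj_on_subset[OF strict_mono_on_imp_inj_on[OF u_mono]])
            (use st J in \<open>auto simp: tied_def closed_segment_eq_real_ivl\<close>)
        ultimately show ?thesis
          using level_J(2)[of s' t'] st J Q_J[of s'] Q_J[of t'] finite_imageD[of u "tied height s' t'"]
          by (auto simp: regular_pair_def)
      next
        case K
        let ?\<phi> = "\<lambda>x. 1 - u (F x - N)"
        have F': "0 \<le> F x - N" "F x - N \<le> al" if "s' \<le> x" "x \<le> t'" for x
          using F_K[of x] that K st by auto
        have inj: "inj_on ?\<phi> (tied height s' t')"
        proof (rule inj_onI)
          fix x y assume xy: "x \<in> tied height s' t'" "y \<in> tied height s' t'" "?\<phi> x = ?\<phi> y"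
          then have "F x - N = F y - N"
            using inj_onD[OF strict_mono_on_imp_inj_on[OF u_mono], of "F x - N" "F y - N"] F'[of x] F'[of y] st
            by (auto simp: tied_def closed_segment_eq_real_ivl)
          then show "x = y" using F_le_iff[of x y] F_le_iff[of y x] by auto
        qed
        have "?\<phi> s' \<noteq> ?\<phi> t'" using inj_onD[OF inj, of s' t'] lv' st by (auto simp: tied_def level_def)
        then have reg: "regular_pair (?\<phi> s') (?\<phi> t')"
          using level_K(1)[of s' t'] lv' st K u_range[OF F'[of s']] u_range[OF F'[of t']]
          by (intro level_stem_regular) auto
        have Q': "Q x" if "?\<phi> x \<in> digital" "s' \<le> x" "x \<le> t'" for x
        proof -
          have "Q (F x - N)" using Q_J[of "F x - N"] F'[of x] digital_reverse that by auto
          then show ?thesis using Q_F[of x] Q_int[of "F x" "- int N"] by simp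
        qed
        have "finite (?\<phi> ` tied height s' t')"
          using level_K(2)[of s' t'] reg st K by (simp add: regular_pair_def)
        then have "finite (tied height s' t')" using inj finite_imageD by blast
        then show ?thesis using Q'[of s'] Q'[of t'] reg st by (simp add: regular_pair_def)
      next
        case M
        \<comment> \<open>In the middle \<open>F\<close> stretches the tie by at least 2, which is
          what the induction on \<open>k\<close> consumes.\<close>
        have "level height (F s') (F t')" using level_M(1)[of s' t'] lv' M st by simp
        moreover have "(1/2) ^ k \<le> F t' - F s'"
          using expand[of s' t'] M st Suc.prems(3) by (simp add: s'_def t'_def)
        ultimately have IH: "Q (F s') \<and> Q (F t') \<and> finite (tied height (F s') (F t'))"
          using st by (intro Suc.IH) auto
        moreover have "inj F" using F_mono by (rule strict_mono_imp_inj_on)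
        then have "inj_on F (tied height s' t')" by (rule inj_on_subset) simp
        moreover have "finite (F ` tied height s' t')" using IH level_M(2)[of s' t'] M st by simp
        ultimately have "finite (tied height s' t')" using finite_imageD by blast
        then show ?thesis using Q_F[of s'] Q_F[of t'] IH by simp
      next
        case JK
        have "Q s'" using Q_J[of s'] late_min_digital[OF JK(3)] JK st by simp
        moreover have "Q (F t' - N)"
          using Q_J[of "F t' - N"] F_K[of t'] digital_reverse[OF late_min_digital[OF JK(4)]] JK st by simp
        then have "Q t'" using Q_F[of t'] Q_int[of "F t'" "- int N"] by simp
        ultimately show ?thesis using finite_tied_JK[OF lv' st(1) JK(1,2) st(3) JK(5)] by blast
      qed
      note fin = this
      have "finite ((\<lambda>x. x + of_int i) ` tied height s t)"
        using fin tied_height_int[of s i t] by (simp add: s'_def t'_def)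
      moreover have "inj_on (\<lambda>x::real. x + of_int i) (tied height s t)" by (simp add: inj_on_def)
      ultimately have "finite (tied height s t)" using finite_imageD by blast
      then show ?thesis using fin Q_int[of s i] Q_int[of t i] by (simp add: s'_def t'_def)
    qed
  qed
  show ?thesis
  proof (cases "s < t")
    case True
    obtain k where "(1/2) ^ k \<le> t - s" using half_power_below[of "t - s"] True by auto
    then show ?thesis using main True lv by blast
  next
    case False
    then have "t < s" using neq by simp
    obtain k where "(1/2) ^ k \<le> s - t" using half_power_below[of "s - t"] \<open>t < s\<close> by auto
    then have "Q t \<and> Q s \<and> finite (tied height t s)" using main \<open>t < s\<close> lv level_sym by blast
    then show ?thesis using tied_commute[of height s t] lv by (simp add: level_def)
  qed
qed

lemma finite_tied: "level height s t \<Longrightarrow> finite (tied height s t)"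
  using level_height_regular[of "\<lambda>_. True" s t] by (cases "s = t") (auto simp: tied_def)

text \<open>A tied point strictly inside the rising slope has positive height, so its partner is in
  the same period, either on the same slope or across the middle. Both cases determine the digits of
  \<open>u x\<close>.\<close>

lemma level_J_digital:
  assumes x: "0 \<le> x" "x \<le> al" and lv: "level height x y" and neq: "x \<noteq> y"
  shows "u x \<in> digital"
proof -
  consider "x = 0" | "x = al" | "0 < x" "x < al" using x by linarith
  then show ?thesis
  proof cases
    case 1 then show ?thesis using u_0 digital_of_int[of 0] by simp
  next
    case 2 then show ?thesis using u_al digital_of_int[of 1] by simp
  next
    case 3
    have hx: "height x \<noteq> 0" using height_pos[of x] 3 order by simp
    then have hy: "height y \<noteq> 0" using lv by (simp add: level_def)
    show ?thesis
    proof (cases "x < y")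
      case True
      obtain k :: int where k: "0 < x + of_int k" "y + of_int k < 1" using level_no_int[OF lv hx] True by auto
      have "of_int k > (-1::real)" "of_int k < (1::real)" using k 3 order True by linarith+
      then have "k = 0" by linarith
      then have y: "y < 1" using k by simp
      from lv 3(1) True y show ?thesis
      proof (cases rule: level_cases)
        case J
        have "regular_pair (u x) (u y)"
          using level_J(1)[of x y] lv J True x u_range[of x] u_range[of y] u_less[of x y]
          by (intro level_stem_regular) auto
        then show ?thesis by (simp add: regular_pair_def)
      next
        case JK
        then show ?thesis using late_min_digital by blast
      qed (use 3 order in auto)
    next
      case False
      then have yx: "y < x" using neq by simp
      have lv': "level height y x" using lv level_sym by blast
      obtain k :: int where k: "0 < y + of_int k" "x + of_int k < 1" using level_no_int[OF lv' hy] yx by auto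
      have "of_int k > (-1::real)" "of_int k < (1::real)" using k 3 order yx by linarith+
      then have "k = 0" by linarith
      then have y: "0 < y" "x < 1" using k by simp_all
      from lv' y(1) yx y(2) show ?thesis
      proof (cases rule: level_cases)
        case J
        have "regular_pair (u y) (u x)"
          using level_J(1)[of y x] lv' J yx y x u_range[of x] u_range[of y] u_less[of y x]
          by (intro level_stem_regular) auto
        then show ?thesis by (simp add: regular_pair_def)
      qed (use 3 order yx in auto)
    qed
  qed
qed

end

section \<open>Circle homeomorphisms\<close>

text \<open>Only values on the circle occur, so the notion is the same for a map and for its
  restriction with \<open>undefined\<close> elsewhere. The equivalences ensure that leaves also come
  from leaves.\<close>

definition preserves :: "(real \<Rightarrow> real) \<Rightarrow> (complex \<Rightarrow> complex) \<Rightarrow> bool"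
  where "preserves f g \<longleftrightarrow> bij_betw g S1 S1
    \<and> (\<forall>x\<in>S1. \<forall>y\<in>S1. crel f (g x) (g y) \<longleftrightarrow> crel f x y)
    \<and> (\<forall>w\<in>S1. \<forall>v\<in>S1. \<forall>x\<in>S1. \<forall>y\<in>S1. sep (g w) (g v) (g x) (g y) \<longleftrightarrow> sep w v x y)"

lemma preserves_mem: "preserves f g \<Longrightarrow> x \<in> S1 \<Longrightarrow> g x \<in> S1"
  unfolding preserves_def by (meson bij_betwE)

lemma preserves_restrict_iff: "preserves f (restrict g S1) \<longleftrightarrow> preserves f g"
proof -
  have "bij_betw (restrict g S1) S1 S1 \<longleftrightarrow> bij_betw g S1 S1" by (rule bij_betw_cong) simp
  then show ?thesis by (simp add: preserves_def)
qed

lemma preserves_id: "preserves f (\<lambda>x\<in>S1. x)"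
  unfolding preserves_restrict_iff by (simp add: preserves_def bij_betw_def)

lemma preserves_compose:
  assumes g: "preserves f g" and h: "preserves f h" shows "preserves f (compose S1 g h)"
proof -
  have "bij_betw (g \<circ> h) S1 S1" using g h unfolding preserves_def by (blast intro: bij_betw_trans)
  then have "preserves f (g \<circ> h)"
    using g h preserves_mem[OF h] unfolding preserves_def by simp
  then show ?thesis using preserves_restrict_iff[of f "g \<circ> h"] by (simp add: compose_def o_def restrict_def)
qed

lemma preserves_edge:
  assumes g: "preserves f g" and xy: "x \<in> S1" "y \<in> S1"
  shows "edge f (g x) (g y) \<longleftrightarrow> edge f x y"
proof -
  have inj: "g x = g y \<longleftrightarrow> x = y"
    using g xy unfolding preserves_def by (meson bij_betw_imp_inj_on inj_on_eq_iff)
  have surj: "\<exists>w\<in>S1. z = g w" if "z \<in> S1" for z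
    using g that unfolding preserves_def bij_betw_def by blast
  have crel: "crel f (g a) (g b) \<longleftrightarrow> crel f a b" if "a \<in> S1" "b \<in> S1" for a b
    using g that unfolding preserves_def by blast
  have sep: "sep (g a) (g b) (g x) (g y) \<longleftrightarrow> sep a b x y" if "a \<in> S1" "b \<in> S1" for a b
    using g that xy unfolding preserves_def by blast
  have "(\<forall>w v. crel f w v \<longrightarrow> \<not> sep w v (g x) (g y)) \<longleftrightarrow> (\<forall>w v. crel f w v \<longrightarrow> \<not> sep w v x y)"
  proof
    assume L: "\<forall>w v. crel f w v \<longrightarrow> \<not> sep w v (g x) (g y)"
    show "\<forall>w v. crel f w v \<longrightarrow> \<not> sep w v x y"
    proof (intro allI impI)
      fix w v assume "crel f w v"
      then have "w \<in> S1" "v \<in> S1" "crel f w v" using crel_S1 by auto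
      then show "\<not> sep w v x y" using L crel[of w v] sep[of w v] by blast
    qed
  next
    assume R: "\<forall>w v. crel f w v \<longrightarrow> \<not> sep w v x y"
    show "\<forall>w v. crel f w v \<longrightarrow> \<not> sep w v (g x) (g y)"
    proof (intro allI impI)
      fix w v assume wv: "crel f w v"
      then have "w \<in> S1" "v \<in> S1" using crel_S1 by auto
      then obtain w' v' where "w' \<in> S1" "v' \<in> S1" "w = g w'" "v = g v'" using surj by metis
      then show "\<not> sep w v (g x) (g y)" using R wv crel[of w' v'] sep[of w' v'] by blast
    qed
  qed
  then show ?thesis unfolding edge_def inj crel[OF xy] by blast
qed

lemma preserves_lam:
  assumes g: "preserves f g" shows "(\<lambda>l. g ` l) ` lam f = lam f"
proof (intro antisym subsetI)
  fix l assume "l \<in> (\<lambda>l. g ` l) ` lam f"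
  then obtain x y where "l = {g x, g y}" "edge f x y" by (auto simp: lam_def)
  then show "l \<in> lam f" using preserves_edge[OF g] edge_S1 by (metis lam_iff)
next
  fix l assume "l \<in> lam f"
  then obtain x y where l: "l = {x, y}" "edge f x y" by (rule lamE)
  then have "x \<in> S1" "y \<in> S1" using edge_S1 by blast+
  then obtain x' y' where *: "x' \<in> S1" "y' \<in> S1" "x = g x'" "y = g y'"
    using g unfolding preserves_def bij_betw_def by (metis imageE)
  then have "{x', y'} \<in> lam f" using preserves_edge[OF g, of x' y'] l by (simp add: lam_iff)
  moreover have "l = g ` {x', y'}" using l * by simp
  ultimately show "l \<in> (\<lambda>l. g ` l) ` lam f" by blast
qed

lemma sgn_side_lift:
  assumes lift: "\<And>t. g (cis t) = cis (G t)" and G: "strict_mono G" "\<And>t. G (t + 2 * pi) = G t + 2 * pi"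
    and S: "w \<in> S1" "v \<in> S1" "x \<in> S1"
  shows "sgn (side (g w) (g v) (g x)) = sgn (side w v x)"
proof -
  obtain s where s: "w = cis s" using S1_cis S by blast
  obtain t where t: "v = cis t" "s \<le> t" "t < s + 2 * pi" using S1_lift S by blast
  obtain r where r: "x = cis r" "s \<le> r" "r < s + 2 * pi" using S1_lift S by blast
  have le: "G a \<le> G b \<longleftrightarrow> a \<le> b" and less: "G a < G b \<longleftrightarrow> a < b" for a b
    using G(1) by (simp_all add: strict_mono_less_eq strict_mono_less)
  have "sgn (side (cis (G s)) (cis (G t)) (cis (G r))) = (if G s < G t \<and> G t < G r then 1 else if G s < G r \<and> G r < G t then -1 else 0)"
    using t r by (intro sgn_side_cis) (simp_all add: le less flip: G(2))
  also have "\<dots> = sgn (side (cis s) (cis t) (cis r))"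
    unfolding less using t r by (subst sgn_side_cis) auto
  finally show ?thesis by (simp add: s t r lift)
qed

lemma sep_sgn: "sep w v x y \<longleftrightarrow> sgn (side w v x) * sgn (side w v y) = -1"
  by (auto simp: sep_def sgn_if mult_less_0_iff)

lemma (in circle_height) crel_lift:
  assumes lift: "\<And>t. g (cis t) = cis (G t)"
    and lev: "\<And>s t. level f s t \<Longrightarrow> \<exists>k::int. level f (G s) (G t + 2 * pi * of_int k)"
    and "crel f x y"
  shows "crel f (g x) (g y)"
proof -
  obtain s t where st: "x = cis s" "y = cis t" "level f s t" using assms(3) by (auto simp: crel_def)
  then obtain k :: int where "level f (G s) (G t + 2 * pi * of_int k)" using lev by blast
  then show ?thesis unfolding st lift crel_cis_iff by (intro exI[of _ "G t + 2 * pi * of_int k"]) simp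
qed

lemma (in circle_height) preservesI:
  assumes inv: "\<And>x. x \<in> S1 \<Longrightarrow> g x \<in> S1 \<and> h (g x) = x" "\<And>x. x \<in> S1 \<Longrightarrow> h x \<in> S1 \<and> g (h x) = x"
    and g: "\<And>t. g (cis t) = cis (G t)" "strict_mono G" "\<And>t. G (t + 2 * pi) = G t + 2 * pi"
    and rel: "\<And>x y. crel f x y \<Longrightarrow> crel f (g x) (g y)" "\<And>x y. crel f x y \<Longrightarrow> crel f (h x) (h y)"
  shows "preserves f g"
  unfolding preserves_def
proof (intro conjI ballI)
  show "bij_betw g S1 S1" by (rule bij_betwI[of g _ _ h]) (use inv in auto)
  fix x y assume xy: "x \<in> S1" "y \<in> S1"
  show "crel f (g x) (g y) \<longleftrightarrow> crel f x y"
    using rel(1)[of x y] rel(2)[of "g x" "g y"] inv xy by auto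
next
  fix w v x y assume "w \<in> S1" "v \<in> S1" "x \<in> S1" "y \<in> S1"
  then show "sep (g w) (g v) (g x) (g y) \<longleftrightarrow> sep w v x y"
    unfolding sep_sgn using sgn_side_lift[OF g] by simp
qed

text \<open>The angle with strip coordinate \<open>x\<close> is \<open>a + 2 * pi / N * x\<close>;
  in angles the map \<open>F\<close> of the strip becomes \<open>G\<close>.\<close>

locale circle_strip = strip +
  fixes a :: real and G :: "real \<Rightarrow> real"
  assumes G_F: "G (a + 2 * pi / N * x) = a + 2 * pi / N * F x"
begin

definition circ :: "real \<Rightarrow> real"
  where "circ \<theta> = height ((\<theta> - a) * (N / (2 * pi)))"

definition coord :: "real \<Rightarrow> real"
  where "coord \<theta> = (\<theta> - a) * (N / (2 * pi))"

lemma N_pos: "real N > 0" using N by simp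

lemma coord_inverse: "a + 2 * pi / N * coord \<theta> = \<theta>"
proof -
  have "2 * pi / N * coord \<theta> = (2 * pi / N * (N / (2 * pi))) * (\<theta> - a)" by (simp only: coord_def mult_ac)
  moreover have "2 * pi / N * (N / (2 * pi)) = 1" using N_pos by simp
  ultimately show ?thesis by (simp only:) simp
qed

lemma coord_add: "coord (\<theta> + 2 * pi / N * r) = coord \<theta> + r"
  using N_pos by (simp add: coord_def field_simps)

lemma coord_G: "coord (G \<theta>) = F (coord \<theta>)"
proof -
  have "G \<theta> = a + 2 * pi / N * F (coord \<theta>)" using G_F[of "coord \<theta>"] by (simp only: coord_inverse)
  then show ?thesis using N_pos by (simp add: coord_def)
qed

lemma circ_coord: "circ \<theta> = height (coord \<theta>)" by (simp add: circ_def coord_def)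

lemma coord_affine: "coord \<theta> = (N / (2 * pi)) * \<theta> + - a * (N / (2 * pi))"
proof -
  have "(\<theta> - a) * k = k * \<theta> + - a * k" for k by (simp add: algebra_simps)
  then show ?thesis unfolding coord_def .
qed

lemma coord_segment: "coord ` closed_segment s t = closed_segment (coord s) (coord t)"
  unfolding coord_affine by (rule affine_segment)

lemma coord_eq_iff: "coord s = coord t \<longleftrightarrow> s = t"
  by (metis coord_inverse)

lemma level_circ: "level circ s t \<longleftrightarrow> level height (coord s) (coord t)"
  using level_transfer[where \<phi> = coord and g = circ and h = height and A = 0 and B = 1, OF coord_segment]
  by (simp add: circ_coord)

lemma tied_circ: "tied height (coord s) (coord t) = coord ` tied circ s t"
  using tied_transfer[where \<phi> = coord and g = circ and h = height and A = 0 and B = 1, OF coord_segment]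
  by (simp add: circ_coord)

lemma coord_turn: "coord (\<theta> + 2 * pi * of_int k) = coord \<theta> + real N * of_int k"
proof -
  have "2 * pi / N * (real N * of_int k) = 2 * pi * of_int k" using N_pos by simp
  then show ?thesis using coord_add[of \<theta> "real N * of_int k"] by (simp only:)
qed

sublocale circ: circle_height circ
proof
  show "continuous_on UNIV circ"
    unfolding circ_def[abs_def] by (intro continuous_on_compose2[OF height_cont] continuous_intros) auto
  show "circ (t + 2 * pi) = circ t" for t
    using coord_turn[of t 1] height_nat(1)[of "coord t" N] by (simp add: circ_coord)
qed

sublocale circ: finite_circle_height circ
proof
  fix z :: complex assume "z \<in> S1"
  then obtain s where z: "z = cis s" using S1_cis by blast
  have "finite (tied circ s t)" if "level circ s t" for t
  proof -
    have "finite (coord ` tied circ s t)" using finite_tied that by (simp add: level_circ flip: tied_circ)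
    moreover have "inj_on coord (tied circ s t)" by (simp add: inj_on_def coord_eq_iff)
    ultimately show ?thesis using finite_imageD by blast
  qed
  then show "finite (cls circ z)" unfolding z by (rule circ.finite_clsI)
qed

lemma level_circ_G:
  assumes "level circ s t" shows "\<exists>k::int. level circ (G s) (G t + 2 * pi * of_int k)"
  using level_F[of "coord s" "coord t"] assms by (simp add: level_circ coord_turn coord_G)

lemma level_circ_rotate:
  "level circ (s + 2 * pi / N * of_int k) (t + 2 * pi / N * of_int k) \<longleftrightarrow> level circ s t"
  unfolding level_circ coord_add level_height_int ..

end

section \<open>Moebius involutions\<close>

text \<open>For \<open>0 < c < 1\<close> this is the half-turn of the hyperbolic disk that exchanges
  0 and \<open>c\<close>.\<close>

definition flip :: "real \<Rightarrow> complex \<Rightarrow> complex"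
  where "flip c z = (c - z) / (1 - c * z)"

text \<open>On the circle \<open>flip c z\<close> is \<open>- z\<close> times the conjugate of
  \<open>1 - c * z\<close> divided by \<open>1 - c * z\<close>. The arctangent is the argument of
  that conjugate, whose real part is positive when \<open>0 < c < 1\<close>.\<close>

definition flip_lift :: "real \<Rightarrow> real \<Rightarrow> real"
  where "flip_lift c t = t + pi + 2 * arctan (c * sin t / (1 - c * cos t))"

lemma cis_double_arctan: "cis (2 * arctan q) = (1 + \<i> * q) / (1 - \<i> * q)"
proof -
  have q: "1 + q\<^sup>2 > 0" by (simp add: add_pos_nonneg)
  have ne: "1 - \<i> * complex_of_real q \<noteq> 0" by (simp add: complex_eq_iff)
  have r: "sqrt (1 + q\<^sup>2) * sqrt (1 + q\<^sup>2) = 1 + q\<^sup>2" using q by simp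
  have "cis (2 * arctan q) = cis (arctan q) * cis (arctan q)" by (simp add: cis_mult)
  also have "cis (arctan q) = (1 + \<i> * q) / complex_of_real (sqrt (1 + q\<^sup>2))"
    by (simp add: complex_eq_iff cos_arctan sin_arctan Re_divide_of_real Im_divide_of_real)
  also have "\<dots> * \<dots> = (1 + \<i> * q) * (1 + \<i> * q) / complex_of_real (1 + q\<^sup>2)"
    unfolding times_divide_times_eq of_real_mult[symmetric] r ..
  also have "complex_of_real (1 + q\<^sup>2) = (1 + \<i> * q) * (1 - \<i> * q)"
    by (simp add: complex_eq_iff power2_eq_square)
  also have "(1 + \<i> * q) * (1 + \<i> * q) / ((1 + \<i> * q) * (1 - \<i> * q)) = (1 + \<i> * q) / (1 - \<i> * q)"
  proof -
    have "1 + \<i> * complex_of_real q \<noteq> 0" by (simp add: complex_eq_iff)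
    then show ?thesis by simp
  qed
  finally show ?thesis .
qed

locale mobius_flip =
  fixes c :: real assumes c: "0 < c" "c < 1"
begin

lemma denom_pos: "0 < 1 - c * cos t"
proof -
  have "c * cos t \<le> c * 1" using c by (intro mult_left_mono) auto
  then show ?thesis using c by linarith
qed

lemma flip_denom: "cmod z = 1 \<Longrightarrow> 1 - complex_of_real c * z \<noteq> 0"
proof
  assume "cmod z = 1" "1 - complex_of_real c * z = 0"
  then have "cmod (complex_of_real c * z) = 1" by (metis eq_iff_diff_eq_0 norm_one)
  then show False using c \<open>cmod z = 1\<close> by (simp add: norm_mult)
qed

lemma flip_cis: "flip c (cis t) = cis (flip_lift c t)"
proof -
  define p where "p = 1 - c * cos t"
  define s where "s = c * sin t"
  have p: "p > 0" using denom_pos by (simp add: p_def)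
  have w: "1 - c * cis t = p - \<i> * s" "1 - c * cis (- t) = p + \<i> * s"
    by (simp_all add: complex_eq_iff p_def s_def)
  have ne: "p - \<i> * s \<noteq> 0" using p by (simp add: complex_eq_iff)
  have "cis (2 * arctan (s / p)) = (p + \<i> * s) / (p - \<i> * s)"
  proof -
    have "1 + \<i> * complex_of_real (s / p) = (p + \<i> * s) / p" "1 - \<i> * complex_of_real (s / p) = (p - \<i> * s) / p"
      using p by (simp_all add: field_simps)
    then show ?thesis unfolding cis_double_arctan using p by simp
  qed
  then have "cis (flip_lift c t) = - cis t * ((p + \<i> * s) / (p - \<i> * s))"
    by (simp add: flip_lift_def p_def s_def flip: cis_mult)
  also have "\<dots> = (c - cis t) / (1 - c * cis t)"
  proof -
    have "- cis t * (p + \<i> * s) = c - cis t"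
      unfolding w(2)[symmetric] by (simp add: algebra_simps cis_mult)
    then show ?thesis unfolding w(1) by simp
  qed
  finally show ?thesis by (simp add: flip_def)
qed

lemma flip_S1: "z \<in> S1 \<Longrightarrow> flip c z \<in> S1"
  using S1_cis flip_cis by (metis cis_in_S1)

lemma flip_flip: assumes "z \<in> S1" shows "flip c (flip c z) = z"
proof -
  have d: "1 - c * z \<noteq> 0" using flip_denom assms by simp
  have cc: "complex_of_real c * complex_of_real c \<noteq> 1"
  proof
    assume "complex_of_real c * complex_of_real c = 1"
    then have "c * c = 1" by (metis of_real_1 of_real_eq_iff of_real_mult)
    then show False using c by (metis mult_less_cancel_left_pos mult.right_neutral less_trans less_irrefl)
  qed
  have num: "c - (c - z) / (1 - c * z) = z * (1 - c * c) / (1 - c * z)" using d by (simp add: field_simps)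
  have den: "1 - c * ((c - z) / (1 - c * z)) = (1 - c * c) / (1 - c * z)" using d by (simp add: field_simps)
  show ?thesis unfolding flip_def num den using d cc by simp
qed

lemma flip_lift_turn: "flip_lift c (t + 2 * pi) = flip_lift c t + 2 * pi"
  by (simp add: flip_lift_def)

lemma flip_lift_uminus: "flip_lift c (- t) = 2 * pi - flip_lift c t"
  by (simp add: flip_lift_def arctan_minus minus_divide_left[symmetric])

text \<open>The derivative is the Poisson kernel: for \<open>c\<close> near 1 it is large near angle
  0 and small away from it, which yields both expansion and contraction.\<close>

lemma flip_lift_deriv:
  "(flip_lift c has_real_derivative (1 - c\<^sup>2) / (1 - 2 * c * cos t + c\<^sup>2)) (at t)"
proof -
  define p where "p = 1 - c * cos t"
  define s where "s = c * sin t"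
  have p: "p > 0" using denom_pos by (simp add: p_def)
  have D: "p\<^sup>2 + s\<^sup>2 = 1 - 2 * c * cos t + c\<^sup>2"
    unfolding p_def s_def power_mult_distrib sin_squared_eq by (simp add: power2_eq_square algebra_simps)
  have Dpos: "p\<^sup>2 + s\<^sup>2 > 0" using p by (simp add: add_pos_nonneg)
  have d: "(flip_lift c has_real_derivative 1 + 2 * (inverse (1 + (s / p)\<^sup>2) * ((c * cos t * p - s * s) / (p * p)))) (at t)"
    unfolding flip_lift_def[abs_def] p_def s_def
    by (rule derivative_eq_intros refl | use denom_pos[of t] in \<open>simp add: algebra_simps\<close>)+
  have e1: "inverse (1 + (s / p)\<^sup>2) * ((c * cos t * p - s * s) / (p * p)) = (c * cos t * p - s * s) / (p\<^sup>2 + s\<^sup>2)"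
  proof -
    have "1 + (s / p)\<^sup>2 = (p\<^sup>2 + s\<^sup>2) / p\<^sup>2" using p by (simp add: field_simps power2_eq_square)
    then show ?thesis using p Dpos by (simp add: power2_eq_square)
  qed
  have e2: "c * cos t * p - s * s = c * cos t - c\<^sup>2"
    unfolding p_def s_def power2_eq_square[symmetric] power_mult_distrib sin_squared_eq
    by (simp add: power2_eq_square algebra_simps)
  have e3: "1 + 2 * ((c * cos t - c\<^sup>2) / (p\<^sup>2 + s\<^sup>2)) = (1 - c\<^sup>2) / (1 - 2 * c * cos t + c\<^sup>2)"
  proof -
    have "1 + 2 * ((c * cos t - c\<^sup>2) / (p\<^sup>2 + s\<^sup>2)) = (p\<^sup>2 + s\<^sup>2 + 2 * (c * cos t - c\<^sup>2)) / (p\<^sup>2 + s\<^sup>2)"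
      using p Dpos by (simp add: add_divide_distrib)
    then show ?thesis unfolding D by simp
  qed
  show ?thesis using d[unfolded e1, unfolded e2, unfolded e3] .
qed

lemma deriv_denom: "1 - 2 * c * cos t + c\<^sup>2 = (1 - c)\<^sup>2 + 2 * c * (1 - cos t)"
  by (simp add: power2_eq_square algebra_simps)

lemma deriv_denom_pos: "1 - 2 * c * cos t + c\<^sup>2 > 0"
  unfolding deriv_denom using c by (intro add_pos_nonneg) auto

lemma one_minus_c2: "1 - c\<^sup>2 > 0"
  using c by (simp add: power_less_one_iff abs_square_less_1)

lemma flip_lift_mono: "strict_mono (flip_lift c)"
proof (rule strict_monoI)
  fix x y :: real assume "x < y"
  then show "flip_lift c x < flip_lift c y"
    by (rule DERIV_pos_imp_increasing)
      (use flip_lift_deriv deriv_denom_pos one_minus_c2 in \<open>blast intro: divide_pos_pos\<close>)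
qed

lemma flip_lift_cont: "continuous_on A (flip_lift c)"
  using flip_lift_deriv by (meson DERIV_isCont continuous_at_imp_continuous_on)

text \<open>Two applications differ from the identity by a multiple of \<open>2 * pi\<close> that is
  constant by continuity. It is one turn, since 0 is lifted to \<open>pi\<close> and
  \<open>pi\<close> to \<open>2 * pi\<close>.\<close>

lemma flip_lift_involution: "flip_lift c (flip_lift c t) = t + 2 * pi"
proof -
  let ?h = "\<lambda>t. (flip_lift c (flip_lift c t) - t) / (2 * pi)"
  have int: "\<exists>k::int. ?h t = k" for t
  proof -
    have "cis (flip_lift c (flip_lift c t)) = cis t"
      using flip_flip[of "cis t"] by (simp add: flip_cis)
    then obtain k :: int where "flip_lift c (flip_lift c t) = t + 2 * pi * k" using cis_eq_iff by blast
    then show ?thesis by (intro exI[of _ k]) simp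
  qed
  have "?h constant_on UNIV"
  proof (rule continuous_discrete_range_constant)
    show "continuous_on UNIV ?h"
      by (intro continuous_intros continuous_on_compose2[OF flip_lift_cont[of UNIV]] flip_lift_cont) auto
    fix x :: real
    have "1 \<le> norm (?h y - ?h x)" if ne: "?h y \<noteq> ?h x" for y
    proof -
      obtain k l :: int where kl: "?h y = k" "?h x = l" using int by metis
      then have "k \<noteq> l" using ne by auto
      then have "1 \<le> \<bar>real_of_int k - real_of_int l\<bar>" by linarith
      then show ?thesis unfolding kl by simp
    qed
    then show "\<exists>e>0. \<forall>y. y \<in> UNIV \<and> ?h y \<noteq> ?h x \<longrightarrow> e \<le> norm (?h y - ?h x)"
      by (intro exI[of _ 1]) auto
  qed simp
  moreover have "?h 0 = 1" by (simp add: flip_lift_def)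
  ultimately have "?h t = 1" unfolding constant_on_def by (metis UNIV_I)
  then show ?thesis by (simp add: field_simps)
qed

end

text \<open>For \<open>c\<close> close to \<open>1\<close> the involution moves everything far from \<open>1\<close> close to \<open>1\<close>.\<close>

lemma mobius_flip_exists:
  fixes \<eta> :: real
  assumes \<eta>: "0 < \<eta>" "\<eta> \<le> pi / 2"
  obtains c \<epsilon> where "mobius_flip c" "0 < \<epsilon>" "\<epsilon> < \<eta> / 2" "flip_lift c \<eta> = 2 * pi - \<epsilon>"
    "\<And>x y. - \<epsilon> \<le> x \<Longrightarrow> x \<le> y \<Longrightarrow> y \<le> \<epsilon> \<Longrightarrow> 2 * (y - x) \<le> flip_lift c y - flip_lift c x"
proof -
  define \<kappa> where "\<kappa> = 1 - cos \<eta>"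
  have \<kappa>: "\<kappa> > 0" using \<eta> cos_monotone_0_pi[of 0 \<eta>] by (simp add: \<kappa>_def)
  \<comment> \<open>With \<open>\<epsilon> \<le> 2 * pi * \<delta> / \<kappa>\<close> the
    denominator of the derivative is at most \<open>\<delta>\<^sup>2 * M\<close> for angles up to
    \<open>\<epsilon>\<close>, while the numerator is at least \<open>\<delta>\<close>.\<close>
  define M where "M = 1 + 4 * pi\<^sup>2 / \<kappa>\<^sup>2"
  have M: "M \<ge> 1" by (simp add: M_def)
  \<comment> \<open>The three bounds give \<open>c \<ge> 1/2\<close>, a derivative of at least 2
    near angle 0, and \<open>\<epsilon> \<le> \<eta> / 4\<close>.\<close>
  define \<delta> where "\<delta> = min (1/2) (min (1 / (2 * M)) (\<eta> * \<kappa> / (8 * pi)))"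
  have \<delta>: "\<delta> > 0" "\<delta> \<le> 1/2" "\<delta> \<le> 1 / (2 * M)" "\<delta> \<le> \<eta> * \<kappa> / (8 * pi)"
    using \<eta> \<kappa> M by (auto simp: \<delta>_def)
  define c where "c = 1 - \<delta>"
  interpret mobius_flip c by unfold_locales (use \<delta> in \<open>auto simp: c_def\<close>)
  have num: "1 - c\<^sup>2 = \<delta> * (2 - \<delta>)" by (simp add: c_def power2_eq_square algebra_simps)
  have num_bounds: "\<delta> \<le> 1 - c\<^sup>2" "1 - c\<^sup>2 \<le> 2 * \<delta>" unfolding num using \<delta> by (auto simp: mult_left_mono)
  define \<epsilon> where "\<epsilon> = 2 * pi - flip_lift c \<eta>"
  have lift_pi: "flip_lift c pi = 2 * pi" by (simp add: flip_lift_def)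
  have "\<eta> < pi" using \<eta> pi_gt_zero by linarith
  then have "\<epsilon> > 0" using flip_lift_mono lift_pi by (simp add: \<epsilon>_def strict_mono_def flip: lift_pi)
  have "\<epsilon> \<le> 2 * pi * \<delta> / \<kappa>"
  proof -
    obtain z where z: "\<eta> < z" "z < pi" "flip_lift c pi - flip_lift c \<eta> = (pi - \<eta>) * ((1 - c\<^sup>2) / (1 - 2 * c * cos z + c\<^sup>2))"
      using MVT2[OF \<open>\<eta> < pi\<close>, of "flip_lift c" "\<lambda>t. (1 - c\<^sup>2) / (1 - 2 * c * cos t + c\<^sup>2)"] flip_lift_deriv by blast
    have "cos z \<le> cos \<eta>" using z \<eta> by (intro cos_monotone_0_pi_le) auto
    then have "\<kappa> \<le> 2 * c * (1 - cos z)"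
    proof -
      have "1 * (1 - cos z) \<le> 2 * c * (1 - cos z)" using \<delta> by (intro mult_right_mono) (auto simp: c_def)
      then show ?thesis using \<open>cos z \<le> cos \<eta>\<close> by (simp add: \<kappa>_def)
    qed
    then have "\<kappa> \<le> 1 - 2 * c * cos z + c\<^sup>2" unfolding deriv_denom using zero_le_power2[of "1 - c"] by linarith
    then have "(1 - c\<^sup>2) / (1 - 2 * c * cos z + c\<^sup>2) \<le> 2 * \<delta> / \<kappa>"
      using num_bounds \<kappa> \<delta> by (intro frac_le) auto
    moreover have "0 \<le> 2 * \<delta> / \<kappa>" using \<delta> \<kappa> by simp
    ultimately have "(pi - \<eta>) * ((1 - c\<^sup>2) / (1 - 2 * c * cos z + c\<^sup>2)) \<le> pi * (2 * \<delta> / \<kappa>)"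
      using \<eta> \<open>\<eta> < pi\<close> one_minus_c2 deriv_denom_pos[of z] by (intro mult_mono) auto
    moreover have "\<epsilon> = (pi - \<eta>) * ((1 - c\<^sup>2) / (1 - 2 * c * cos z + c\<^sup>2))"
      unfolding \<epsilon>_def z(3)[symmetric] lift_pi ..
    ultimately have "\<epsilon> \<le> pi * (2 * \<delta> / \<kappa>)" by (simp only:)
    moreover have "pi * (2 * \<delta> / \<kappa>) = 2 * pi * \<delta> / \<kappa>" by simp
    ultimately show ?thesis by (simp only:)
  qed
  then have \<epsilon>_small: "\<epsilon> < \<eta> / 2"
  proof -
    have "2 * pi * \<delta> / \<kappa> \<le> 2 * pi * (\<eta> * \<kappa> / (8 * pi)) / \<kappa>"
      using \<delta> \<kappa> by (intro divide_right_mono mult_left_mono) auto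
    also have "\<dots> = \<eta> / 4" using \<kappa> by simp
    finally show ?thesis using \<open>\<epsilon> \<le> 2 * pi * \<delta> / \<kappa>\<close> \<eta> by simp
  qed
  have big: "2 \<le> (1 - c\<^sup>2) / (1 - 2 * c * cos t + c\<^sup>2)" if t: "- \<epsilon> \<le> t" "t \<le> \<epsilon>" for t
  proof -
    have "1 - cos t = 2 * (sin (t / 2))\<^sup>2" using cos_double_sin[of "t / 2"] by simp
    also have "\<dots> \<le> 2 * (t / 2)\<^sup>2"
      using abs_sin_x_le_abs_x[of "t / 2"] unfolding abs_le_square_iff by simp
    finally have "1 - cos t \<le> t\<^sup>2 / 2" by (simp add: power_divide)
    also have "t\<^sup>2 / 2 \<le> \<epsilon>\<^sup>2 / 2" using t by (simp add: abs_le_square_iff[symmetric])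
    finally have "2 * c * (1 - cos t) \<le> 2 * 1 * (\<epsilon>\<^sup>2 / 2)" using c by (intro mult_mono) auto
    then have "1 - 2 * c * cos t + c\<^sup>2 \<le> \<delta>\<^sup>2 + \<epsilon>\<^sup>2" unfolding deriv_denom by (simp add: c_def)
    also have "\<epsilon>\<^sup>2 \<le> (2 * pi * \<delta> / \<kappa>)\<^sup>2" using \<open>\<epsilon> \<le> 2 * pi * \<delta> / \<kappa>\<close> \<open>\<epsilon> > 0\<close> by (intro power_mono) auto
    also have "\<delta>\<^sup>2 + (2 * pi * \<delta> / \<kappa>)\<^sup>2 = \<delta> * (\<delta> * M)"
      using \<kappa> by (simp add: M_def power2_eq_square field_simps)
    also have "\<delta> * (\<delta> * M) \<le> \<delta> * (1 / (2 * M) * M)" using \<delta> M by (intro mult_left_mono mult_right_mono) auto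
    also have "\<dots> = \<delta> / 2" using M by simp
    finally have "2 * (1 - 2 * c * cos t + c\<^sup>2) \<le> 1 - c\<^sup>2" using num_bounds by simp
    then show ?thesis using deriv_denom_pos[of t] by (simp add: pos_le_divide_eq)
  qed
  have "2 * (y - x) \<le> flip_lift c y - flip_lift c x" if xy: "- \<epsilon> \<le> x" "x \<le> y" "y \<le> \<epsilon>" for x y
  proof (cases "x = y")
    case False
    then have "x < y" using xy by simp
    then obtain z where z: "x < z" "z < y" "flip_lift c y - flip_lift c x = (y - x) * ((1 - c\<^sup>2) / (1 - 2 * c * cos z + c\<^sup>2))"
      using MVT2[of x y "flip_lift c" "\<lambda>t. (1 - c\<^sup>2) / (1 - 2 * c * cos t + c\<^sup>2)"] flip_lift_deriv by blast
    then show ?thesis using mult_left_mono[OF big[of z], of "y - x"] xy by simp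
  qed simp
  moreover have "flip_lift c \<eta> = 2 * pi - \<epsilon>" by (simp add: \<epsilon>_def)
  ultimately show ?thesis
    using that[OF mobius_flip_axioms \<open>\<epsilon> > 0\<close> \<epsilon>_small] by blast
qed

section \<open>Two laminations without common endpoints\<close>

text \<open>The condition on \<open>cis\<close> discards ties of a point with its own translates by
  full turns, which occur at the global minimum.\<close>

definition tie_point :: "(real \<Rightarrow> real) \<Rightarrow> real \<Rightarrow> bool"
  where "tie_point f s \<longleftrightarrow> (\<exists>t. level f s t \<and> cis t \<noteq> cis s)"

lemma (in circle_height) endpoint_tie_point:
  assumes "cis s \<in> endpoints (lam f)" shows "tie_point f s"
proof -
  obtain l where "l \<in> lam f" "cis s \<in> l" using assms by (auto simp: endpoints_def)
  then obtain x y where "l = {x, y}" "edge f x y" using lamE by blast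
  then obtain w where "edge f (cis s) w" using \<open>cis s \<in> l\<close> edge_sym by auto
  then have "crel f (cis s) w" "w \<noteq> cis s" by (auto simp: edge_def)
  then show ?thesis unfolding crel_cis_iff tie_point_def by metis
qed

text \<open>The involution sends the complement of the arc of radius \<open>p / 4\<close> about 1
  into the arc of radius \<open>\<epsilon>\<close>. The bound \<open>p / 8\<close> leaves room for
  the shifted interval in \<open>two_heights\<close>.\<close>

locale flip_group = mobius_flip c for c +
  fixes N :: nat and p \<epsilon> :: real
  assumes N: "N \<ge> 2" and p: "p = 2 * pi / N"
    and \<epsilon>: "0 < \<epsilon>" "\<epsilon> < p / 8" and lift_\<epsilon>: "flip_lift c (p / 4) = 2 * pi - \<epsilon>"
    and expansion: "\<And>x y. - \<epsilon> \<le> x \<Longrightarrow> x \<le> y \<Longrightarrow> y \<le> \<epsilon> \<Longrightarrow> 2 * (y - x) \<le> flip_lift c y - flip_lift c x"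
begin

abbreviation "\<phi> \<equiv> flip_lift c"

lemma p_pos: "p > 0" using N by (simp add: p)

lemma N_p: "real N * p = 2 * pi" "p * real N = 2 * pi" using N by (simp_all add: p)

lemma p_le_pi: "p \<le> pi"
  unfolding p using N by (simp add: field_simps)

lemma lift_le: "\<phi> x \<le> \<phi> y \<longleftrightarrow> x \<le> y" using flip_lift_mono strict_mono_less_eq by blast
lemma lift_less: "\<phi> x < \<phi> y \<longleftrightarrow> x < y" using flip_lift_mono strict_mono_less by blast

lemma lift_far: assumes "p / 4 \<le> x" "x \<le> 2 * pi - p / 4" shows "2 * pi - \<epsilon> \<le> \<phi> x" "\<phi> x \<le> 2 * pi + \<epsilon>"
proof -
  show "2 * pi - \<epsilon> \<le> \<phi> x" using lift_le[of "p / 4" x] assms lift_\<epsilon> by simp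
  have "\<phi> (2 * pi - p / 4) = 2 * pi + \<epsilon>"
    using flip_lift_turn[of "- (p / 4)"] flip_lift_uminus[of "p / 4"] lift_\<epsilon> by (simp add: algebra_simps)
  then show "\<phi> x \<le> 2 * pi + \<epsilon>" using lift_le[of x "2 * pi - p / 4"] assms by simp
qed

text \<open>The rotation by \<open>p\<close> followed by the involution. In angles,
  [\<open>a\<close>, \<open>turn a\<close>] is the rising slope of the strip based at
  \<open>a\<close>, and [\<open>\<phi> a\<close>, \<open>a + p\<close>] is the falling one.\<close>

definition turn :: "real \<Rightarrow> real" where "turn x = \<phi> (x + p) - 2 * pi"

definition lift_at :: "real \<Rightarrow> real \<Rightarrow> real" where "lift_at a x = (\<phi> (a + p * x) - a) / p"

text \<open>Both \<open>a\<close> and \<open>a + p\<close> keep distance at least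
  \<open>p / 4\<close> from the multiples of \<open>2 * pi\<close>, so the involution brings both
  within \<open>\<epsilon>\<close> of such a multiple.\<close>

lemma turn_bounds:
  assumes "- (p / 2) \<le> a" "a \<le> - (p / 4)"
  shows "- \<epsilon> \<le> turn a" "turn a < \<phi> a" "\<phi> a \<le> \<epsilon>" "a < turn a" "\<phi> a < a + p"
proof -
  show 1: "- \<epsilon> \<le> turn a" using lift_far(1)[of "a + p"] assms p_pos p_le_pi by (simp add: turn_def)
  have "\<phi> (a + p) < \<phi> (a + 2 * pi)" unfolding lift_less using p_le_pi pi_gt_zero by linarith
  then show "turn a < \<phi> a" by (simp add: turn_def flip_lift_turn)
  have "\<phi> (a + 2 * pi) \<le> 2 * pi + \<epsilon>" using assms p_pos p_le_pi by (intro lift_far(2)) auto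
  then show 2: "\<phi> a \<le> \<epsilon>" by (simp add: flip_lift_turn)
  show "a < turn a" "\<phi> a < a + p" using 1 2 assms \<epsilon> p_pos by linarith+
qed

lemma circle_strip_at:
  assumes a: "- (p / 2) \<le> a" "a \<le> - (p / 4)"
    and U: "continuous_on {a..turn a} U" "strict_mono_on {a..turn a} U" "U a = 0" "U (turn a) = 1"
  shows "circle_strip N (lift_at a) (\<lambda>x. U (a + p * x)) ((turn a - a) / p) ((\<phi> a - a) / p) a \<phi>"
proof unfold_locales
  note b = turn_bounds[OF a] and pp = p_pos
  show "2 \<le> N" by (rule N)
  show "continuous_on UNIV (lift_at a)"
    unfolding lift_at_def[abs_def]
    by (intro continuous_intros continuous_on_compose2[OF flip_lift_cont[of UNIV]]) (use pp in auto)
  show "strict_mono (lift_at a)"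
    using pp by (intro strict_monoI) (simp add: lift_at_def divide_strict_right_mono lift_less)
  show "lift_at a (x + real N) = lift_at a x + real N" for x
  proof -
    have "a + p * (x + real N) = a + p * x + 2 * pi" by (simp add: distrib_left N_p)
    then have "\<phi> (a + p * (x + real N)) = \<phi> (a + p * x) + 2 * pi" by (simp only: flip_lift_turn)
    then have "lift_at a (x + real N) = lift_at a x + 2 * pi / p"
      unfolding lift_at_def by (simp add: diff_divide_distrib add_divide_distrib)
    moreover have "2 * pi / p = real N" using pp by (simp add: N_p(1)[symmetric])
    ultimately show ?thesis by simp
  qed
  show "lift_at a (lift_at a x) = x + real N" for x
  proof -
    have "a + p * lift_at a x = \<phi> (a + p * x)" using pp by (simp add: lift_at_def)
    then have "lift_at a (lift_at a x) = (p * x + 2 * pi) / p" by (simp add: lift_at_def flip_lift_involution)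
    also have "\<dots> = x + real N" using pp by (simp add: N_p(1)[symmetric] add_divide_distrib)
    finally show ?thesis .
  qed
  show "(turn a - a) / p = lift_at a 1 - real N"
  proof -
    have "real N = 2 * pi / p" using pp by (simp add: N_p(1)[symmetric])
    then show ?thesis by (simp add: lift_at_def turn_def diff_divide_distrib)
  qed
  show "(\<phi> a - a) / p = lift_at a 0" by (simp add: lift_at_def)
  show "0 < (turn a - a) / p" "(turn a - a) / p < (\<phi> a - a) / p" "(\<phi> a - a) / p < 1"
    using b pp by (simp_all add: divide_strict_right_mono)
  show "2 * (y - x) \<le> lift_at a y - lift_at a x"
    if xy: "(turn a - a) / p \<le> x" "x \<le> y" "y \<le> (\<phi> a - a) / p" for x y
  proof -
    have "turn a \<le> a + p * x" "a + p * y \<le> \<phi> a" "p * x \<le> p * y"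
      using xy pp by (simp_all add: pos_divide_le_eq pos_le_divide_eq mult.commute)
    then have "2 * ((a + p * y) - (a + p * x)) \<le> \<phi> (a + p * y) - \<phi> (a + p * x)"
      using b by (intro expansion) auto
    then have "2 * (y - x) * p \<le> \<phi> (a + p * y) - \<phi> (a + p * x)" by (simp add: algebra_simps)
    then have "2 * (y - x) \<le> (\<phi> (a + p * y) - \<phi> (a + p * x)) / p" using pp by (simp add: pos_le_divide_eq)
    then show ?thesis by (simp add: lift_at_def diff_divide_distrib)
  qed
  have mem: "a + p * x \<in> {a..turn a}" if "x \<in> {0..(turn a - a) / p}" for x
    using that pp by (simp add: pos_le_divide_eq mult.commute)
  show "continuous_on {0..(turn a - a) / p} (\<lambda>x. U (a + p * x))"
    by (intro continuous_on_compose2[OF U(1)] continuous_intros) (use mem in auto)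
  show "strict_mono_on {0..(turn a - a) / p} (\<lambda>x. U (a + p * x))"
    using strict_mono_onD[OF U(2)] mem pp by (intro strict_mono_onI) simp
  show "U (a + p * 0) = 0" "U (a + p * ((turn a - a) / p)) = 1" using U pp by simp_all
  show "\<phi> (a + 2 * pi / real N * x) = a + 2 * pi / real N * lift_at a x" for x
    using pp by (simp add: lift_at_def flip: p)
qed

lemma flip_cis_eq_iff: "cis (\<phi> s) = cis (\<phi> t) \<longleftrightarrow> cis s = cis t"
  unfolding flip_cis[symmetric] using flip_flip[of "cis s"] flip_flip[of "cis t"] by (metis cis_in_S1)

lemma preserves_circ:
  assumes "circle_strip N F u al be a \<phi>"
  shows "preserves (circle_strip.circ N F u al be a) (flip c)"
    "preserves (circle_strip.circ N F u al be a) (\<lambda>z. cis (p * of_int k) * z)"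
proof -
  interpret circle_strip N F u al be a \<phi> by (rule assms)
  have rel_flip: "crel circ (flip c x) (flip c y)" if "crel circ x y" for x y
    using circ.crel_lift[where g = "flip c" and G = "\<phi>"] flip_cis level_circ_G that by blast
  show "preserves circ (flip c)"
    by (rule circ.preservesI[of _ "flip c" \<phi>])
      (use flip_S1 flip_flip flip_cis flip_lift_mono flip_lift_turn rel_flip in auto)
  have rot: "cis (p * of_int k) * cis t = cis (t + p * of_int k)" for t and k :: int
    by (simp add: cis_mult add.commute)
  have lev: "\<exists>j::int. level circ (s + p * of_int k) (t + p * of_int k + 2 * pi * of_int j)" if "level circ s t" for s t and k :: int
    using that level_circ_rotate[of s k t] by (intro exI[of _ 0]) (simp add: p)
  have rel: "crel circ (cis (p * of_int k) * x) (cis (p * of_int k) * y)" if "crel circ x y" for x y and k :: int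
    using circ.crel_lift[where g = "\<lambda>z. cis (p * of_int k) * z" and G = "\<lambda>t. t + p * of_int k"] rot lev that by blast
  have cancel: "cis (p * of_int (- k)) * (cis (p * of_int k) * z) = z" "cis (p * of_int k) * (cis (p * of_int (- k)) * z) = z" for z
    unfolding mult.assoc[symmetric] cis_mult by simp_all
  show "preserves circ (\<lambda>z. cis (p * of_int k) * z)"
    by (rule circ.preservesI[of _ "\<lambda>z. cis (p * of_int (- k)) * z" "\<lambda>t. t + p * of_int k"])
      (use cancel rot rel in \<open>auto simp: norm_mult strict_mono_def simp del: of_int_minus mult_minus_right\<close>)
qed

lemma tie_point_circ:
  assumes "circle_strip N F u al be a \<phi>" and tie: "tie_point (circle_strip.circ N F u al be a) s"
  shows "tie_point (circle_strip.circ N F u al be a) (\<phi> s)"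
    "tie_point (circle_strip.circ N F u al be a) (s + p * of_int k)"
proof -
  interpret circle_strip N F u al be a \<phi> by (rule assms)
  obtain t where t: "level circ s t" "cis t \<noteq> cis s" using tie by (auto simp: tie_point_def)
  obtain j :: int where "level circ (\<phi> s) (\<phi> t + 2 * pi * of_int j)" using level_circ_G t by blast
  moreover have "cis (\<phi> t + 2 * pi * of_int j) \<noteq> cis (\<phi> s)" using t flip_cis_eq_iff by simp
  ultimately show "tie_point circ (\<phi> s)" unfolding tie_point_def by blast
  have "level circ (s + p * of_int k) (t + p * of_int k)" using level_circ_rotate[of s k t] t by (simp add: p)
  moreover have "cis (t + p * of_int k) \<noteq> cis (s + p * of_int k)"
    using t by (simp flip: cis_mult)
  ultimately show "tie_point circ (s + p * of_int k)" unfolding tie_point_def by blast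
qed

lemma tie_point_digital:
  assumes "circle_strip N (lift_at a) (\<lambda>x. U (a + p * x)) ((turn a - a) / p) ((\<phi> a - a) / p) a \<phi>"
    and tie: "tie_point (circle_strip.circ N (lift_at a) (\<lambda>x. U (a + p * x)) ((turn a - a) / p) ((\<phi> a - a) / p) a) s"
    and s: "a \<le> s" "s \<le> turn a"
  shows "U s \<in> digital"
proof -
  interpret circle_strip N "lift_at a" "\<lambda>x. U (a + p * x)" "(turn a - a) / p" "(\<phi> a - a) / p" a \<phi> by (rule assms)
  obtain t where t: "level circ s t" "cis t \<noteq> cis s" using tie by (auto simp: tie_point_def)
  have inv: "a + p * coord s = s" using coord_inverse[of s] by (simp add: p)
  have "0 \<le> coord s" using s N_pos by (simp add: coord_def)
  moreover have "coord s \<le> (turn a - a) / p" using inv s p_pos by (simp add: pos_le_divide_eq mult.commute)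
  moreover have "coord s \<noteq> coord t" using t coord_eq_iff by auto
  ultimately have "U (a + p * coord s) \<in> digital" using level_J_digital[of "coord s" "coord t"] t level_circ by blast
  then show ?thesis unfolding inv .
qed

theorem two_heights:
  obtains f1 f2 where "finite_circle_height f1" "finite_circle_height f2"
    "endpoints (lam f1) \<inter> endpoints (lam f2) = {}"
    "\<And>f. f = f1 \<or> f = f2 \<Longrightarrow> preserves f (flip c)"
    "\<And>f k. f = f1 \<or> f = f2 \<Longrightarrow> preserves f (\<lambda>z. cis (p * of_int k) * z)"
proof -
  define a1 where "a1 = - (p / 2)"
  define b1 where "b1 = turn a1"
  define U1 where "U1 x = (x - a1) / (b1 - a1)" for x
  \<comment> \<open>Since \<open>a1 = - (p / 2)\<close> and
    \<open>b1 \<le> \<epsilon> < p / 8\<close>, this is still below \<open>- (p / 4)\<close>, as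
    \<open>turn_bounds\<close> requires.\<close>
  define a2 where "a2 = a1 + 2/5 * (b1 - a1)"
  define b2 where "b2 = turn a2"
  \<comment> \<open>Gluing \<open>a1\<close> to \<open>b1\<close> by \<open>turn\<close> gives a
    circle on which \<open>U2\<close> is \<open>U1 - 2/5\<close> modulo 1. A point beyond
    \<open>b1\<close> is brought back by \<open>\<phi> x - p\<close>, which inverts
    \<open>turn\<close>; there \<open>U2\<close> is \<open>U1 + 3/5\<close>.\<close>
  define U2 where "U2 x = U1 (min x b1) - 2/5 + U1 (\<phi> (max x b1) - p)" for x
  have a1: "- (p / 2) \<le> a1" "a1 \<le> - (p / 4)" using p_pos by (auto simp: a1_def)
  note t1 = turn_bounds[OF a1, folded b1_def]
  have a2: "- (p / 2) \<le> a2" "a2 \<le> - (p / 4)" and a12: "a1 < a2" "a2 < b1"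
  proof -
    have eqs: "2 * a1 = - p" "5 * a2 = 3 * a1 + 2 * b1" by (simp_all add: a1_def a2_def field_simps)
    show "- (p / 2) \<le> a2" using eqs t1 \<epsilon> by linarith
    show "a2 \<le> - (p / 4)" using eqs t1 \<epsilon> by linarith
    show "a1 < a2" using eqs t1 \<epsilon> by linarith
    show "a2 < b1" using eqs t1 \<epsilon> by linarith
  qed
  have b12: "b1 < b2" unfolding b1_def b2_def turn_def using a12 by (simp add: lift_less)
  have lift_of_turn: "\<phi> (turn x) - p = x" for x
    using flip_lift_involution[of "x + p"] flip_lift_turn[of "turn x"] by (simp add: turn_def)
  have U1_mono: "U1 x < U1 y \<longleftrightarrow> x < y" for x y using t1 by (simp add: U1_def divide_less_cancel)
  have U1_vals: "U1 a1 = 0" "U1 b1 = 1" "U1 a2 = 2/5"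
  proof -
    have ne: "b1 - a1 \<noteq> 0" using t1 by simp
    then show "U1 a1 = 0" "U1 b1 = 1" by (simp_all add: U1_def)
    have "U1 a2 = 2/5 * (b1 - a1) / (b1 - a1)" unfolding U1_def a2_def add_diff_cancel_left' ..
    then show "U1 a2 = 2/5" using nonzero_mult_div_cancel_right[OF ne] by (simp only:)
  qed
  have U1_cont: "continuous_on A U1" for A
    unfolding U1_def[abs_def] by (intro continuous_intros) (use t1 in auto)
  have U2_cont: "continuous_on A U2" for A
    unfolding U2_def[abs_def]
    by (intro continuous_intros continuous_on_compose2[OF U1_cont[of UNIV]] continuous_on_compose2[OF flip_lift_cont[of UNIV]]) auto
  have U2_low: "U2 x = U1 x - 2/5" if "x \<le> b1" for x
    using that lift_of_turn[of a1] U1_vals by (simp add: U2_def b1_def)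
  have U2_high: "U2 x = U1 (\<phi> x - p) + 3/5" if "b1 \<le> x" for x
    using that U1_vals by (simp add: U2_def)
  have U2_mono: "U2 x < U2 y" if "x < y" for x y
  proof -
    have high: "U2 x < U2 y" if "b1 \<le> x" "x < y" for x y
      using that U1_mono lift_less[of x y] by (simp add: U2_high)
    have low: "U2 x < U2 y" if "y \<le> b1" "x < y" for x y
      using that U1_mono by (simp add: U2_low)
    show ?thesis
      using high[of x y] low[of y x] low[of b1 x] high[of b1 y] that by (cases "x < b1"; cases "b1 < y") auto
  qed
  have "circle_strip N (lift_at a1) (\<lambda>x. U1 (a1 + p * x)) ((turn a1 - a1) / p) ((\<phi> a1 - a1) / p) a1 \<phi>"
    by (intro circle_strip_at a1 U1_cont strict_mono_onI) (use U1_mono U1_vals in \<open>auto simp: b1_def\<close>)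
  note S1 = this
  interpret A: circle_strip N "lift_at a1" "\<lambda>x. U1 (a1 + p * x)" "(turn a1 - a1) / p" "(\<phi> a1 - a1) / p" a1 \<phi> by (rule S1)
  have "U2 b2 = 1" using U2_high[of b2] b12 lift_of_turn[of a2] U1_vals by (simp add: b2_def)
  then have "circle_strip N (lift_at a2) (\<lambda>x. U2 (a2 + p * x)) ((turn a2 - a2) / p) ((\<phi> a2 - a2) / p) a2 \<phi>"
    using U2_low[of a2] a12 U1_vals
    by (intro circle_strip_at a2 U2_cont strict_mono_onI) (use U2_mono in \<open>auto simp: b2_def\<close>)
  note S2 = this
  interpret B: circle_strip N "lift_at a2" "\<lambda>x. U2 (a2 + p * x)" "(turn a2 - a2) / p" "(\<phi> a2 - a2) / p" a2 \<phi> by (rule S2)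
  have disjoint: False if x: "x \<in> endpoints (lam A.circ)" "x \<in> endpoints (lam B.circ)" for x
  proof -
    have "x \<in> S1" using x(1) edge_S1 by (auto simp: endpoints_def lam_def)
    then obtain s where s: "x = cis s" using S1_cis by blast
    have tieA: "tie_point A.circ s" and tieB: "tie_point B.circ s"
      using x s A.circ.endpoint_tie_point B.circ.endpoint_tie_point by blast+
    \<comment> \<open>Tie points of the first height spread forwards along the group, so their
      absence spreads backwards. Hence \<open>level_height_regular\<close> for the second height
      leaves only points of its own interval with digital coordinate to be examined.\<close>
    define Q where "Q y \<longleftrightarrow> \<not> tie_point A.circ (a2 + p * y)" for y
    have lift: "a2 + p * lift_at a2 y = \<phi> (a2 + p * y)" for y using p_pos by (simp add: lift_at_def)
    have Q_int: "Q y" if "Q (y + of_int k)" for y k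
      using that tie_point_circ(2)[OF S1, of "a2 + p * y" k] by (auto simp: Q_def algebra_simps)
    have Q_F: "Q y" if "Q (lift_at a2 y)" for y
      using that tie_point_circ(1)[OF S1, of "a2 + p * y"] by (auto simp: Q_def lift)
    have Q_J: "Q y" if y: "0 \<le> y" "y \<le> (turn a2 - a2) / p" "U2 (a2 + p * y) \<in> digital" for y
    proof (unfold Q_def, rule notI)
      let ?x = "a2 + p * y"
      assume tie: "tie_point A.circ ?x"
      have bounds: "a2 \<le> ?x" "?x \<le> b2" using y p_pos by (simp_all add: b2_def pos_le_divide_eq mult.commute)
      show False
      proof (cases "?x \<le> b1")
        case True
        then have "U1 ?x \<in> digital" using bounds a12 by (intro tie_point_digital[OF S1 tie]) (auto simp: b1_def)
        then have "U2 ?x + real_of_int 2 / 5 \<in> digital" using True by (simp add: U2_low)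
        then show False using digital_shift[OF y(3), of 2] by simp
      next
        case False
        let ?z = "\<phi> ?x - p"
        have "tie_point A.circ ?z"
          using tie_point_circ(2)[OF S1 tie_point_circ(1)[OF S1 tie], of "-1"] by simp
        moreover have "a1 \<le> ?z" using lift_of_turn[of a1] lift_le[of b1 ?x] False by (simp add: b1_def)
        moreover have "?z \<le> b1" using lift_of_turn[of a2] lift_le[of ?x b2] bounds a12 by (simp add: b2_def)
        ultimately have "U1 ?z \<in> digital" by (intro tie_point_digital[OF S1]) (auto simp: b1_def)
        moreover have "U1 ?z + real_of_int 3 / 5 \<in> digital" using y(3) U2_high[of ?x] False by simp
        ultimately show False using digital_shift[of "U1 ?z" 3] by simp
      qed
    qed
    obtain t where t: "level B.circ s t" "cis t \<noteq> cis s" using tieB by (auto simp: tie_point_def)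
    then have "B.coord s \<noteq> B.coord t" using B.coord_eq_iff by auto
    then have "Q (B.coord s)"
      using B.level_height_regular[where Q = Q and s = "B.coord s" and t = "B.coord t"]
        Q_int Q_F Q_J t(1) B.level_circ by blast
    moreover have "a2 + p * B.coord s = s" using B.coord_inverse[of s] by (simp add: p)
    ultimately show False using tieA by (simp add: Q_def)
  qed
  show ?thesis
  proof (rule that)
    show "finite_circle_height A.circ" "finite_circle_height B.circ" by unfold_locales
    show "endpoints (lam A.circ) \<inter> endpoints (lam B.circ) = {}" using disjoint by blast
    show "preserves f (flip c)" if "f = A.circ \<or> f = B.circ" for f
      using that preserves_circ(1)[OF S1] preserves_circ(1)[OF S2] by blast
    show "preserves f (\<lambda>z. cis (p * of_int k) * z)" if "f = A.circ \<or> f = B.circ" for f k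
      using that preserves_circ(2)[OF S1] preserves_circ(2)[OF S2] by blast
  qed
qed

end

section \<open>Reduced words and discreteness\<close>

text \<open>The exponent with respect to a generator, stretched by the quotient of \<open>N\<close>
  by the order of the generator, so that rotations through \<open>2 * pi / N * \<kappa> x\<close>
  represent the group faithfully. Exponents are arbitrary choices, hence additivity holds modulo
  \<open>N\<close>.\<close>

lemma (in group) finite_cyclic_exponent:
  assumes fin: "finite (carrier G)" and cyc: "cyclic_group G" and N: "order G dvd N" "N > 0"
  obtains \<kappa> :: "'a \<Rightarrow> int" where
    "\<And>x y. x \<in> carrier G \<Longrightarrow> y \<in> carrier G \<Longrightarrow> int N dvd \<kappa> (x \<otimes> y) - (\<kappa> x + \<kappa> y)"
    "\<And>x. x \<in> carrier G \<Longrightarrow> int N dvd \<kappa> x \<longleftrightarrow> x = \<one>"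
proof -
  obtain g where g: "g \<in> carrier G" "carrier G = range (\<lambda>n::int. g [^] n)" using cyc unfolding cyclic_group by blast
  define M where "M = ord g"
  have "M dvd N" using ord_dvd_group_order[OF g(1)] N(1) unfolding M_def by (rule dvd_trans)
  then obtain q where q: "N = M * q" by blast
  then have pos: "M > 0" "q > 0" using N(2) by auto
  define e where "e x = (SOME i::int. g [^] i = x)" for x
  have e: "g [^] e x = x" if "x \<in> carrier G" for x
  proof -
    have "\<exists>i::int. g [^] i = x" using that g(2) by auto
    then show ?thesis unfolding e_def by (rule someI_ex)
  qed
  show ?thesis
  proof (rule that[of "\<lambda>x. int q * e x"])
    fix x y assume xy: "x \<in> carrier G" "y \<in> carrier G"
    have "g [^] (e x + e y) = g [^] e (x \<otimes> y)"
      unfolding int_pow_mult[OF g(1)] using xy by (simp add: e)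
    then have "int M dvd e (x \<otimes> y) - (e x + e y)" unfolding int_pow_eq[OF g(1)] M_def .
    then have "int q * int M dvd int q * (e (x \<otimes> y) - (e x + e y))" by (rule mult_dvd_mono[OF dvd_refl])
    then show "int N dvd int q * e (x \<otimes> y) - (int q * e x + int q * e y)"
      by (simp add: q algebra_simps)
  next
    fix x assume x: "x \<in> carrier G"
    have "int N dvd int q * e x \<longleftrightarrow> int M dvd e x" using pos by (simp add: q mult.commute)
    also have "\<dots> \<longleftrightarrow> x = \<one>" using int_pow_eq_id[OF g(1), of "e x"] e[OF x] by (simp add: M_def)
    finally show "int N dvd int q * e x \<longleftrightarrow> x = \<one>" .
  qed
qed

context two_groups begin

fun reduced :: "('a + 'b) list \<Rightarrow> bool" where
  "reduced [] \<longleftrightarrow> True"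
| "reduced (l # w) \<longleftrightarrow> l \<noteq> Inl \<one>\<^bsub>G\<^esub> \<and> l \<noteq> Inr \<one>\<^bsub>H\<^esub> \<and> (w = [] \<or> isl l \<noteq> isl (hd w)) \<and> reduced w"

lemma reduced_exists:
  assumes "w \<in> fp_words G H" shows "\<exists>v \<in> fp_words G H. reduced v \<and> fp_eq G H w v"
  using assms
proof (induction w)
  case Nil
  then show ?case by (intro bexI[of _ "[]"]) (auto intro: fp_eq.refl)
next
  case (Cons l w)
  then obtain v where v: "v \<in> fp_words G H" "reduced v" "fp_eq G H w v" by auto
  have l: "[l] \<in> fp_words G H" using Cons by auto
  have lv: "fp_eq G H (l # w) (l # v)" using fp_eq_append_left[OF v(3) l] by simp
  have lvw: "l # v \<in> fp_words G H" using l v by auto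
  consider "l = Inl \<one>\<^bsub>G\<^esub>" | "l = Inr \<one>\<^bsub>H\<^esub>" | "reduced (l # v)"
    | x y v' where "l = Inl x" "v = Inl y # v'" | x y v' where "l = Inr x" "v = Inr y # v'"
  proof (cases v)
    case Nil
    then show ?thesis using that(1-3) by auto
  next
    case (Cons l' v')
    then show ?thesis using that v(2) by (cases l; cases l') auto
  qed
  then show ?case
  proof cases
    case 1
    then have "fp_eq G H (l # v) v" using fp_eq.one_left[of "[]" G H v] v by simp
    then show ?thesis using v lv fp_eq.trans by blast
  next
    case 2
    then have "fp_eq G H (l # v) v" using fp_eq.one_right[of "[]" G H v] v by simp
    then show ?thesis using v lv fp_eq.trans by blast
  next
    case 3
    then show ?thesis using lv lvw by blast
  next
    case (4 x y v')
    then have xy: "x \<in> carrier G" "y \<in> carrier G" "v' \<in> fp_words G H" using lvw by auto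
    have eq: "fp_eq G H (l # w) (Inl (x \<otimes>\<^bsub>G\<^esub> y) # v')"
      using fp_eq.mult_left[of "[]" G H v' x y] xy 4 lv fp_eq.trans by fastforce
    show ?thesis
    proof (cases "x \<otimes>\<^bsub>G\<^esub> y = \<one>\<^bsub>G\<^esub>")
      case True
      then have "fp_eq G H (l # w) v'" using eq fp_eq.one_left[of "[]" G H v'] xy fp_eq.trans by fastforce
      then show ?thesis using xy v(2) 4 by auto
    next
      case False
      then have "reduced (Inl (x \<otimes>\<^bsub>G\<^esub> y) # v')" using v(2) 4 by auto
      then show ?thesis using eq xy by (intro bexI[of _ "Inl (x \<otimes>\<^bsub>G\<^esub> y) # v'"]) auto
    qed
  next
    case (5 x y v')
    then have xy: "x \<in> carrier H" "y \<in> carrier H" "v' \<in> fp_words G H" using lvw by auto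
    have eq: "fp_eq G H (l # w) (Inr (x \<otimes>\<^bsub>H\<^esub> y) # v')"
      using fp_eq.mult_right[of "[]" G H v' x y] xy 5 lv fp_eq.trans by fastforce
    show ?thesis
    proof (cases "x \<otimes>\<^bsub>H\<^esub> y = \<one>\<^bsub>H\<^esub>")
      case True
      then have "fp_eq G H (l # w) v'" using eq fp_eq.one_right[of "[]" G H v'] xy fp_eq.trans by fastforce
      then show ?thesis using xy v(2) 5 by auto
    next
      case False
      then have "reduced (Inr (x \<otimes>\<^bsub>H\<^esub> y) # v')" using v(2) 5 by auto
      then show ?thesis using eq xy by (intro bexI[of _ "Inr (x \<otimes>\<^bsub>H\<^esub> y) # v'"]) auto
    qed
  qed
qed

end

lemma Homeo_plus_mult:
  assumes "f \<in> carrier Homeo_plus" "g \<in> carrier Homeo_plus"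
  shows "f \<otimes>\<^bsub>Homeo_plus\<^esub> g = compose S1 f g"
proof -
  have "f \<otimes>\<^bsub>Homeo_plus\<^esub> g = f \<otimes>\<^bsub>BijGroup S1\<^esub> g" by (simp add: Homeo_plus_def)
  also have "\<dots> = compose S1 f g"
    using Homeo_plus_subset_Bij[OF assms(1)] Homeo_plus_subset_Bij[OF assms(2)] by (simp add: BijGroup_def)
  finally show ?thesis .
qed

lemma Homeo_plus_one: "\<one>\<^bsub>Homeo_plus\<^esub> = (\<lambda>z\<in>S1. z)"
  by (simp add: Homeo_plus_def BijGroup_def)

lemma Homeo_plus_S1: "f \<in> carrier Homeo_plus \<Longrightarrow> z \<in> S1 \<Longrightarrow> f z \<in> S1"
  using Homeo_plus_subset_Bij[of f] unfolding Bij_def bij_betw_def by blast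

text \<open>If \<open>h\<close> is uniformly close to \<open>g\<close>, continuity of the inverse of
  \<open>g\<close> at \<open>g z\<close> shows that the quotient of \<open>h\<close> by
  \<open>g\<close> moves \<open>z\<close> by less than \<open>d\<close>; so it is trivial.\<close>

lemma discrete_subgroupI:
  assumes sub: "subgroup \<Gamma> Homeo_plus" and z: "z \<in> S1" and d: "d > 0"
    and far: "\<And>k. k \<in> \<Gamma> \<Longrightarrow> k \<noteq> \<one>\<^bsub>Homeo_plus\<^esub> \<Longrightarrow> d \<le> dist (k z) z"
  shows "discrete_subgroup \<Gamma>"
proof -
  interpret group Homeo_plus by (rule group_Homeo_plus)
  let ?m = "cfunspace (top_of_set S1) euclidean_metric :: (complex \<Rightarrow> complex) metric"
  interpret M: Metric_space "mspace ?m" "mdist ?m" by (rule Metric_space_mspace_mdist)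
  have \<Gamma>: "\<Gamma> \<subseteq> carrier Homeo_plus" using sub subgroup.subset by blast
  have mem: "carrier Homeo_plus \<subseteq> mspace ?m"
    using topspace_Homeo_plus_topology unfolding Homeo_plus_topology_def by (auto simp: topspace_subtopology)
  have single: "openin (subtopology Homeo_plus_topology \<Gamma>) {g}" if g: "g \<in> \<Gamma>" for g
  proof -
    have gH: "g \<in> carrier Homeo_plus" using g \<Gamma> by blast
    obtain g' where g': "homeomorphism S1 S1 g g'" using gH unfolding mem_Homeo_plus_iff by blast
    have gz: "g z \<in> S1" using Homeo_plus_S1[OF gH z] .
    have "continuous_on S1 g'" using g' by (simp add: homeomorphism_def)
    then obtain r where r: "r > 0" "\<And>y. y \<in> S1 \<Longrightarrow> dist y (g z) < r \<Longrightarrow> dist (g' y) (g' (g z)) < d"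
      unfolding continuous_on_iff using d gz by meson
    have g'g: "g' (g z) = z" using g' z by (simp add: homeomorphism_def)
    have "h = g" if h: "h \<in> \<Gamma>" "h \<in> M.mball g r" for h
    proof -
      have hH: "h \<in> carrier Homeo_plus" using h \<Gamma> by blast
      have hz: "h z \<in> S1" using Homeo_plus_S1[OF hH z] .
      have "mdist ?m g h < r" using h(2) unfolding M.in_mball by blast
      then have "mdist euclidean_metric (g z) (h z) < r"
        using mem gH hH z by (intro cfunspace_mdist_lt[of "top_of_set S1" g euclidean_metric h]) auto
      then have "dist (h z) (g z) < r" by (simp add: dist_commute)
      then have near: "dist (g' (h z)) z < d" using r hz g'g by simp
      define k where "k = inv\<^bsub>Homeo_plus\<^esub> g \<otimes>\<^bsub>Homeo_plus\<^esub> h"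
      have k: "k \<in> \<Gamma>" unfolding k_def using sub g h subgroup.m_closed subgroup.m_inv_closed by metis
      have kH: "k \<in> carrier Homeo_plus" using k \<Gamma> by blast
      have gk: "g \<otimes>\<^bsub>Homeo_plus\<^esub> k = h" unfolding k_def using gH hH by (simp add: m_assoc[symmetric])
      then have hk: "h = compose S1 g k" using Homeo_plus_mult[OF gH kH] by simp
      have "g (k z) = h z" unfolding hk using z by (simp add: compose_def)
      then have "k z = g' (h z)" using g' Homeo_plus_S1[OF kH z] by (metis homeomorphism_apply1)
      then have "k = \<one>\<^bsub>Homeo_plus\<^esub>" using far[OF k] near by force
      then show "h = g" using gk gH by simp
    qed
    note isolated = this
    have "g \<in> mspace ?m" using mem gH by (rule subsetD)
    then have "g \<in> M.mball g r" using M.centre_in_mball_iff[of g r] r(1) by blast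
    then have "{g} = M.mball g r \<inter> (carrier Homeo_plus \<inter> \<Gamma>)"
      using isolated g gH by (intro antisym subsetI) blast+
    moreover have "openin (mtopology_of ?m) (M.mball g r)" unfolding mtopology_of_def by (rule M.openin_mball)
    ultimately show ?thesis
      unfolding Homeo_plus_topology_def subtopology_subtopology openin_subtopology by (intro exI conjI)
  qed
  have "topspace (subtopology Homeo_plus_topology \<Gamma>) = \<Gamma>"
    using \<Gamma> by (auto simp: topspace_subtopology topspace_Homeo_plus_topology)
  then have "discrete_topology \<Gamma> = subtopology Homeo_plus_topology \<Gamma>"
    using single discrete_topology_unique by blast
  then show ?thesis using sub by (simp add: discrete_subgroup_def)
qed

definition mobius :: "(complex \<Rightarrow> complex) \<Rightarrow> bool"
  where "mobius g \<longleftrightarrow> (\<exists>a b c d. \<forall>z\<in>S1. c * z + d \<noteq> 0 \<and> g z = (a * z + b) / (c * z + d))"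

lemma mobius_compose:
  assumes "mobius g" "mobius h" "\<And>z. z \<in> S1 \<Longrightarrow> h z \<in> S1" shows "mobius (compose S1 g h)"
proof -
  obtain a b c d where g: "\<And>z. z \<in> S1 \<Longrightarrow> c * z + d \<noteq> 0 \<and> g z = (a * z + b) / (c * z + d)"
    using assms(1) unfolding mobius_def by blast
  obtain a' b' c' d' where h: "\<And>z. z \<in> S1 \<Longrightarrow> c' * z + d' \<noteq> 0 \<and> h z = (a' * z + b') / (c' * z + d')"
    using assms(2) unfolding mobius_def by blast
  have "(c * a' + d * c') * z + (c * b' + d * d') \<noteq> 0 \<and>
      compose S1 g h z = ((a * a' + b * c') * z + (a * b' + b * d')) / ((c * a' + d * c') * z + (c * b' + d * d'))"
    if z: "z \<in> S1" for z
  proof -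
    let ?D = "c' * z + d'"
    have D: "?D \<noteq> 0" and hz: "h z * ?D = a' * z + b'" using h[OF z] by auto
    have gz: "c * h z + d \<noteq> 0" "g (h z) = (a * h z + b) / (c * h z + d)" using g[OF assms(3)[OF z]] by auto
    have "(c * a' + d * c') * z + (c * b' + d * d') = c * (a' * z + b') + d * ?D" by (simp add: algebra_simps)
    also have "\<dots> = (c * h z + d) * ?D" unfolding hz[symmetric] by (simp add: algebra_simps)
    finally have den: "(c * a' + d * c') * z + (c * b' + d * d') = (c * h z + d) * ?D" .
    have "(a * a' + b * c') * z + (a * b' + b * d') = a * (a' * z + b') + b * ?D" by (simp add: algebra_simps)
    also have "\<dots> = (a * h z + b) * ?D" unfolding hz[symmetric] by (simp add: algebra_simps)
    finally have num: "(a * a' + b * c') * z + (a * b' + b * d') = (a * h z + b) * ?D" .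
    show ?thesis unfolding den num using D gz z by (simp add: compose_def)
  qed
  then show ?thesis unfolding mobius_def by blast
qed

text \<open>The fixed points are roots of a polynomial of degree at most 2, which vanishes
  identically only if the map is the identity on the circle.\<close>

lemma mobius_fixed_points:
  assumes g: "mobius g" "g \<in> extensional S1" and ne: "g \<noteq> (\<lambda>z\<in>S1. z)"
  shows "finite {z \<in> S1. g z = z}"
proof -
  obtain a b c d where m: "\<And>z. z \<in> S1 \<Longrightarrow> c * z + d \<noteq> 0 \<and> g z = (a * z + b) / (c * z + d)"
    using assms(1) unfolding mobius_def by blast
  define P where "P = [:- b, d - a, c:]"
  have fixed: "g z = z \<longleftrightarrow> poly P z = 0" if "z \<in> S1" for z
    using m[OF that] by (auto simp: P_def divide_eq_eq algebra_simps)
  have "P \<noteq> 0"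
  proof
    assume "P = 0"
    then have "g z = z" if "z \<in> S1" for z using fixed[OF that] by simp
    then have "g = (\<lambda>z\<in>S1. z)" using g(2) by (intro ext) (auto simp: extensional_def)
    then show False using ne by blast
  qed
  then have "finite {z. poly P z = 0}" by (rule poly_roots_finite)
  then show ?thesis by (rule rev_finite_subset) (use fixed in auto)
qed

section \<open>The generators and the ping-pong arc\<close>

context flip_group begin

definition rot :: "int \<Rightarrow> complex \<Rightarrow> complex" where "rot k = (\<lambda>z\<in>S1. cis (p * of_int k) * z)"
definition inv_flip :: "complex \<Rightarrow> complex" where "inv_flip = (\<lambda>z\<in>S1. flip c z)"

lemma rot_S1: "z \<in> S1 \<Longrightarrow> cis (p * of_int k) * z \<in> S1"
  by (simp add: norm_mult)

lemma rot_compose: "compose S1 (rot j) (rot k) = rot (j + k)"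
  using rot_S1 by (auto simp: rot_def compose_def fun_eq_iff distrib_left simp flip: cis_mult mult.assoc)

lemma rot_eq: assumes "int N dvd j - k" shows "rot j = rot k"
proof -
  obtain i where i: "j = k + int N * i" using assms by (metis dvdE diff_eq_eq add.commute)
  have "p * of_int j = p * of_int k + (p * real N) * of_int i" by (simp add: i algebra_simps)
  then have "cis (p * of_int j) = cis (p * of_int k)" by (simp add: N_p)
  then show ?thesis by (simp add: rot_def)
qed

lemma rot_0: "rot 0 = (\<lambda>z\<in>S1. z)" by (simp add: rot_def)

lemma inv_flip_involution: "compose S1 inv_flip inv_flip = (\<lambda>z\<in>S1. z)"
  using flip_S1 flip_flip by (auto simp: inv_flip_def compose_def fun_eq_iff)

lemma rot_Homeo_plus: "rot k \<in> carrier Homeo_plus"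
proof (rule mem_Homeo_plusI)
  have r: "rot j ` S1 \<subseteq> S1" for j using rot_S1 by (auto simp: rot_def)
  have inv: "rot (- j) (rot j z) = z" "rot j (rot (- j) z) = z" if "z \<in> S1" for z j
    using rot_compose[of "- j" j] rot_compose[of j "- j"] that
    by (auto simp: compose_def rot_0 fun_eq_iff restrict_def split: if_splits)
  have cont: "continuous_on S1 (rot j)" for j
  proof -
    have "continuous_on S1 (\<lambda>z. cis (p * of_int j) * z)" by (intro continuous_intros)
    moreover have "continuous_on S1 (rot j) \<longleftrightarrow> continuous_on S1 (\<lambda>z. cis (p * of_int j) * z)"
      by (rule continuous_on_cong) (simp_all add: rot_def)
    ultimately show ?thesis by blast
  qed
  show "homeomorphism S1 S1 (rot k) (rot (- k))"
    by (intro homeomorphismI cont r) (use inv in auto)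
  show "homeomorphism UNIV UNIV (\<lambda>t. t + p * of_int k) (\<lambda>t. t - p * of_int k)"
    by (intro homeomorphismI continuous_intros) auto
  show "strict_mono (\<lambda>t. t + p * of_int k)" by (simp add: strict_mono_def)
  show "rot k (cis t) = cis (t + p * of_int k)" for t by (simp add: rot_def cis_mult add.commute)
qed (simp add: rot_def)

lemma inv_flip_Homeo_plus: "inv_flip \<in> carrier Homeo_plus"
proof (rule mem_Homeo_plusI)
  have inv: "inv_flip (inv_flip z) = z" if "z \<in> S1" for z
    using flip_S1 flip_flip that by (simp add: inv_flip_def)
  have "continuous_on S1 (flip c)"
    unfolding flip_def by (intro continuous_intros) (use flip_denom in auto)
  moreover have "continuous_on S1 inv_flip \<longleftrightarrow> continuous_on S1 (flip c)"
    by (rule continuous_on_cong) (simp_all add: inv_flip_def)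
  ultimately have cont: "continuous_on S1 inv_flip" by blast
  show "homeomorphism S1 S1 inv_flip inv_flip"
    by (intro homeomorphismI cont) (use inv flip_S1 in \<open>auto simp: inv_flip_def\<close>)
  have "\<phi> (\<phi> t - 2 * pi) = t" for t
    using flip_lift_turn[of "\<phi> t - 2 * pi"] flip_lift_involution[of t] by simp
  then show "homeomorphism UNIV UNIV \<phi> (\<lambda>t. \<phi> t - 2 * pi)"
    by (intro homeomorphismI continuous_intros flip_lift_cont) (auto simp: flip_lift_involution)
  show "strict_mono \<phi>" by (rule flip_lift_mono)
  show "inv_flip (cis t) = cis (\<phi> t)" for t by (simp add: inv_flip_def flip_cis)
qed (simp add: inv_flip_def)

lemma mobius_rot: "mobius (rot k)"
  unfolding mobius_def rot_def by (intro exI[of _ "cis (p * of_int k)"] exI[of _ 0] exI[of _ 1]) auto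

lemma mobius_inv_flip: "mobius inv_flip"
  unfolding mobius_def inv_flip_def
  by (rule exI[of _ "-1"], rule exI[of _ "complex_of_real c"], rule exI[of _ "- complex_of_real c"], rule exI[of _ 1])
    (use flip_denom in \<open>auto simp: flip_def\<close>)

definition arc :: "complex set" where "arc = {z \<in> S1. cos (p / 2) < Re z}"

lemma cis_in_arc_iff: assumes "\<bar>t\<bar> \<le> pi" shows "cis t \<in> arc \<longleftrightarrow> \<bar>t\<bar> < p / 2"
proof -
  have "cos (p / 2) < cos \<bar>t\<bar> \<longleftrightarrow> \<bar>t\<bar> < p / 2"
    using assms p_pos p_le_pi by (intro cos_mono_less_eq) auto
  then show ?thesis by (simp add: arc_def)
qed

lemma S1_arg: assumes "z \<in> S1" obtains t where "z = cis t" "\<bar>t\<bar> \<le> pi"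
proof -
  obtain r where "z = cis r" "- pi \<le> r" "r < - pi + 2 * pi" using S1_lift[OF assms] by metis
  then show ?thesis using that[of r] by auto
qed

text \<open>The arc is open and has angular width \<open>p\<close>, so rotating it by a multiple of
  \<open>p\<close> other than full turns moves it off itself.\<close>

lemma rot_arc:
  assumes "z \<in> arc" "\<not> int N dvd k" shows "rot k z \<in> S1 - arc"
proof -
  have zS: "z \<in> S1" using assms by (simp add: arc_def)
  obtain t where t: "z = cis t" "\<bar>t\<bar> \<le> pi" using S1_arg[OF zS] .
  have tp: "\<bar>t\<bar> < p / 2" using cis_in_arc_iff[OF t(2)] assms t by simp
  have "rot k z \<in> S1" using rot_S1 zS by (simp add: rot_def)
  moreover have "rot k z \<notin> arc"
  proof
    assume r: "rot k z \<in> arc"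
    obtain s where s: "rot k z = cis s" "\<bar>s\<bar> \<le> pi" using S1_arg[OF \<open>rot k z \<in> S1\<close>] .
    have sp: "\<bar>s\<bar> < p / 2" using cis_in_arc_iff[OF s(2)] r s by simp
    have "cis (t + p * of_int k) = cis s" using s t by (simp add: rot_def cis_mult add.commute)
    then obtain j :: int where "t + p * of_int k = s + 2 * pi * of_int j" using cis_eq_iff by blast
    then have "p * of_int (k - int N * j) = s - t" using N_p(2) by (simp add: algebra_simps)
    then have "\<bar>p * of_int (k - int N * j)\<bar> < p" using sp tp by simp
    then have "p * \<bar>of_int (k - int N * j)\<bar> < p * 1" using p_pos by (simp add: abs_mult)
    then have "\<bar>of_int (k - int N * j)\<bar> < (1::real)" using p_pos by (simp only: mult_less_cancel_left_pos)
    then have "k = int N * j" by linarith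
    then show False using assms(2) by simp
  qed
  ultimately show ?thesis by blast
qed

text \<open>Outside the arc the angle keeps distance at least \<open>p / 2\<close> from the full
  turns, so \<open>lift_far\<close> puts the image within \<open>\<epsilon>\<close> of 1 in
  angle.\<close>

lemma flip_arc: assumes "z \<in> S1 - arc" shows "inv_flip z \<in> arc"
proof -
  obtain t where t: "z = cis t" "p / 2 \<le> t" "t < p / 2 + 2 * pi" using S1_lift[of z "p / 2"] assms by auto
  have le: "t \<le> 2 * pi - p / 2"
  proof (rule ccontr)
    assume "\<not> ?thesis"
    then have "\<bar>t - 2 * pi\<bar> < p / 2 \<or> t - 2 * pi = p / 2" using t by (auto simp: abs_if)
    then have "\<bar>t - 2 * pi\<bar> < p / 2" using t by auto
    moreover have "\<bar>t - 2 * pi\<bar> \<le> pi" using calculation p_le_pi by linarith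
    ultimately have "cis (t - 2 * pi) \<in> arc" using cis_in_arc_iff by blast
    moreover have "cis (t - 2 * pi) = cis t" using cis_shift[of t "-1"] by simp
    ultimately show False using assms t by simp
  qed
  have "2 * pi - \<epsilon> \<le> \<phi> t" "\<phi> t \<le> 2 * pi + \<epsilon>" using lift_far[of t] t le p_pos by auto
  then have "\<bar>\<phi> t - 2 * pi\<bar> < p / 2" using \<epsilon> p_pos by linarith
  moreover have "\<bar>\<phi> t - 2 * pi\<bar> \<le> pi" using calculation p_le_pi by linarith
  ultimately have "cis (\<phi> t - 2 * pi) \<in> arc" using cis_in_arc_iff by blast
  moreover have "cis (\<phi> t - 2 * pi) = cis (\<phi> t)" using cis_shift[of "\<phi> t" "-1"] by simp
  ultimately show ?thesis using assms t flip_cis by (simp add: inv_flip_def)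
qed

text \<open>Nontrivial rotations move \<open>arc\<close> off itself, and their conjugates do the
  same with the image of \<open>arc\<close> under the involution; a point of both sets leaves
  \<open>home\<close> under any nontrivial letter.\<close>

definition home :: "complex set" where "home = {z \<in> arc. inv_flip z \<in> arc}"

lemma home_point: "cis (p / 4) \<in> home"
proof -
  have "cis (p / 4) \<in> arc" using cis_in_arc_iff[of "p / 4"] p_pos p_le_pi by simp
  moreover have "cis (\<phi> (p / 4)) = cis (- \<epsilon>)" unfolding lift_\<epsilon> using cis_shift[of "- \<epsilon>" 1] by simp
  then have "inv_flip (cis (p / 4)) \<in> arc"
    using cis_in_arc_iff[of "- \<epsilon>"] \<epsilon> p_pos p_le_pi flip_cis by (simp add: inv_flip_def)
  ultimately show ?thesis by (simp add: home_def)
qed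

lemma home_open: obtains d where "d > 0" "\<And>z. z \<in> S1 \<Longrightarrow> dist z (cis (p / 4)) < d \<Longrightarrow> z \<in> home"
proof -
  let ?z = "cis (p / 4)"
  have "continuous_on S1 (\<lambda>z. Re (inv_flip z))"
    using inv_flip_Homeo_plus unfolding mem_Homeo_plus_iff homeomorphism_def by (auto intro: continuous_on_Re)
  moreover have "Re (inv_flip ?z) - cos (p / 2) > 0" using home_point by (simp add: home_def arc_def)
  ultimately obtain d1 where d1: "d1 > 0"
    "\<And>z. z \<in> S1 \<Longrightarrow> dist z ?z < d1 \<Longrightarrow> dist (Re (inv_flip z)) (Re (inv_flip ?z)) < Re (inv_flip ?z) - cos (p / 2)"
    unfolding continuous_on_iff by (meson cis_in_S1)
  define d2 where "d2 = Re ?z - cos (p / 2)"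
  have d2: "d2 > 0" using home_point by (simp add: d2_def home_def arc_def)
  have "z \<in> home" if z: "z \<in> S1" "dist z ?z < min d1 d2" for z
  proof -
    have "\<bar>Re z - Re ?z\<bar> < d2" using z abs_Re_le_cmod[of "z - ?z"] by (simp add: dist_norm)
    then have "z \<in> arc" using z by (simp add: arc_def d2_def)
    moreover have "cos (p / 2) < Re (inv_flip z)" using d1(2)[OF z(1)] z(2) by (simp add: dist_real_def)
    moreover have "inv_flip z \<in> S1" using Homeo_plus_S1[OF inv_flip_Homeo_plus z(1)] .
    ultimately show ?thesis by (simp add: home_def arc_def)
  qed
  then show ?thesis using that[of "min d1 d2"] d1(1) d2 by simp
qed

end

section \<open>Ping-pong\<close>

locale ping_pong = two_groups G H + flip_group c N p \<epsilon>
  for G :: "('a, 'c) monoid_scheme" (structure) and H :: "('b, 'd) monoid_scheme" (structure)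
    and c N p \<epsilon> +
  fixes \<kappa> :: "'a \<Rightarrow> int" and \<mu> :: "'b \<Rightarrow> int"
  assumes \<kappa>_mult: "\<lbrakk>x \<in> carrier G; y \<in> carrier G\<rbrakk> \<Longrightarrow> int N dvd \<kappa> (x \<otimes>\<^bsub>G\<^esub> y) - (\<kappa> x + \<kappa> y)"
    and \<kappa>_one: "x \<in> carrier G \<Longrightarrow> int N dvd \<kappa> x \<longleftrightarrow> x = \<one>\<^bsub>G\<^esub>"
    and \<mu>_mult: "\<lbrakk>x' \<in> carrier H; y' \<in> carrier H\<rbrakk> \<Longrightarrow> int N dvd \<mu> (x' \<otimes>\<^bsub>H\<^esub> y') - (\<mu> x' + \<mu> y')"
    and \<mu>_one: "x' \<in> carrier H \<Longrightarrow> int N dvd \<mu> x' \<longleftrightarrow> x' = \<one>\<^bsub>H\<^esub>"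
begin

abbreviation "\<H> \<equiv> Homeo_plus"

lemma rot_mult: "rot j \<otimes>\<^bsub>\<H>\<^esub> rot k = rot (j + k)"
  using Homeo_plus_mult[OF rot_Homeo_plus rot_Homeo_plus] rot_compose by simp

lemma inv_flip_mult: "inv_flip \<otimes>\<^bsub>\<H>\<^esub> inv_flip = \<one>\<^bsub>\<H>\<^esub>"
  using Homeo_plus_mult[OF inv_flip_Homeo_plus inv_flip_Homeo_plus] inv_flip_involution Homeo_plus_one by simp

definition left :: "'a \<Rightarrow> complex \<Rightarrow> complex" where "left x = rot (\<kappa> x)"

definition right :: "'b \<Rightarrow> complex \<Rightarrow> complex"
  where "right y = inv_flip \<otimes>\<^bsub>\<H>\<^esub> (rot (\<mu> y) \<otimes>\<^bsub>\<H>\<^esub> inv_flip)"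

lemma left_hom: "left \<in> hom G \<H>"
proof (rule homI)
  show "left x \<in> carrier \<H>" for x by (simp add: left_def rot_Homeo_plus)
  fix x y assume "x \<in> carrier G" "y \<in> carrier G"
  then show "left (x \<otimes>\<^bsub>G\<^esub> y) = left x \<otimes>\<^bsub>\<H>\<^esub> left y"
    using rot_eq[OF \<kappa>_mult] by (simp add: left_def rot_mult)
qed

lemma right_hom: "right \<in> hom H \<H>"
proof (rule homI)
  interpret K: group \<H> by (rule group_Homeo_plus)
  note [simp] = rot_Homeo_plus inv_flip_Homeo_plus
  show "right y \<in> carrier \<H>" for y by (simp add: right_def)
  fix x y assume xy: "x \<in> carrier H" "y \<in> carrier H"
  have "right x \<otimes>\<^bsub>\<H>\<^esub> right y
      = inv_flip \<otimes>\<^bsub>\<H>\<^esub> (rot (\<mu> x) \<otimes>\<^bsub>\<H>\<^esub> ((inv_flip \<otimes>\<^bsub>\<H>\<^esub> inv_flip) \<otimes>\<^bsub>\<H>\<^esub> (rot (\<mu> y) \<otimes>\<^bsub>\<H>\<^esub> inv_flip)))"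
    by (simp add: right_def K.m_assoc)
  also have "\<dots> = inv_flip \<otimes>\<^bsub>\<H>\<^esub> ((rot (\<mu> x) \<otimes>\<^bsub>\<H>\<^esub> rot (\<mu> y)) \<otimes>\<^bsub>\<H>\<^esub> inv_flip)"
    by (simp add: inv_flip_mult K.m_assoc)
  also have "\<dots> = right (x \<otimes>\<^bsub>H\<^esub> y)"
    using rot_eq[OF \<mu>_mult[OF xy]] by (simp add: right_def rot_mult)
  finally show "right (x \<otimes>\<^bsub>H\<^esub> y) = right x \<otimes>\<^bsub>\<H>\<^esub> right y" ..
qed

definition letter :: "'a + 'b \<Rightarrow> complex \<Rightarrow> complex" where "letter = case_sum left right"

definition act :: "('a + 'b) list \<Rightarrow> complex \<Rightarrow> complex"
  where "act w = foldr (\<lambda>l k. letter l \<otimes>\<^bsub>\<H>\<^esub> k) w \<one>\<^bsub>\<H>\<^esub>"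

lemma act_Nil: "act [] = \<one>\<^bsub>\<H>\<^esub>" and act_Cons: "act (l # w) = letter l \<otimes>\<^bsub>\<H>\<^esub> act w"
  by (simp_all add: act_def)

lemma letter_Homeo_plus: "l \<in> carrier G <+> carrier H \<Longrightarrow> letter l \<in> carrier \<H>"
  using hom_in_carrier[OF left_hom] hom_in_carrier[OF right_hom] by (auto simp: letter_def)

lemma act_Homeo_plus: "w \<in> fp_words G H \<Longrightarrow> act w \<in> carrier \<H>"
proof (induction w)
  case Nil
  then show ?case using group.is_monoid[OF group_Homeo_plus] by (simp add: act_Nil monoid.one_closed)
next
  case (Cons l w)
  then have "letter l \<in> carrier \<H>" "act w \<in> carrier \<H>" using letter_Homeo_plus by auto
  then show ?case using group.is_monoid[OF group_Homeo_plus] by (simp add: act_Cons monoid.m_closed)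
qed

text \<open>Properties of all elements are checked on the rotations and on the involution, although
  the involution itself need not belong to the group.\<close>

lemma act_induct:
  assumes w: "w \<in> fp_words G H" and one: "P (\<lambda>z\<in>S1. z)"
    and comp: "\<And>g h. g \<in> carrier \<H> \<Longrightarrow> h \<in> carrier \<H> \<Longrightarrow> P g \<Longrightarrow> P h \<Longrightarrow> P (compose S1 g h)"
    and gens: "\<And>k. P (rot k)" "P inv_flip"
  shows "P (act w)"
proof -
  have mult: "P (g \<otimes>\<^bsub>\<H>\<^esub> h)" if "g \<in> carrier \<H>" "h \<in> carrier \<H>" "P g" "P h" for g h
    using comp[OF that] Homeo_plus_mult[OF that(1,2)] by simp
  have closed: "rot k \<otimes>\<^bsub>\<H>\<^esub> inv_flip \<in> carrier \<H>" for k
    using group.is_monoid[OF group_Homeo_plus] rot_Homeo_plus inv_flip_Homeo_plus by (simp add: monoid.m_closed)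
  have P_letter: "P (letter l)" for l
    using mult rot_Homeo_plus inv_flip_Homeo_plus closed gens
    by (cases l) (simp_all add: letter_def left_def right_def)
  show ?thesis
    using w
  proof (induction w)
    case Nil
    show ?case unfolding act_Nil Homeo_plus_one by (rule one)
  next
    case (Cons l w)
    then have "letter l \<in> carrier \<H>" "act w \<in> carrier \<H>" "P (act w)"
      using letter_Homeo_plus act_Homeo_plus by auto
    then show ?case unfolding act_Cons using mult P_letter by blast
  qed
qed

lemma letter_apply:
  assumes "z \<in> S1"
  shows "letter (Inl x) z = rot (\<kappa> x) z" "letter (Inr y) z = inv_flip (rot (\<mu> y) (inv_flip z))"
proof -
  show "letter (Inl x) z = rot (\<kappa> x) z" by (simp add: letter_def left_def)
  have closed: "rot (\<mu> y) \<otimes>\<^bsub>\<H>\<^esub> inv_flip \<in> carrier \<H>"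
    using group.is_monoid[OF group_Homeo_plus] rot_Homeo_plus inv_flip_Homeo_plus by (simp add: monoid.m_closed)
  show "letter (Inr y) z = inv_flip (rot (\<mu> y) (inv_flip z))"
    using assms Homeo_plus_mult[OF inv_flip_Homeo_plus closed] Homeo_plus_mult[OF rot_Homeo_plus inv_flip_Homeo_plus]
    by (simp add: letter_def right_def compose_def)
qed

lemma inv_flip_inv_flip: "z \<in> S1 \<Longrightarrow> inv_flip (inv_flip z) = z"
  using flip_S1 flip_flip by (simp add: inv_flip_def)

text \<open>The head of the word is applied last and decides where the base point ends up.
  Reducedness makes the letter before it come from the other factor, so \<open>flip_arc\<close> puts
  the point where the head acts; letters from \<open>H\<close> are viewed through the involution,
  which conjugates them to rotations.\<close>

lemma ping_pong:
  assumes "w \<in> fp_words G H" "reduced w" "w \<noteq> []"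
  shows "if isl (hd w) then act w (cis (p / 4)) \<in> S1 - arc else inv_flip (act w (cis (p / 4))) \<in> S1 - arc"
  using assms
proof (induction w rule: list.induct)
  case (Cons l w)
  let ?z = "cis (p / 4)" and ?y = "act w (cis (p / 4))"
  have wf: "w \<in> fp_words G H" "l \<in> carrier G <+> carrier H" using Cons.prems(1) by auto
  have yS: "?y \<in> S1" by (rule Homeo_plus_S1[OF act_Homeo_plus[OF wf(1)]]) simp
  have act: "act (l # w) ?z = letter l ?y"
    unfolding act_Cons Homeo_plus_mult[OF letter_Homeo_plus[OF wf(2)] act_Homeo_plus[OF wf(1)]]
    by (simp add: compose_def)
  have IH: "if isl (hd w) then ?y \<in> S1 - arc else inv_flip ?y \<in> S1 - arc" if "w \<noteq> []"
    using Cons.IH[OF wf(1)] Cons.prems(2) that by simp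
  have nil: "?y = ?z" if "w = []" using that by (simp add: act_Nil Homeo_plus_one)
  show ?case
  proof (cases l)
    case (Inl x)
    then have x: "x \<in> carrier G" "x \<noteq> \<one>\<^bsub>G\<^esub>" using wf(2) Cons.prems(2) by auto
    have "?y \<in> arc"
    proof (cases "w = []")
      case True
      then show ?thesis using nil home_point by (simp add: home_def)
    next
      case False
      then have "inv_flip ?y \<in> S1 - arc" using IH Cons.prems(2) Inl by auto
      then show ?thesis using flip_arc[of "inv_flip ?y"] inv_flip_inv_flip[OF yS] by simp
    qed
    then have "rot (\<kappa> x) ?y \<in> S1 - arc" using x \<kappa>_one by (intro rot_arc) auto
    then show ?thesis unfolding act using letter_apply(1)[OF yS] Inl by simp
  next
    case (Inr y)
    then have y: "y \<in> carrier H" "y \<noteq> \<one>\<^bsub>H\<^esub>" using wf(2) Cons.prems(2) by auto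
    have "inv_flip ?y \<in> arc"
    proof (cases "w = []")
      case True
      then show ?thesis using nil home_point by (simp add: home_def)
    next
      case False
      then have "?y \<in> S1 - arc" using IH Cons.prems(2) Inr by auto
      then show ?thesis by (rule flip_arc)
    qed
    then have r: "rot (\<mu> y) (inv_flip ?y) \<in> S1 - arc" using y \<mu>_one by (intro rot_arc) auto
    then have "inv_flip (letter l ?y) \<in> S1 - arc"
      using letter_apply(2)[OF yS, of y] Inr inv_flip_inv_flip[of "rot (\<mu> y) (inv_flip ?y)"] by simp
    then show ?thesis unfolding act using Inr by simp
  qed
qed simp

lemma reduced_moves_home:
  assumes "w \<in> fp_words G H" "reduced w" "w \<noteq> []" shows "act w (cis (p / 4)) \<notin> home"
  using ping_pong[OF assms] by (auto simp: home_def split: if_splits)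

theorem pseudo_fibered_action:
  assumes fin: "finite (carrier G)" "finite (carrier H)"
  shows "\<exists>\<rho> \<in> hom (free_product G H) Homeo_plus.
    inj_on \<rho> (carrier (free_product G H)) \<and> pseudo_fibered (\<rho> ` carrier (free_product G H))"
proof -
  let ?F = "free_product G H" and ?z = "cis (p / 4)"
  interpret F: group ?F by (rule group_free_product)
  interpret K: group \<H> by (rule group_Homeo_plus)
  obtain \<rho> where \<rho>: "\<rho> \<in> hom ?F \<H>"
    "\<And>x. x \<in> carrier G \<Longrightarrow> \<rho> (fp_class G H [Inl x]) = left x"
    "\<And>y. y \<in> carrier H \<Longrightarrow> \<rho> (fp_class G H [Inr y]) = right y"
    using free_product_universal[OF group_Homeo_plus left_hom right_hom] by blast
  interpret h: group_hom ?F \<H> \<rho> by unfold_locales (rule \<rho>(1))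
  have \<rho>_act: "\<rho> (fp_class G H w) = act w" if "w \<in> fp_words G H" for w
    using that
  proof (induction w)
    case Nil
    then show ?case using h.hom_one by (simp add: one_free_product act_Nil)
  next
    case (Cons l w)
    then have lw: "[l] \<in> fp_words G H" "w \<in> fp_words G H" "l \<in> carrier G <+> carrier H" by auto
    have "fp_class G H (l # w) = fp_class G H [l] \<otimes>\<^bsub>?F\<^esub> fp_class G H w"
      using mult_fp_class[OF lw(1,2)] by simp
    moreover have "\<rho> (fp_class G H [l]) = letter l"
      using \<rho>(2,3) lw(3) by (cases l) (auto simp: letter_def)
    ultimately show ?case using h.hom_mult lw Cons.IH by (simp add: carrier_free_product act_Cons)
  qed
  let ?\<Gamma> = "\<rho> ` carrier ?F"
  have \<Gamma>: "?\<Gamma> = act ` fp_words G H"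
    unfolding carrier_free_product image_image by (intro image_cong) (simp_all add: \<rho>_act)
  have reduce: "\<exists>v \<in> fp_words G H. reduced v \<and> x = fp_class G H v" if x: "x \<in> carrier ?F" for x
  proof -
    obtain w where w: "w \<in> fp_words G H" "x = fp_class G H w" using x by (auto simp: carrier_free_product)
    obtain v where "v \<in> fp_words G H" "reduced v" "fp_eq G H w v" using reduced_exists[OF w(1)] by blast
    then show ?thesis using w fp_class_eq_iff by blast
  qed
  have moves: "\<rho> x ?z \<notin> home" if x: "x \<in> carrier ?F" and ne: "x \<noteq> \<one>\<^bsub>?F\<^esub>" for x
  proof -
    obtain v where v: "v \<in> fp_words G H" "reduced v" "x = fp_class G H v" using reduce[OF x] by blast
    then have "v \<noteq> []" using ne by (auto simp: one_free_product)
    then show ?thesis using reduced_moves_home v \<rho>_act by simp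
  qed
  have inj: "inj_on \<rho> (carrier ?F)"
    unfolding h.inj_on_one_iff
  proof (intro allI impI)
    fix x assume x: "x \<in> carrier ?F" "\<rho> x = \<one>\<^bsub>\<H>\<^esub>"
    then have "\<rho> x ?z \<in> home" using home_point by (simp add: Homeo_plus_one)
    then show "x = \<one>\<^bsub>?F\<^esub>" using moves x by blast
  qed
  have sub: "subgroup ?\<Gamma> \<H>" by (rule h.img_is_subgroup)
  \<comment> \<open>Nontrivial elements throw the base point out of \<open>home\<close>, which
    contains a whole neighbourhood of it, so they move it by at least \<open>d\<close>.\<close>
  obtain d where d: "d > 0" "\<And>z. z \<in> S1 \<Longrightarrow> dist z ?z < d \<Longrightarrow> z \<in> home" using home_open by blast
  have discrete: "discrete_subgroup ?\<Gamma>"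
  proof (rule discrete_subgroupI[OF sub _ d(1)])
    fix k assume k: "k \<in> ?\<Gamma>" "k \<noteq> \<one>\<^bsub>\<H>\<^esub>"
    then obtain x where x: "x \<in> carrier ?F" "k = \<rho> x" by blast
    then have "x \<noteq> \<one>\<^bsub>?F\<^esub>" using k(2) h.hom_one by metis
    then have "k ?z \<notin> home" using moves x by simp
    moreover have "k ?z \<in> S1" using Homeo_plus_S1[of k ?z] x h.hom_closed by simp
    ultimately show "d \<le> dist (k ?z) ?z" using d(2) by (meson not_le)
  qed simp
  obtain f1 f2 where f: "finite_circle_height f1" "finite_circle_height f2"
    "endpoints (lam f1) \<inter> endpoints (lam f2) = {}"
    "\<And>f. f = f1 \<or> f = f2 \<Longrightarrow> preserves f (flip c)"
    "\<And>f k. f = f1 \<or> f = f2 \<Longrightarrow> preserves f (\<lambda>z. cis (p * of_int k) * z)"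
    by (rule two_heights) blast
  interpret A: finite_circle_height f1 by (rule f(1))
  interpret B: finite_circle_height f2 by (rule f(2))
  have pres: "preserves f g" if fi: "f = f1 \<or> f = f2" and g: "g \<in> ?\<Gamma>" for f g
  proof -
    obtain w where w: "w \<in> fp_words G H" "g = act w" using g \<Gamma> by blast
    show ?thesis unfolding w(2)
      by (rule act_induct[OF w(1)])
        (use preserves_id preserves_compose f(4,5)[OF fi] in
          \<open>simp_all only: rot_def inv_flip_def preserves_restrict_iff\<close>)
  qed
  have inv: "invariant_lamination ?\<Gamma> (lam f1)" "invariant_lamination ?\<Gamma> (lam f2)"
    unfolding invariant_lamination_def using A.lamination_lam B.lamination_lam pres preserves_lam by blast+
  have mob: "mobius g" if g: "g \<in> ?\<Gamma>" for g
  proof -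
    obtain w where w: "w \<in> fp_words G H" "g = act w" using g \<Gamma> by blast
    have "mobius (\<lambda>z\<in>S1. z)" using mobius_rot[of 0] by (simp add: rot_0)
    then show ?thesis unfolding w(2)
      by (rule act_induct[OF w(1)]) (use mobius_compose Homeo_plus_S1 mobius_rot mobius_inv_flip in blast)+
  qed
  have fixed: "countable {z \<in> S1. g z = z}" if g: "g \<in> ?\<Gamma>" "g \<noteq> \<one>\<^bsub>\<H>\<^esub>" for g
  proof -
    have "g \<in> carrier \<H>" using g sub subgroup.subset by blast
    then have "g \<in> extensional S1" by (simp add: mem_Homeo_plus_iff)
    then have "finite {z \<in> S1. g z = z}"
      using mobius_fixed_points[OF mob[OF g(1)]] g(2) Homeo_plus_one by metis
    then show ?thesis by (rule countable_finite)
  qed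
  let ?X = "letter ` (carrier G <+> carrier H)"
  have X: "finite ?X" using fin by simp
  have X_sub: "?X \<subseteq> ?\<Gamma>"
  proof
    fix g assume "g \<in> ?X"
    then obtain l where l: "l \<in> carrier G <+> carrier H" "g = letter l" by blast
    then have "[l] \<in> fp_words G H" by auto
    moreover have "act [l] = letter l" using letter_Homeo_plus[OF l(1)] by (simp add: act_Cons act_Nil)
    ultimately show "g \<in> ?\<Gamma>" unfolding \<Gamma> l(2) by (intro image_eqI[of _ _ "[l]"]) auto
  qed
  have gen: "generate \<H> ?X = ?\<Gamma>"
  proof
    show "generate \<H> ?X \<subseteq> ?\<Gamma>" by (rule K.generate_subgroup_incl[OF X_sub sub])
    show "?\<Gamma> \<subseteq> generate \<H> ?X"
    proof
      fix g assume "g \<in> ?\<Gamma>"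
      then obtain w where "w \<in> fp_words G H" "g = act w" using \<Gamma> by blast
      moreover have "act w \<in> generate \<H> ?X" if "w \<in> fp_words G H" for w
        using that
      proof (induction w)
        case Nil
        then show ?case by (simp add: act_Nil generate.one)
      next
        case (Cons l w)
        then have "letter l \<in> ?X" "act w \<in> generate \<H> ?X" by auto
        then show ?case unfolding act_Cons by (rule generate.eng[OF generate.incl])
      qed
      ultimately show "g \<in> generate \<H> ?X" by blast
    qed
  qed
  have "laminar_group ?\<Gamma>"
    unfolding laminar_group_def dense_lamination_def
    using discrete A.lamination_lam A.dense_lam inv(1) by blast
  then have "pseudo_fibered ?\<Gamma>"
    unfolding pseudo_fibered_def
    using X X_sub gen inv A.very_full_lam A.loose_lam B.very_full_lam B.loose_lam f(3) fixed by blast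
  then show ?thesis using \<rho>(1) inj by blast
qed

end

theorem theorem3p1:
  fixes G :: "('a, 'c) monoid_scheme" and H :: "('b, 'd) monoid_scheme"
  assumes "group G" and "finite (carrier G)" and "cyclic_group G"
    and "group H" and "finite (carrier H)" and "cyclic_group H"
  shows "\<exists>\<rho> \<in> hom (free_product G H) Homeo_plus.
    inj_on \<rho> (carrier (free_product G H)) \<and>
    pseudo_fibered (\<rho> ` carrier (free_product G H))"
proof -
  interpret G: group G by fact
  interpret H: group H by fact
  \<comment> \<open>The factor 2 secures \<open>N \<ge> 2\<close> when both groups are
    trivial.\<close>
  define N where "N = 2 * (order G * order H)"
  have "order G > 0" "order H > 0" using assms G.order_gt_0_iff_finite H.order_gt_0_iff_finite by auto
  then have "order G * order H \<ge> 1" by (simp add: Suc_leI)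
  then have N: "N \<ge> 2" unfolding N_def by linarith
  obtain \<kappa> where \<kappa>:
    "\<And>x y. x \<in> carrier G \<Longrightarrow> y \<in> carrier G \<Longrightarrow> int N dvd \<kappa> (x \<otimes>\<^bsub>G\<^esub> y) - (\<kappa> x + \<kappa> y)"
    "\<And>x. x \<in> carrier G \<Longrightarrow> int N dvd \<kappa> x \<longleftrightarrow> x = \<one>\<^bsub>G\<^esub>"
    using G.finite_cyclic_exponent[of N] assms N by (auto simp: N_def)
  obtain \<mu> where \<mu>:
    "\<And>x y. x \<in> carrier H \<Longrightarrow> y \<in> carrier H \<Longrightarrow> int N dvd \<mu> (x \<otimes>\<^bsub>H\<^esub> y) - (\<mu> x + \<mu> y)"
    "\<And>x. x \<in> carrier H \<Longrightarrow> int N dvd \<mu> x \<longleftrightarrow> x = \<one>\<^bsub>H\<^esub>"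
    using H.finite_cyclic_exponent[of N] assms N by (auto simp: N_def)
  define p where "p = 2 * pi / N"
  have "p / 4 > 0" using N by (simp add: p_def)
  moreover have "p / 4 \<le> pi / 2" using N by (simp add: p_def field_simps)
  ultimately obtain c \<epsilon> where flip: "mobius_flip c" "0 < \<epsilon>" "\<epsilon> < p / 4 / 2" "flip_lift c (p / 4) = 2 * pi - \<epsilon>"
    "\<And>x y. - \<epsilon> \<le> x \<Longrightarrow> x \<le> y \<Longrightarrow> y \<le> \<epsilon> \<Longrightarrow> 2 * (y - x) \<le> flip_lift c y - flip_lift c x"
    using mobius_flip_exists by blast
  interpret mobius_flip c by (rule flip(1))
  interpret ping_pong G H c N p \<epsilon> \<kappa> \<mu>
    by unfold_locales (use N flip \<kappa> \<mu> in \<open>auto simp: p_def\<close>)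
  show ?thesis by (rule pseudo_fibered_action) fact+
qed

end
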